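(* Let $1<p<\infty$, let $\Omega\subset\mathbf{R}^N$ be a bounded convex domain, and let $k\ge 0$ be a fixed integer. Then there exists $D_0=D_0(k,p,\mathrm{diam}(\Omega))\ge \mathrm{diam}(\Omega)/2$ (depending only on $k$, $p$ and $\mathrm{diam}(\Omega)$) such that for every $D\ge D_0$ one has $1-\eta_D-a\eta_D^2\ge 0$ (so that the power below is defined) and $$\int_{\Omega}|\nabla u|^p\,dx \ \geq\ \Bigl(\frac{p-1}{p}\Bigr)^p\int_{\Omega}\frac{|u|^p}{d^p}\,dx + \frac{1}{2}\Bigl(\frac{p-1}{p}\Bigr)^{p-1}\sum_{i=1}^k\int_{\Omega}\frac{|u|^p}{d^p}X_1^2(d/D)\cdots X_i^2(d/D)\,dx + k_p\,(1-\eta_D-a\eta_D^2)^{\frac{p}{p-1}} \Bigl(\frac{a_N}{|\Omega|}\Bigr)^{\frac{p}{N}} \int_{\Omega}|u|^p\,dx$$ for all $u\in W^{1,p}_0(\Omega)$. Moreover, when $p=2$ and $k\ge 1$, one can take as $D_0$ the unique solution of $\eta_{D_0}=1$.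
   Context: Here $d=d(x)=\mathrm{dist}(x,\partial\Omega)$, $|\Omega|$ is the volume of $\Omega$, and $a_N$ is the volume of the unit ball of $\mathbf{R}^N$. For $t\in(0,1]$ set $X_1(t)=(1-\log t)^{-1}$ and recursively $X_i(t)=X_1(X_{i-1}(t))$ for $i=2,3,\ldots$. For $k\ge 1$ set $\eta(t)=\sum_{i=1}^k X_1(t)\cdots X_i(t)$; for $k=0$ set $\eta=0$ (and the sum over $i$ in the inequality is empty). For $D\ge\mathrm{diam}(\Omega)/2$ set $\eta_D=\eta\bigl(\frac{\mathrm{diam}(\Omega)}{2D}\bigr)$. The constant $a$ is $a=0$ if $1<p\le 2$, and $a=\frac{(p-2)k}{3(p-1)}$ if $p>2$. The constant $k_p$ is $$k_p=(p-1)\Bigl(\frac{p-1}{p}\Bigr)^p\,\frac{\sqrt{\pi}\,\Gamma\bigl(\frac{N+p}{2}\bigr)}{\Gamma\bigl(\frac{p+1}{2}\bigr)\Gamma\bigl(\frac{N}{2}\bigr)}.$$ *)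

theory Defs
  imports "HOL-Analysis.Analysis"
begin

text \<open>
  The constant \<open>D\<^sub>0\<close> must not depend on the dimension, so the dimension \<open>N\<close> is a term and not
  a type: the points of \<open>\<real>\<^sup>N\<close> are the extensional functions on \<open>{..<N}\<close>, which are the points
  both of the product topology below and of the product measure \<open>Pi\<^sub>M {..<N}\<close>.
\<close>

abbreviation RN :: "nat \<Rightarrow> (nat \<Rightarrow> real) topology" where
  "RN N \<equiv> powertop_real {..<N}"

definition leb :: "nat \<Rightarrow> (nat \<Rightarrow> real) measure" where
  "leb N = completion (Pi\<^sub>M {..<N} (\<lambda>_. lborel))"

definition edist :: "nat \<Rightarrow> (nat \<Rightarrow> real) \<Rightarrow> (nat \<Rightarrow> real) \<Rightarrow> real" where
  "edist N x y = L2_set (\<lambda>i. x i - y i) {..<N}"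

definition ediam :: "nat \<Rightarrow> (nat \<Rightarrow> real) set \<Rightarrow> real" where
  "ediam N S = (SUP (x, y) \<in> S \<times> S. edist N x y)"

definition bdry_dist :: "nat \<Rightarrow> (nat \<Rightarrow> real) set \<Rightarrow> (nat \<Rightarrow> real) \<Rightarrow> real" where
  "bdry_dist N \<Omega> x = (INF y \<in> RN N frontier_of \<Omega>. edist N x y)"

definition volume :: "nat \<Rightarrow> (nat \<Rightarrow> real) set \<Rightarrow> real" where
  "volume N S = measure (leb N) S"

definition unit_ball :: "nat \<Rightarrow> (nat \<Rightarrow> real) set" where
  "unit_ball N = {x \<in> topspace (RN N). L2_set x {..<N} < 1}"

definition bounded_convex_domain :: "nat \<Rightarrow> (nat \<Rightarrow> real) set \<Rightarrow> bool" where
  "bounded_convex_domain N \<Omega> \<longleftrightarrow>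
     \<Omega> \<noteq> {} \<and> openin (RN N) \<Omega> \<and> connectedin (RN N) \<Omega> \<and>
     (\<exists>B. \<forall>x\<in>\<Omega>. L2_set x {..<N} \<le> B) \<and>
     (\<forall>x\<in>\<Omega>. \<forall>y\<in>\<Omega>. \<forall>t\<in>{0..1}. (\<lambda>i\<in>{..<N}. (1 - t) * x i + t * y i) \<in> \<Omega>)"

definition pdiff :: "nat \<Rightarrow> ((nat \<Rightarrow> real) \<Rightarrow> real) \<Rightarrow> (nat \<Rightarrow> real) \<Rightarrow> real" where
  "pdiff i f x = deriv (\<lambda>t. f (x(i := t))) (x i)"

text \<open>Smooth means that all iterated partial derivatives exist everywhere and are continuous.\<close>

definition smooth :: "nat \<Rightarrow> ((nat \<Rightarrow> real) \<Rightarrow> real) \<Rightarrow> bool" where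
  "smooth N f \<longleftrightarrow>
     (\<forall>is. set is \<subseteq> {..<N} \<longrightarrow>
        continuous_map (RN N) euclideanreal (fold pdiff is f) \<and>
        (\<forall>x\<in>topspace (RN N). \<forall>i<N.
           (\<lambda>t. fold pdiff is f (x(i := t))) differentiable (at (x i))))"

definition test_functions :: "nat \<Rightarrow> (nat \<Rightarrow> real) set \<Rightarrow> ((nat \<Rightarrow> real) \<Rightarrow> real) set" where
  "test_functions N \<Omega> =
     {\<phi>. smooth N \<phi> \<and>
         (\<exists>K. compactin (RN N) K \<and> K \<subseteq> \<Omega> \<and> (\<forall>x\<in>topspace (RN N) - K. \<phi> x = 0))}"

definition L1_loc :: "nat \<Rightarrow> (nat \<Rightarrow> real) set \<Rightarrow> ((nat \<Rightarrow> real) \<Rightarrow> real) set" where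
  "L1_loc N \<Omega> = {f. \<forall>K. compactin (RN N) K \<and> K \<subseteq> \<Omega> \<longrightarrow> set_integrable (leb N) K f}"

definition Lp :: "nat \<Rightarrow> real \<Rightarrow> (nat \<Rightarrow> real) set \<Rightarrow> ((nat \<Rightarrow> real) \<Rightarrow> real) set" where
  "Lp N p \<Omega> = {f. set_borel_measurable (leb N) \<Omega> f \<and>
                   set_integrable (leb N) \<Omega> (\<lambda>x. \<bar>f x\<bar> powr p)}"

text \<open>\<open>G i\<close> is the weak partial derivative of \<open>u\<close> in direction \<open>i\<close>; it is determined almost
  everywhere in \<open>\<Omega>\<close> by \<open>u\<close>.\<close>

definition weak_gradient ::
  "nat \<Rightarrow> (nat \<Rightarrow> real) set \<Rightarrow> ((nat \<Rightarrow> real) \<Rightarrow> real) \<Rightarrow> (nat \<Rightarrow> (nat \<Rightarrow> real) \<Rightarrow> real) \<Rightarrow> bool" where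
  "weak_gradient N \<Omega> u G \<longleftrightarrow>
     u \<in> L1_loc N \<Omega> \<and>
     (\<forall>i<N. G i \<in> L1_loc N \<Omega> \<and>
        (\<forall>\<phi>\<in>test_functions N \<Omega>.
           (LINT x:\<Omega>|leb N. u x * pdiff i \<phi> x) = - (LINT x:\<Omega>|leb N. G i x * \<phi> x)))"

text \<open>\<open>W\<^sub>0\<^sup>1\<^sup>,\<^sup>p(\<Omega>)\<close> is the closure of the test functions in \<open>W\<^sup>1\<^sup>,\<^sup>p(\<Omega>)\<close>.\<close>

definition W1p :: "nat \<Rightarrow> real \<Rightarrow> (nat \<Rightarrow> real) set \<Rightarrow> ((nat \<Rightarrow> real) \<Rightarrow> real) set" where
  "W1p N p \<Omega> = {u \<in> Lp N p \<Omega>. \<exists>G. weak_gradient N \<Omega> u G \<and> (\<forall>i<N. G i \<in> Lp N p \<Omega>)}"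

definition W1p0 :: "nat \<Rightarrow> real \<Rightarrow> (nat \<Rightarrow> real) set \<Rightarrow> ((nat \<Rightarrow> real) \<Rightarrow> real) set" where
  "W1p0 N p \<Omega> =
     {u \<in> W1p N p \<Omega>. \<exists>G \<phi>. weak_gradient N \<Omega> u G \<and> (\<forall>n. \<phi> n \<in> test_functions N \<Omega>) \<and>
        (\<lambda>n. (\<integral>\<^sup>+x\<in>\<Omega>. ennreal (\<bar>\<phi> n x - u x\<bar> powr p) \<partial>leb N) +
             (\<Sum>i<N. \<integral>\<^sup>+x\<in>\<Omega>. ennreal (\<bar>pdiff i (\<phi> n) x - G i x\<bar> powr p) \<partial>leb N))
          \<longlonglongrightarrow> 0}"

definition X1 :: "real \<Rightarrow> real" where
  "X1 t = 1 / (1 - ln t)"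

text \<open>With \<open>X\<^sub>0\<close> the identity, the recursion also gives \<open>X\<^sub>1\<close>.\<close>

primrec X_iter :: "nat \<Rightarrow> real \<Rightarrow> real" where
  "X_iter 0 t = t"
| "X_iter (Suc i) t = X1 (X_iter i t)"

definition eta :: "nat \<Rightarrow> real \<Rightarrow> real" where
  "eta k t = (\<Sum>i=1..k. \<Prod>j=1..i. X_iter j t)"

definition a_const :: "nat \<Rightarrow> real \<Rightarrow> real" where
  "a_const k p = (if p \<le> 2 then 0 else (p - 2) * real k / (3 * (p - 1)))"

definition k_const :: "nat \<Rightarrow> real \<Rightarrow> real" where
  "k_const N p = (p - 1) * ((p - 1) / p) powr p *
     (sqrt pi * Gamma ((real N + p) / 2) / (Gamma ((p + 1) / 2) * Gamma (real N / 2)))"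

definition defect :: "nat \<Rightarrow> real \<Rightarrow> real \<Rightarrow> real" where
  "defect k p e = 1 - e - a_const k p * e\<^sup>2"

text \<open>The integrals are nonnegative extended reals, so that the inequality contains the finiteness
  of those on the right-hand side.\<close>

definition hardy_inequality ::
  "nat \<Rightarrow> real \<Rightarrow> nat \<Rightarrow> (nat \<Rightarrow> real) set \<Rightarrow> real \<Rightarrow>
   ((nat \<Rightarrow> real) \<Rightarrow> real) \<Rightarrow> (nat \<Rightarrow> (nat \<Rightarrow> real) \<Rightarrow> real) \<Rightarrow> bool" where
  "hardy_inequality k p N \<Omega> D u G \<longleftrightarrow>
     (\<integral>\<^sup>+x\<in>\<Omega>. ennreal (L2_set (\<lambda>i. G i x) {..<N} powr p) \<partial>leb N) \<ge>
       ennreal (((p - 1) / p) powr p) *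
         (\<integral>\<^sup>+x\<in>\<Omega>. ennreal (\<bar>u x\<bar> powr p / bdry_dist N \<Omega> x powr p) \<partial>leb N)
     + ennreal (1 / 2 * ((p - 1) / p) powr (p - 1)) *
         (\<Sum>i=1..k. \<integral>\<^sup>+x\<in>\<Omega>. ennreal (\<bar>u x\<bar> powr p / bdry_dist N \<Omega> x powr p *
                                (\<Prod>j=1..i. (X_iter j (bdry_dist N \<Omega> x / D))\<^sup>2)) \<partial>leb N)
     + ennreal (k_const N p * defect k p (eta k (ediam N \<Omega> / (2 * D))) powr (p / (p - 1)) *
                (volume N (unit_ball N) / volume N \<Omega>) powr (p / real N)) *
         (\<integral>\<^sup>+x\<in>\<Omega>. ennreal (\<bar>u x\<bar> powr p) \<partial>leb N)"

end

theory Submission imports Defs "HOL-Probability.Probability"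
begin

text \<open>
  Write \<open>q = p / (p - 1)\<close>, \<open>C = ((p - 1) / p)\<^sup>p\<^sup>-\<^sup>1\<close> and \<open>g = 1 - \<eta> - a \<eta>\<^sup>2\<close>. The inequality comes from a
  one-dimensional one, averaged over all directions.

  In dimension one let \<open>g(t)\<close> stand for \<open>g\<close> at \<open>\<eta>(t / D)\<close>. The function \<open>C t\<^sup>1\<^sup>-\<^sup>p g(t)\<close> satisfies the
  Riccati inequality \<open>- H' - (p - 1) H\<^sup>q \<ge> w\<close> whose right-hand side \<open>w\<close> is the Hardy weight
  with the series. This rests on \<open>s \<eta>'(s) = (\<eta>\<^sup>2 + \<Sum>X\<^sub>1\<^sup>2\<dots>X\<^sub>i\<^sup>2) / 2\<close> and on an inequality between real numbers
  (\<open>scalar_inequality_le2\<close>, \<open>scalar_inequality_gt2\<close>) that holds as long as \<open>\<eta> \<le> 1\<close> if \<open>p \<le> 2\<close>, and for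
  small \<open>\<eta>\<close> if \<open>p > 2\<close>; this determines \<open>D\<^sub>0\<close>. On a chord of length \<open>2 b\<close> the constant
  \<open>C b\<^sup>1\<^sup>-\<^sup>p g(b)\<close> is subtracted, which makes \<open>H\<close> vanish at the midpoint. As \<open>x\<^sup>q\<close> is superadditive, this
  gains \<open>(p - 1) C\<^sup>q b\<^sup>-\<^sup>p g(b)\<^sup>q\<close>, and integration of \<open>(\<bar>u\<bar>\<^sup>p H)'\<close> from each end of the chord to its
  midpoint gives \<open>hardy_chord\<close>.

  In dimension \<open>N\<close> the chord inequality is applied to all lines in direction \<open>z\<close>, then multiplied by
  \<open>e\<close> to the power \<open>-\<bar>z\<bar>\<^sup>2\<close> and integrated over \<open>z \<in> \<real>\<^sup>N\<close>. This turns \<open>\<bar>z \<cdot> \<nabla>u\<bar>\<^sup>p\<close> into a constant multiple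
  of \<open>\<bar>\<nabla>u\<bar>\<^sup>p\<close> (\<open>nn_integral_gweight_projection\<close>). Two facts about \<open>\<Omega>\<close> bound the
  averages on the other side. First, as \<open>\<Omega>\<close> is convex, it lies on one side of the hyperplane through a nearest
  boundary point \<open>y\<close> that is orthogonal to \<open>y - x\<close>, so the distance \<open>\<rho>\<close> from \<open>x\<close> to the boundary along
  the line, in units of \<open>\<bar>z\<bar>\<close>, satisfies \<open>\<rho> \<bar>z \<cdot> (y - x)\<bar> \<le> d\<^sup>2\<close>; hence the average of \<open>\<rho>\<^sup>-\<^sup>p\<close> is at least the same
  constant times \<open>d\<^sup>-\<^sup>p\<close> (\<open>average_near\<close>). Secondly, in polar coordinates the \<open>N\<close>-th powers of the
  lengths of the rays from \<open>x\<close> average to \<open>\<bar>\<Omega>\<bar> / a\<^sub>N\<close>, so Jensen's inequality bounds the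
  average of \<open>b\<^sup>-\<^sup>p\<close> by the factor with \<open>a\<^sub>N / \<bar>\<Omega>\<bar>\<close> (\<open>average_half_chord\<close>). The quotient of the two
  Gaussian moments is the Gamma factor in \<open>k\<^sub>p\<close>.

  This proves the inequality for test functions (\<open>hardy_test_function\<close>). For \<open>u \<in> W\<^sub>0\<^sup>1\<^sup>,\<^sup>p(\<Omega>)\<close> the weight is
  truncated, the test functions are replaced by their limit, and the truncation is removed. The
  weak gradient in the statement agrees with the limit of the gradients by the fundamental lemma
  of the calculus of variations (\<open>weak_gradient_unique\<close>).
\<close>

section \<open>The functions \<open>X\<^sub>i\<close> and the scalar inequality\<close>

definition Xprod :: "nat \<Rightarrow> real \<Rightarrow> real" where
  "Xprod i t = (\<Prod>j=1..i. X_iter j t)"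

definition Xsquares :: "nat \<Rightarrow> real \<Rightarrow> real" where
  "Xsquares k t = (\<Sum>i=1..k. \<Prod>j=1..i. (X_iter j t)\<^sup>2)"

lemma Xprod_0 [simp]: "Xprod 0 t = 1"
  by (simp add: Xprod_def)

lemma Xprod_Suc [simp]: "Xprod (Suc i) t = Xprod i t * X_iter (Suc i) t"
  by (simp add: Xprod_def del: X_iter.simps)

lemma eta_0 [simp]: "eta 0 t = 0"
  by (simp add: eta_def)

lemma eta_Suc [simp]: "eta (Suc k) t = eta k t + Xprod (Suc k) t"
  by (simp add: eta_def Xprod_def)

lemma Xsquares_0 [simp]: "Xsquares 0 t = 0"
  by (simp add: Xsquares_def)

lemma Xsquares_Suc [simp]: "Xsquares (Suc k) t = Xsquares k t + (Xprod (Suc k) t)\<^sup>2"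
  by (simp add: Xsquares_def Xprod_def prod_power_distrib power_mult_distrib)

lemma X_iter_bounds:
  assumes "0 < t" "t \<le> 1"
  shows "0 < X_iter i t \<and> X_iter i t \<le> 1"
proof (induction i)
  case (Suc i)
  then have "ln (X_iter i t) \<le> 0" by simp
  then show ?case by (simp add: X1_def)
qed (use assms in auto)

lemma X_iter_strict_mono:
  assumes "0 < s" "s < t" "t \<le> 1"
  shows "X_iter i s < X_iter i t"
proof (induction i)
  case (Suc i)
  have b: "0 < X_iter i s" "X_iter i s \<le> 1" "0 < X_iter i t" "X_iter i t \<le> 1"
    using X_iter_bounds[of s i] X_iter_bounds[of t i] assms by auto
  have "ln (X_iter i s) < ln (X_iter i t)" "ln (X_iter i t) \<le> 0" 
    using Suc b by auto
  then show ?case by (simp add: X1_def frac_less2)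
qed (use assms in auto)

lemma X_iter_mono:
  assumes "0 < s" "s \<le> t" "t \<le> 1"
  shows "X_iter i s \<le> X_iter i t"
  using X_iter_strict_mono[of s t i] assms by (cases "s = t") auto

lemma Xprod_bounds:
  assumes "0 < t" "t \<le> 1"
  shows "0 < Xprod i t \<and> Xprod i t \<le> 1"
proof (induction i)
  case (Suc i)
  with X_iter_bounds[OF assms, of "Suc i"] show ?case
    by (simp del: X_iter.simps add: mult_le_one)
qed simp

lemma Xprod_mono:
  assumes "0 < s" "s \<le> t" "t \<le> 1"
  shows "Xprod i s \<le> Xprod i t"
  unfolding Xprod_def
  by (intro prod_mono conjI X_iter_mono assms less_imp_le) (use X_iter_bounds[of s] assms in auto)

lemma eta_nonneg: "0 < t \<Longrightarrow> t \<le> 1 \<Longrightarrow> 0 \<le> eta k t"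
proof (induction k)
  case (Suc k) then show ?case using Xprod_bounds[of t "Suc k"] by simp
qed simp

lemma eta_mono:
  assumes "0 < s" "s \<le> t" "t \<le> 1"
  shows "eta k s \<le> eta k t"
  using Xprod_mono[OF assms] unfolding eta_def Xprod_def by (intro sum_mono) auto

lemma eta_strict_mono:
  assumes "0 < s" "s < t" "t \<le> 1" "k \<ge> 1"
  shows "eta k s < eta k t"
proof -
  have "Xprod 1 s < Xprod 1 t"
    using X_iter_strict_mono[OF assms(1-3), of 1] by (simp add: Xprod_def)
  then show ?thesis unfolding eta_def Xprod_def[symmetric]
    by (intro sum_strict_mono_ex1) (use assms Xprod_mono[of s t] in \<open>auto intro!: bexI[of _ 1]\<close>)
qed

lemma X_iter_1: "X_iter i 1 = 1"
  by (induction i) (auto simp: X1_def)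

lemma eta_1: "eta k 1 = real k"
  by (simp add: eta_def X_iter_1)

lemma Xprod_le_X1:
  assumes "0 < t" "t \<le> 1"
  shows "Xprod (Suc i) t \<le> X1 t"
proof (induction i)
  case (Suc i)
  have "Xprod (Suc (Suc i)) t \<le> Xprod (Suc i) t * 1"
    unfolding Xprod_Suc[of "Suc i"]
    using X_iter_bounds[OF assms] Xprod_bounds[OF assms] 
    by (intro mult_left_mono) (auto intro: less_imp_le simp del: X_iter.simps Xprod_Suc)
  with Suc show ?case by linarith
qed simp

lemma eta_le_X1:
  assumes "0 < t" "t \<le> 1"
  shows "eta k t \<le> real k * X1 t"
proof (induction k)
  case (Suc k)
  then show ?case using Xprod_le_X1[OF assms, of k] by (simp add: algebra_simps del: Xprod_Suc)
qed simp

lemma Xsquares_nonneg: "0 \<le> Xsquares k t"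
  unfolding Xsquares_def by (intro sum_nonneg prod_nonneg) auto

lemma Xsquares_mono:
  assumes "0 < s" "s \<le> t" "t \<le> 1"
  shows "Xsquares k s \<le> Xsquares k t"
  unfolding Xsquares_def
  by (intro sum_mono prod_mono conjI power_mono X_iter_mono assms zero_le_power2) 
    (use X_iter_bounds[of s] assms in \<open>auto intro: less_imp_le\<close>)

text \<open>
  For \<open>p > 2\<close> this bounds the sum of squares from below by \<open>\<eta>\<^sup>2 / k\<close>, which yields the cubic term that
  absorbs the Taylor remainder in \<open>scalar_inequality_gt2\<close>. The factor \<open>k\<close> in the constant \<open>a\<close> makes up
  for the division by \<open>k\<close>.
\<close>

lemma eta_square_le: "(eta k t)\<^sup>2 \<le> real k * Xsquares k t"
proof -
  have "(\<Sum>i=1..k. Xprod i t * 1)\<^sup>2 \<le> (\<Sum>i=1..k. (Xprod i t)\<^sup>2) * (\<Sum>i=1..k. 1\<^sup>2)"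
    by (rule Cauchy_Schwarz_ineq_sum)
  then show ?thesis 
    by (simp add: eta_def Xprod_def Xsquares_def prod_power_distrib mult.commute)
qed

lemma X_iter_deriv:
  assumes "0 < t" "t \<le> 1"
  shows "(X_iter i has_real_derivative X_iter i t * Xprod i t / t) (at t)"
proof (induction i)
  case 0
  then show ?case using assms by (auto intro!: derivative_eq_intros simp: X_iter.simps(1)[abs_def])
next
  case (Suc i)
  have b: "0 < X_iter i t" "X_iter i t \<le> 1" using X_iter_bounds[OF assms, of i] by auto
  then have l: "1 - ln (X_iter i t) \<noteq> 0" by (smt (verit) ln_le_zero_iff)
  have "((\<lambda>t. 1 / (1 - ln (X_iter i t))) has_real_derivative 
          (X_iter i t * Xprod i t / t / X_iter i t) / (1 - ln (X_iter i t))^2) (at t)"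
    by (rule derivative_eq_intros Suc refl | use b l in \<open>simp add: field_simps power2_eq_square\<close>)+
  moreover have "X_iter (Suc i) = (\<lambda>t. 1 / (1 - ln (X_iter i t)))"
    by (auto simp: X1_def)
  moreover have "(X_iter i t * Xprod i t / t / X_iter i t) / (1 - ln (X_iter i t))^2 =
    X_iter (Suc i) t * Xprod (Suc i) t / t"
    using b l assms by (simp add: X1_def field_simps power2_eq_square)
  ultimately show ?case by simp
qed

lemma Xprod_deriv:
  assumes "0 < t" "t \<le> 1"
  shows "(Xprod i has_real_derivative Xprod i t * eta i t / t) (at t)"
proof (induction i)
  case 0
  have "Xprod 0 = (\<lambda>_. 1)" by auto
  then show ?case by simp
next
  case (Suc i)
  have "((\<lambda>t. Xprod i t * X_iter (Suc i) t) has_real_derivative 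
     Xprod i t * eta i t / t * X_iter (Suc i) t + X_iter (Suc i) t * Xprod (Suc i) t / t * Xprod i t) (at t)"
    by (intro DERIV_mult' Suc X_iter_deriv assms DERIV_mult)
  moreover have "Xprod (Suc i) = (\<lambda>t. Xprod i t * X_iter (Suc i) t)" by auto
  ultimately show ?case using assms by (simp add: field_simps)
qed

text \<open>
  With \<open>P\<^sub>i = X\<^sub>1\<dots>X\<^sub>i\<close> the rule \<open>s X\<^sub>i' = X\<^sub>i P\<^sub>i\<close> gives \<open>s P\<^sub>i' = P\<^sub>i (P\<^sub>1 + \<dots> + P\<^sub>i)\<close>. Summed over \<open>i\<close>, these
  are the products \<open>P\<^sub>i P\<^sub>j\<close> with \<open>j \<le> i\<close>, that is, half of \<open>\<eta>\<^sup>2\<close> plus half of the diagonal. The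
  diagonal is the weight \<open>\<Sum>X\<^sub>1\<^sup>2\<dots>X\<^sub>i\<^sup>2\<close> of the series.
\<close>

lemma eta_deriv:
  assumes "0 < t" "t \<le> 1"
  shows "(eta k has_real_derivative ((eta k t)\<^sup>2 + Xsquares k t) / 2 / t) (at t)"
proof (induction k)
  case 0
  have "eta 0 = (\<lambda>_. 0)" by auto
  then show ?case by simp
next
  case (Suc k)
  have "((\<lambda>t. eta k t + Xprod (Suc k) t) has_real_derivative 
     ((eta k t)\<^sup>2 + Xsquares k t) / 2 / t + Xprod (Suc k) t * eta (Suc k) t / t) (at t)"
    by (intro DERIV_add Suc Xprod_deriv assms)
  moreover have "eta (Suc k) = (\<lambda>t. eta k t + Xprod (Suc k) t)" by auto
  moreover have "((eta k t)\<^sup>2 + Xsquares k t) / 2 / t + Xprod (Suc k) t * eta (Suc k) t / t =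
      ((eta (Suc k) t)\<^sup>2 + Xsquares (Suc k) t) / 2 / t"
    using assms by (simp add: field_simps power2_eq_square del: Xprod_Suc)
  ultimately show ?case by metis
qed

lemma eta_small:
  assumes "0 < e" "e \<le> real k"
  obtains t where "0 < t" "t \<le> 1" "eta k t \<le> e"
proof
  let ?t = "exp (1 - real k / e)"
  have k: "real k / e \<ge> 1" "k > 0" using assms by (auto simp: field_simps)
  then show "?t \<le> 1" by simp
  have "eta k ?t \<le> real k * X1 ?t" using \<open>?t \<le> 1\<close> by (intro eta_le_X1) auto
  also have "\<dots> = e" using k assms by (simp add: X1_def)
  finally show "eta k ?t \<le> e" .
qed simp

lemma eta_root:
  assumes "k \<ge> 1"
  obtains s where "0 < s" "s \<le> 1" "eta k s = 1"
proof -
  obtain t where t: "0 < t" "t \<le> 1" "eta k t \<le> 1" using eta_small[of 1 k] assms by auto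
  have "continuous_on {t..1} (eta k)"
    by (intro DERIV_continuous_on[OF DERIV_subset[OF eta_deriv]]) (use t in auto)
  then obtain s where "s \<ge> t" "s \<le> 1" "eta k s = 1"
    using IVT'[of "eta k" t 1 1] t assms by (auto simp: eta_1)
  then show ?thesis using that[of s] t by auto
qed

text \<open>
  The second condition is the Riccati inequality \<open>- H' - (p - 1) H\<^sup>q \<ge> w\<close> for \<open>H(t) = C t\<^sup>1\<^sup>-\<^sup>p g\<close>, with
  \<open>C = ((p - 1) / p)\<^sup>p\<^sup>-\<^sup>1\<close>, after multiplication by \<open>t\<^sup>p / C\<close>.
\<close>

definition admissible :: "nat \<Rightarrow> real \<Rightarrow> real \<Rightarrow> bool" where
  "admissible k p s \<longleftrightarrow> 0 < s \<and> s \<le> 1 \<and> (\<forall>t. 0 < t \<and> t \<le> s \<longrightarrow> 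
     (let e = eta k t; B = Xsquares k t; g = defect k p e in
        0 \<le> g \<and> (p - 1) / p + B / 2 \<le>
          (p - 1) * g + (1 + 2 * a_const k p * e) * (e\<^sup>2 + B) / 2
          - (p - 1)\<^sup>2 / p * g powr (p / (p - 1))))"

text \<open>
  Equality holds at \<open>y = 1\<close>, so it suffices that the right-hand side \<open>h\<close> decreases on \<open>[0, 1]\<close>. In terms of
  \<open>w\<close>, the power \<open>1 / (p - 1)\<close> of \<open>y\<close>, the condition \<open>h' \<le> 0\<close> reads \<open>(p - 1) (1 - w) \<le> 1 - y\<close>. This is the tangent
  inequality at \<open>1\<close> for the function \<open>w\<^sup>p\<^sup>-\<^sup>1\<close>, which is concave because \<open>p \<le> 2\<close>.
\<close>

lemma scalar_inequality_le2:
  fixes p y :: real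
  assumes p: "1 < p" "p \<le> 2" and y: "0 \<le> y" "y \<le> 1"
  shows "(p - 1) / p \<le> (p - 1) * y + (1 - y)\<^sup>2 / 2 - (p - 1)\<^sup>2 / p * y powr (p / (p - 1))"
proof -
  define q where "q = p / (p - 1)"
  have q: "q \<ge> 2" "q - 1 = 1 / (p - 1)" "(p-1)\<^sup>2 / p * q = p - 1" 
    using p by (auto simp: q_def field_simps power2_eq_square)
  define h where "h y = (p - 1) * y + (1 - y)\<^sup>2 / 2 - (p - 1)\<^sup>2 / p * y powr q" for y
  have "h 1 \<le> h y"
  proof (cases "y = 1")
    case False
    show ?thesis
    proof (rule DERIV_nonpos_imp_decreasing_open[of y 1 h])
      show "y \<le> 1" by fact
      show "continuous_on {y..1} h"
        unfolding h_def using q y by (intro continuous_intros continuous_on_powr') auto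
      fix x assume x: "y < x" "x < 1"
      have "(h has_real_derivative (p - 1) - (1 - x) - (p - 1) * x powr (q - 1)) (at x)"
      proof -
        have "(h has_real_derivative (p - 1) - (1 - x) - (p - 1)\<^sup>2 / p * (q * x powr (q - 1))) (at x)"
          unfolding h_def using x y p by (auto intro!: derivative_eq_intros simp: field_simps)
        moreover have "(p - 1)\<^sup>2 / p * (q * x powr (q - 1)) = (p - 1) * x powr (q - 1)"
          using q(3) by (simp flip: mult.assoc)
        ultimately show ?thesis by simp
      qed
      moreover have "1 - x \<ge> (p - 1) * (1 - x powr (q - 1))"
      proof -
        have "(x powr (q - 1)) powr (p - 1) * 1 powr (2 - p) \<le> (p - 1) * x powr (q - 1) + (2 - p) * 1"
          using p x y by (intro Youngs_inequality_0) auto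
        moreover have "(x powr (q - 1)) powr (p - 1) = x"
          using p x y q by (simp add: powr_powr)
        ultimately show ?thesis by (simp add: algebra_simps)
      qed
      ultimately show "\<exists>d. (h has_real_derivative d) (at x) \<and> d \<le> 0"
        by (intro exI[of _ "(p - 1) - (1 - x) - (p - 1) * x powr (q - 1)"]) (simp add: algebra_simps)
    qed
  qed simp
  moreover have "h 1 = (p - 1) / p" using p by (simp add: h_def field_simps power2_eq_square)
  ultimately show ?thesis by (simp add: h_def q_def)
qed

text \<open>
  On \<open>[0, 1 / 10]\<close> the third derivative is at most \<open>4 / 3\<close> times its value at \<open>0\<close>, and \<open>2 / 9\<close> is \<open>4 / 3\<close> divided
  by \<open>3!\<close>.
\<close>

lemma powr_cubic_upper_bound:
  fixes q x :: real
  assumes q: "1 < q" "q < 2" and x: "0 \<le> x" "x \<le> 1/10"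
  shows "(1 - x) powr q \<le> 1 - q * x + q * (q - 1) / 2 * x\<^sup>2 + q * (q - 1) * (2 - q) * (2 / 9) * x ^ 3"
proof (cases "x = 0")
  case False
  define diff :: "nat \<Rightarrow> real \<Rightarrow> real" where
    "diff m t = (if m = 0 then (1 - t) powr q
       else if m = 1 then - q * (1 - t) powr (q - 1)
       else if m = 2 then q * (q - 1) * (1 - t) powr (q - 2)
       else - q * (q - 1) * (q - 2) * (1 - t) powr (q - 3))" for m t
  have d: "((\<lambda>t. c * (1 - t) powr r) has_real_derivative c * (- r * (1 - t) powr (r - 1))) (at t)"
    if "t \<le> x" for c r t :: real
    using that x by (intro DERIV_cmult) (auto intro!: derivative_eq_intros)
  have D1: "diff m = (\<lambda>t. (if m = 0 then 1 else if m = 1 then - q else q * (q - 1)) * (1 - t) powr (q - real m))"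
    if "m < 3" for m using that by (auto simp: diff_def less_Suc_eq numeral_3_eq_3)
  have D2: "diff (Suc m) t = (if m = 0 then 1 else if m = 1 then - q else q * (q - 1)) * 
      (- (q - real m) * (1 - t) powr (q - real m - 1))" if "m < 3" for m t 
  proof -
    from that consider "m = 0" | "m = 1" | "m = 2" by linarith
    then show ?thesis by cases (simp_all add: diff_def algebra_simps)
  qed
  have "\<forall>m t. m < 3 \<and> 0 \<le> t \<and> t \<le> x \<longrightarrow> (diff m has_real_derivative diff (Suc m) t) (at t)"
  proof (intro allI impI, elim conjE)
    fix m :: nat and t assume m: "m < 3" and t: "t \<le> x"
    show "(diff m has_real_derivative diff (Suc m) t) (at t)"
      unfolding D1[OF m] D2[OF m] by (rule d[OF t])
  qed
  from Maclaurin[OF _ _ refl this] 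
  have "\<exists>t. 0 < t \<and> t < x \<and> diff 0 x = (\<Sum>m<3. diff m 0 / fact m * x ^ m) + diff 3 t / fact 3 * x ^ 3"
    using x False by simp
  then obtain t where t: "0 < t" "t < x" 
    and eq0: "diff 0 x = (\<Sum>m<3. diff m 0 / fact m * x ^ m) + diff 3 t / fact 3 * x ^ 3"
    by blast
  have "{..<3::nat} = {0, 1, 2}" by auto
  then have "(\<Sum>m<3. diff m 0 / fact m * x ^ m) = 1 - q * x + q * (q - 1) / 2 * x\<^sup>2"
    by (simp add: diff_def)
  moreover have "diff 0 x = (1 - x) powr q" "fact 3 = (6 :: real)" by (simp_all add: diff_def fact_numeral)
  ultimately have eq: "(1 - x) powr q = 1 - q * x + q * (q - 1) / 2 * x\<^sup>2 + diff 3 t / 6 * x ^ 3"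
    using eq0 by simp
  have "(1 - t) powr (q - 3) \<le> (1 - t) powr (-2)"
    using t x q by (intro powr_mono') auto
  also have "\<dots> = 1 / (1 - t)\<^sup>2"
    using t x by (simp add: powr_minus_divide)
  also have "\<dots> \<le> 1 / (9/10)\<^sup>2"
    using t x by (intro divide_left_mono power_mono) auto
  also have "1 / (9/10)\<^sup>2 \<le> (4/3 :: real)" by (simp add: power2_eq_square)
  finally have "q * (q - 1) * (2 - q) * (1 - t) powr (q - 3) \<le> q * (q - 1) * (2 - q) * (4/3)"
    using q by (intro mult_left_mono) auto
  moreover have "diff 3 t = q * (q - 1) * (2 - q) * (1 - t) powr (q - 3)"
    by (simp add: diff_def algebra_simps)
  ultimately have "diff 3 t / 6 \<le> q * (q - 1) * (2 - q) * (2 / 9)" by linarith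
  then have "diff 3 t / 6 * x ^ 3 \<le> q * (q - 1) * (2 - q) * (2 / 9) * x ^ 3"
    using x by (intro mult_right_mono) auto
  then show ?thesis using eq by simp
qed simp

text \<open>
  Put \<open>x = e + a e\<^sup>2\<close> and \<open>b = (p - 2) / (3 (p - 1))\<close>, so that \<open>a = k b\<close> and \<open>2 - q = 3 b\<close>. When the power of
  \<open>g = 1 - x\<close> is expanded to third order, all terms up to order two cancel. There remain the gain
  \<open>a e B \<ge> b e\<^sup>3\<close> and the losses \<open>(2 / 3) b x\<^sup>3\<close> and \<open>(a e\<^sup>2)\<^sup>2 / 2\<close>; the bound \<open>e \<le> 1 / (20 k\<^sup>2)\<close> makes
  these at most \<open>5 / 6\<close> and \<open>1 / 6\<close> of the gain.
\<close>

lemma scalar_inequality_gt2: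
  fixes p e B :: real
  assumes p: "2 < p" and k: "k \<ge> 1" and e: "0 \<le> e" "e \<le> 1 / (20 * (real k)\<^sup>2)" 
    and B: "e\<^sup>2 \<le> real k * B"
  defines "g \<equiv> defect k p e" and "a \<equiv> a_const k p"
  shows "0 \<le> g" 
    and "(p - 1) / p + B / 2 \<le> (p - 1) * g + (1 + 2 * a * e) * (e\<^sup>2 + B) / 2
          - (p - 1)\<^sup>2 / p * g powr (p / (p - 1))"
proof -
  define q where "q = p / (p - 1)"
  define b where "b = (p - 2) / (3 * (p - 1))"
  define x where "x = e + a * e\<^sup>2"
  have q: "1 < q" "q < 2" using p by (auto simp: q_def field_simps)
  have b: "0 < b" "b \<le> 1/3" "2 - q = 3 * b" using p by (auto simp: b_def q_def field_simps)
  have a: "a = real k * b" using p by (simp add: a_def a_const_def b_def)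
  have kk: "real k \<ge> 1" using k by simp
  have ke: "(real k)\<^sup>2 * e \<le> 1/20" using e kk by (simp add: field_simps)
  have "real k * e \<le> (real k)\<^sup>2 * e" using kk e 
    by (intro mult_right_mono) (auto simp: power2_eq_square)
  then have "real k * e \<le> 1/20" using ke by linarith
  moreover have "b * (real k * e) \<le> 1/3 * (real k * e)" using b e kk by (intro mult_right_mono) auto
  ultimately have ae: "a * e \<le> 1/60" by (simp add: a mult_ac)
  have ae0: "0 \<le> a * e" using a b kk e by simp
  have e20: "e \<le> 1/20" using \<open>real k * e \<le> 1/20\<close> kk e mult_right_mono[of 1 "real k" e] by linarith
  have xe: "x = e * (1 + a * e)" by (simp add: x_def power2_eq_square algebra_simps)
  have x0: "0 \<le> x" using xe e ae0 by simp
  have "x \<le> e * (61/60)" unfolding xe using ae e by (intro mult_left_mono) auto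
  then have x1: "x \<le> 1/10" using e20 by linarith
  have g: "g = 1 - x" by (simp add: g_def defect_def x_def a_def)
  then show "0 \<le> g" using x1 by simp
  have "(1 + a * e) ^ 3 \<le> (61/60) ^ 3" using ae ae0 by (intro power_mono) auto
  also have "\<dots> \<le> (5/4 :: real)" by (simp add: eval_nat_numeral)
  finally have "2/3 * x ^ 3 \<le> 5/6 * e ^ 3" 
    unfolding xe power_mult_distrib using e mult_left_mono[of "(1 + a * e) ^ 3" "5/4" "e^3"] by auto
  then have cub: "b * (2/3 * x ^ 3) \<le> b * (5/6 * e ^ 3)" using b by (intro mult_left_mono) auto
  have "(real k)\<^sup>2 * e * b \<le> 1/20 * (1/3)" using ke b e by (intro mult_mono) auto
  then have "b * e ^ 3 * ((real k)\<^sup>2 * e * b) \<le> b * e ^ 3 * (1/3)" using b e by (intro mult_left_mono) auto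
  moreover have "(a * e\<^sup>2)\<^sup>2 = b * e ^ 3 * ((real k)\<^sup>2 * e * b)"
    by (simp add: a power2_eq_square power3_eq_cube algebra_simps)
  ultimately have quart: "(a * e\<^sup>2)\<^sup>2 \<le> b * e ^ 3 * (1/3)" by simp
  have "b * e * e\<^sup>2 \<le> b * e * (real k * B)" using b e B by (intro mult_left_mono) auto
  then have aB: "b * e ^ 3 \<le> a * e * B" by (simp add: a power2_eq_square power3_eq_cube mult_ac)
  have "q - 1 = 1 / (p - 1)" using p by (simp add: q_def field_simps)
  then have "(p - 1)\<^sup>2 / p * (q * (q - 1)) = (p - 1) * (p - 1) / p * (p / (p - 1) * (1 / (p - 1)))"
    unfolding q_def by (simp add: power2_eq_square)
  also have "\<dots> = 1" using p by simp
  finally have c1: "(p - 1)\<^sup>2 / p * (q * (q - 1)) = 1" .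
  have c2: "(p - 1)\<^sup>2 / p * q = p - 1" using p by (simp add: q_def power2_eq_square)
  have c3: "(p - 1)\<^sup>2 / p = (p - 1) - (p - 1) / p"
  proof -
    have "p - 1 - (p - 1) / p = (p * (p - 1) - (p - 1)) / p" using p by (simp add: diff_divide_distrib)
    also have "p * (p - 1) - (p - 1) = (p - 1)\<^sup>2" by (simp add: power2_eq_square algebra_simps)
    finally show ?thesis by simp
  qed
  have "(p - 1)\<^sup>2 / p * g powr q \<le> (p - 1)\<^sup>2 / p * (1 - q * x + q * (q - 1) / 2 * x\<^sup>2 + q * (q - 1) * (2 - q) * (2 / 9) * x ^ 3)"
    unfolding g using p q x0 x1 by (intro mult_left_mono powr_cubic_upper_bound) auto
  also have "\<dots> = (p - 1) - (p - 1) / p - (p - 1) * x + x\<^sup>2 / 2 + b * (2/3 * x ^ 3)"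
  proof -
    have "c * (1 - q * x + q * (q - 1) / 2 * x\<^sup>2 + q * (q - 1) * r * (2 / 9) * x ^ 3) =
       c - c * q * x + c * (q * (q - 1)) / 2 * x\<^sup>2 + c * (q * (q - 1)) * r * (2 / 9) * x ^ 3" for c r
      by (simp add: field_simps)
    then show ?thesis by (simp only: c1 c2 b(3)) (simp add: c3)
  qed
  finally have upper: "(p - 1)\<^sup>2 / p * g powr q \<le> (p - 1) - (p - 1) / p - (p - 1) * x + x\<^sup>2 / 2 + b * (2/3 * x ^ 3)" .
  have "x\<^sup>2 = e\<^sup>2 + 2 * a * e^3 + (a * e\<^sup>2)\<^sup>2" 
    by (simp add: x_def power2_eq_square power3_eq_cube algebra_simps)
  moreover have "(1 + 2 * a * e) * (e\<^sup>2 + B) / 2 = e\<^sup>2 / 2 + B / 2 + a * e ^ 3 + a * e * B"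
    by (simp add: power2_eq_square power3_eq_cube algebra_simps)
  moreover have "(p - 1) * g = (p - 1) - (p - 1) * x" by (simp add: g algebra_simps)
  ultimately show "(p - 1) / p + B / 2 \<le> (p - 1) * g + (1 + 2 * a * e) * (e\<^sup>2 + B) / 2
          - (p - 1)\<^sup>2 / p * g powr (p / (p - 1))"
    using upper cub quart aB unfolding q_def[symmetric] by linarith
qed

lemma ex_admissible:
  assumes p: "1 < p"
  shows "\<exists>s. admissible k p s \<and> (p = 2 \<and> k \<ge> 1 \<longrightarrow> eta k s = 1)"
proof -
  consider (k0) "k = 0" | (le) "k \<ge> 1" "p \<le> 2" | (gt) "k \<ge> 1" "p > 2"
    by (cases "k = 0"; cases "p \<le> 2") auto
  then show ?thesis
  proof cases
    case k0
    have "(p - 1) / p = p - 1 - (p - 1)\<^sup>2 / p"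
    proof -
      have "p - 1 - (p - 1)\<^sup>2 / p = (p * (p - 1) - (p - 1)\<^sup>2) / p" using p by (simp add: diff_divide_distrib)
      also have "p * (p - 1) - (p - 1)\<^sup>2 = p - 1" by (simp add: power2_eq_square algebra_simps)
      finally show ?thesis by simp
    qed
    then have "admissible k p 1"
      unfolding admissible_def Let_def k0 defect_def by simp
    with k0 show ?thesis by (intro exI[of _ 1]) simp
  next
    case le
    obtain s where s: "0 < s" "s \<le> 1" "eta k s = 1" using eta_root[OF le(1)] .
    have "admissible k p s"
      unfolding admissible_def Let_def
    proof (intro conjI allI impI)
      fix t assume t: "0 < t \<and> t \<le> s"
      then have e: "0 \<le> eta k t" "eta k t \<le> 1" using eta_mono[of t s k] eta_nonneg[of t k] s by auto
      have a: "a_const k p = 0" using le by (simp add: a_const_def)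
      show "0 \<le> defect k p (eta k t)" using e by (simp add: defect_def a)
      show "(p - 1) / p + Xsquares k t / 2
         \<le> (p - 1) * defect k p (eta k t) + (1 + 2 * a_const k p * eta k t) * ((eta k t)\<^sup>2 + Xsquares k t) / 2 -
            (p - 1)\<^sup>2 / p * defect k p (eta k t) powr (p / (p - 1))"
        using scalar_inequality_le2[of p "1 - eta k t"] p le e by (simp add: defect_def a add_divide_distrib)
    qed (use s in auto)
    with s le show ?thesis by (intro exI[of _ s]) auto
  next
    case gt
    have k1: "real k \<ge> 1" using gt by simp
    then have "1 \<le> 20 * (real k)\<^sup>2" using one_le_power[OF k1, of 2] by linarith
    then have "1 / (20 * (real k)\<^sup>2) \<le> 1" using k1 by (subst divide_le_eq_1_pos) auto
    then have "1 / (20 * (real k)\<^sup>2) \<le> real k" using k1 by linarith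
    moreover have "0 < 1 / (20 * (real k)\<^sup>2)" using k1 by simp
    ultimately    obtain s where s: "0 < s" "s \<le> 1" "eta k s \<le> 1 / (20 * (real k)\<^sup>2)"
      using eta_small[of "1 / (20 * (real k)\<^sup>2)" k] by blast
    have "admissible k p s"
      unfolding admissible_def Let_def
    proof (intro conjI allI impI)
      fix t assume t: "0 < t \<and> t \<le> s"
      then have e: "0 \<le> eta k t" "eta k t \<le> 1 / (20 * (real k)\<^sup>2)" 
        using eta_mono[of t s k] eta_nonneg[of t k] s by auto
      show "0 \<le> defect k p (eta k t)" 
        "(p - 1) / p + Xsquares k t / 2
         \<le> (p - 1) * defect k p (eta k t) + (1 + 2 * a_const k p * eta k t) * ((eta k t)\<^sup>2 + Xsquares k t) / 2 -
            (p - 1)\<^sup>2 / p * defect k p (eta k t) powr (p / (p - 1))"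
        using scalar_inequality_gt2[OF gt(2,1) e eta_square_le] by auto
    qed (use s in auto)
    with gt show ?thesis by (intro exI[of _ s]) auto
  qed
qed

section \<open>The Hardy inequality on a chord\<close>

lemma DERIV_abs_powr:
  fixes x p :: real
  assumes "1 < p"
  shows "((\<lambda>x. \<bar>x\<bar> powr p) has_real_derivative p * \<bar>x\<bar> powr (p - 1) * sgn x) (at x)"
proof (cases x "0::real" rule: linorder_cases)
  case greater
  have "((\<lambda>x. x powr p) has_real_derivative p * x powr (p - 1)) (at x)"
    using greater by (auto intro!: derivative_eq_intros)
  moreover have "\<forall>\<^sub>F y in nhds x. y powr p = \<bar>y\<bar> powr p"
    using eventually_nhds_in_open[of "{0<..}" x] greater by (auto elim!: eventually_mono)
  ultimately show ?thesis using greater by (subst (asm) DERIV_cong_ev) auto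
next
  case less
  have "((\<lambda>x. (- x) powr p) has_real_derivative - (p * (- x) powr (p - 1))) (at x)"
    using less by (auto intro!: derivative_eq_intros)
  moreover have "\<forall>\<^sub>F y in nhds x. (-y) powr p = \<bar>y\<bar> powr p"
    using eventually_nhds_in_open[of "{..<0}" x] less by (auto elim!: eventually_mono)
  ultimately show ?thesis using less by (subst (asm) DERIV_cong_ev) auto
next
  case equal
  have "((\<lambda>h. \<bar>h\<bar> powr (p - 1)) \<longlongrightarrow> 0 powr (p - 1)) (at (0::real))"
    using assms by (intro tendsto_powr' tendsto_rabs_zero tendsto_const tendsto_ident_at) auto
  then have "((\<lambda>h. \<bar>h\<bar> powr (p - 1)) \<longlongrightarrow> 0) (at (0::real))" using assms by simp
  moreover have "\<bar>\<bar>h\<bar> powr p / h\<bar> = \<bar>h\<bar> powr (p - 1)" for h :: real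
    by (simp add: powr_diff abs_divide)
  ultimately have "((\<lambda>h. \<bar>h\<bar> powr p / h) \<longlongrightarrow> 0) (at (0::real))"
    by (intro tendsto_rabs_zero_cancel[of "\<lambda>h. \<bar>h\<bar> powr p / h"]) simp
  then show ?thesis using equal assms by (simp add: DERIV_def)
qed

text \<open>
  When a potential is lowered by a constant, its \<open>q\<close>-th power drops by at least the \<open>q\<close>-th power of the
  constant. This drop is the origin of the term without singular weight in the inequality.
\<close>

lemma powr_superadditive:
  fixes x y q :: real
  assumes "0 \<le> y" "y \<le> x" "1 \<le> q"
  shows "(x - y) powr q \<le> x powr q - y powr q"
proof (cases "y = 0 \<or> x = y")
  case False
  then have xy: "0 < y" "y < x" using assms by auto
  have "((x - y) / x) powr q \<le> ((x - y) / x) powr 1"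
    using xy assms by (intro powr_mono') auto
  moreover have "(y / x) powr q \<le> (y / x) powr 1"
    using xy assms by (intro powr_mono') auto
  ultimately have "((x - y) / x) powr q + (y / x) powr q \<le> (x - y) / x + y / x"
    using xy by simp
  also have "\<dots> = 1" using xy by (simp add: field_simps)
  finally have "((x - y) powr q + y powr q) / x powr q \<le> 1"
    using xy by (simp add: powr_divide add_divide_distrib)
  then show ?thesis using xy by (simp add: field_simps)
qed (use assms in auto)

definition hardy_weight :: "nat \<Rightarrow> real \<Rightarrow> real \<Rightarrow> real" where
  "hardy_weight k p t = ((p - 1) / p) powr p + 1 / 2 * ((p - 1) / p) powr (p - 1) * Xsquares k t"

definition remainder_const :: "nat \<Rightarrow> real \<Rightarrow> real \<Rightarrow> real" where
  "remainder_const k p s = (p - 1) * ((p - 1) / p) powr p * defect k p (eta k s) powr (p / (p - 1))"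

lemma measurable_X_iter [measurable]: "X_iter i \<in> borel_measurable borel"
  by (induction i) (auto simp: X1_def[abs_def] X_iter.simps[abs_def])

lemma measurable_hardy_weight [measurable]: "hardy_weight k p \<in> borel_measurable borel"
  unfolding hardy_weight_def[abs_def] Xsquares_def by measurable

lemma hardy_weight_nonneg: "0 \<le> hardy_weight k p t"
  unfolding hardy_weight_def using Xsquares_nonneg by simp

lemma hardy_weight_mono:
  "0 < s \<Longrightarrow> s \<le> t \<Longrightarrow> t \<le> 1 \<Longrightarrow> hardy_weight k p s \<le> hardy_weight k p t"
  unfolding hardy_weight_def using Xsquares_mono[of s t k]
  by (intro add_mono mult_left_mono) auto

lemma remainder_const_nonneg: "1 < p \<Longrightarrow> 0 \<le> remainder_const k p s"
  unfolding remainder_const_def by simp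

lemma a_const_nonneg: "0 \<le> a_const k p"
  by (auto simp: a_const_def)

lemma defect_antimono:
  assumes "0 < s" "s \<le> t" "t \<le> 1"
  shows "defect k p (eta k t) \<le> defect k p (eta k s)"
proof -
  have e: "eta k s \<le> eta k t" "0 \<le> eta k s" 
    using eta_mono[OF assms] eta_nonneg[of s k] assms by auto
  then have "(eta k s)\<^sup>2 \<le> (eta k t)\<^sup>2" by (intro power_mono) auto
  then show ?thesis unfolding defect_def 
    using e mult_left_mono[OF _ a_const_nonneg, of "(eta k s)\<^sup>2" "(eta k t)\<^sup>2" k p] by linarith
qed

lemma admissible_mono: "admissible k p s \<Longrightarrow> 0 < s' \<Longrightarrow> s' \<le> s \<Longrightarrow> admissible k p s'"
  unfolding admissible_def by auto

lemma admissible_defect: "admissible k p s \<Longrightarrow> 0 < t \<Longrightarrow> t \<le> s \<Longrightarrow> 0 \<le> defect k p (eta k t)"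
  unfolding admissible_def Let_def by auto

text \<open>
  The subtracted constant makes the potential vanish at the midpoint \<open>t = b\<close> of a chord of length
  \<open>2 b\<close>, so that no boundary term arises there.
\<close>

definition hardy_potential :: "nat \<Rightarrow> real \<Rightarrow> real \<Rightarrow> real \<Rightarrow> real \<Rightarrow> real" where
  "hardy_potential k p D b t = ((p - 1) / p) powr (p - 1) *
     (t powr (1 - p) * defect k p (eta k (t / D)) - b powr (1 - p) * defect k p (eta k (b / D)))"

lemma hardy_potential_deriv:
  fixes p D b t :: real
  assumes p: "1 < p" and D: "0 < D" and t: "0 < t" "t \<le> D"
  shows "(hardy_potential k p D b has_real_derivative
     - (((p - 1) / p) powr (p - 1) * t powr (- p) * ((p - 1) * defect k p (eta k (t / D)) +
        (1 + 2 * a_const k p * eta k (t / D)) * ((eta k (t / D))\<^sup>2 + Xsquares k (t / D)) / 2))) (at t)"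
proof -
  have tD: "0 < t / D" "t / D \<le> 1" using D t by auto
  have e: "((\<lambda>t. eta k (t / D)) has_real_derivative 
      ((eta k (t / D))\<^sup>2 + Xsquares k (t / D)) / 2 / (t / D) * (1 / D)) (at t)"
    using D by (intro DERIV_chain2[where f="eta k" and g="\<lambda>t. t / D", OF eta_deriv[OF tD]]) (auto intro!: derivative_eq_intros)
  have "(hardy_potential k p D b has_real_derivative
     ((p - 1) / p) powr (p - 1) * ((1 - p) * t powr (1 - p - 1) * defect k p (eta k (t / D)) + 
      t powr (1 - p) * (- (((eta k (t / D))\<^sup>2 + Xsquares k (t / D)) / 2 / (t / D) * (1 / D)) - 
        a_const k p * (2 * eta k (t / D) * (((eta k (t / D))\<^sup>2 + Xsquares k (t / D)) / 2 / (t / D) * (1 / D)))))) (at t)"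
    unfolding hardy_potential_def[abs_def] defect_def
    using t by (auto intro!: derivative_eq_intros e)
  moreover have "t powr (1 - p) = t * t powr (- p)" 
    using t powr_add[of t 1 "-p"] by simp
  ultimately show ?thesis using D t by (elim DERIV_cong) (simp add: field_simps)
qed

text \<open>
  The subtracted constant does not change the derivative, and it lowers the \<open>q\<close>-th power of the
  potential by superadditivity; the rest is the Riccati inequality in \<open>admissible\<close>. The gain is
  stated with \<open>\<eta>\<close> at the end \<open>s\<close> of the admissible range instead of \<open>b / D\<close>, where it is larger, since
  only this value does not depend on the chord.
\<close>

lemma hardy_potential_riccati:
  fixes p D b t s :: real
  assumes p: "1 < p" and adm: "admissible k p s" and D: "0 < D" and b: "b \<le> D * s" and t: "0 < t" "t \<le> b"
  defines "H \<equiv> hardy_potential k p D b"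
  shows "0 \<le> H t"
    and "\<exists>H'. (H has_real_derivative H') (at t) \<and>
       H' + (p - 1) * H t powr (p / (p - 1)) \<le> - (t powr (- p) * hardy_weight k p (t / D) 
          + b powr (- p) * remainder_const k p s)"
proof -
  define C where "C = ((p - 1) / p) powr (p - 1)"
  define q where "q = p / (p - 1)"
  define g where "g = defect k p (eta k (t / D))"
  define gb where "gb = defect k p (eta k (b / D))"
  define R where "R = (p - 1) * g + (1 + 2 * a_const k p * eta k (t / D)) * ((eta k (t / D))\<^sup>2 + Xsquares k (t / D)) / 2"
  have s: "0 < s" "s \<le> 1" using adm by (auto simp: admissible_def)
  have bD: "0 < b / D" "b / D \<le> s" "t / D \<le> b / D" "0 < t / D" using b t D by (auto simp: field_simps)
  have g: "0 \<le> gb" "gb \<le> g" "defect k p (eta k s) \<le> gb" "0 \<le> defect k p (eta k s)"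
    unfolding g_def gb_def using bD s
    by (auto intro!: defect_antimono admissible_defect[OF adm])
  have C0: "0 < C" using p by (simp add: C_def)
  have tp: "0 < t powr (1 - p)" "b powr (1 - p) \<le> t powr (1 - p)" using t p by (auto intro!: powr_mono2')
  have q1: "1 \<le> q" using p by (simp add: q_def field_simps)
  have mb: "b powr (1 - p) * gb \<le> t powr (1 - p) * g" using tp g by (intro mult_mono) auto
  have Ht: "H t = C * (t powr (1 - p) * g - b powr (1 - p) * gb)"
    by (simp add: H_def hardy_potential_def C_def g_def gb_def)
  show "0 \<le> H t" using mb C0 by (simp add: Ht)
  have pw: "x powr ((1 - p) * q) = x powr (- p)" for x :: real
  proof -
    have "(1 - p) * q = - ((p - 1) * (p / (p - 1)))" 
      unfolding q_def by (metis minus_diff_eq mult_minus_left)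
    also have "\<dots> = - p" using p by simp
    finally show ?thesis by simp
  qed
  have Cq: "C powr q = ((p - 1) / p) powr p" "C * (p - 1) / p = ((p - 1) / p) powr p" 
      "(p - 1) * C powr q = C * ((p - 1)\<^sup>2 / p)"
  proof -
    show 1: "C powr q = ((p - 1) / p) powr p" using p by (simp add: C_def powr_powr q_def)
    show 2: "C * (p - 1) / p = ((p - 1) / p) powr p" 
      using p powr_add[of "(p - 1) / p" "p - 1" 1] by (simp add: C_def)
    show "(p - 1) * C powr q = C * ((p - 1)\<^sup>2 / p)" unfolding 1 2[symmetric] by (simp add: power2_eq_square)
  qed
  have "(t powr (1 - p) * g - b powr (1 - p) * gb) powr q \<le> 
      (t powr (1 - p) * g) powr q - (b powr (1 - p) * gb) powr q"
    using mb g q1 by (intro powr_superadditive) auto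
  also have "\<dots> = t powr (- p) * g powr q - b powr (- p) * gb powr q"
    using g by (simp add: powr_mult powr_powr pw)
  also have "\<dots> \<le> t powr (- p) * g powr q - b powr (- p) * defect k p (eta k s) powr q"
    using g q1 by (intro diff_left_mono mult_left_mono powr_mono2) auto
  finally have "C powr q * (t powr (1 - p) * g - b powr (1 - p) * gb) powr q 
      \<le> C powr q * (t powr (- p) * g powr q - b powr (- p) * defect k p (eta k s) powr q)"
    by (intro mult_left_mono) auto
  then have "H t powr q \<le> C powr q * (t powr (- p) * g powr q - b powr (- p) * defect k p (eta k s) powr q)"
    using mb C0 by (simp add: Ht powr_mult)
  then have "(p - 1) * H t powr q \<le> (p - 1) * (C powr q * (t powr (- p) * g powr q - b powr (- p) * defect k p (eta k s) powr q))"
    using p by (intro mult_left_mono) auto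
  also have "\<dots> = ((p - 1) * C powr q) * t powr (- p) * g powr q - b powr (- p) * remainder_const k p s"
    unfolding Cq(1) remainder_const_def q_def[symmetric] by (simp add: algebra_simps)
  also have "\<dots> = C * t powr (- p) * ((p - 1)\<^sup>2 / p * g powr q) - b powr (- p) * remainder_const k p s"
    by (subst Cq(3)) (simp add: mult_ac)
  finally have 1: "(p - 1) * H t powr q \<le> C * t powr (- p) * ((p - 1)\<^sup>2 / p * g powr q) - b powr (- p) * remainder_const k p s" .
  have "(p - 1) / p + Xsquares k (t / D) / 2 \<le> R - (p - 1)\<^sup>2 / p * g powr q"
    using adm bD unfolding admissible_def R_def g_def q_def Let_def by auto
  then have A: "C * t powr (- p) * ((p - 1) / p + Xsquares k (t / D) / 2) \<le> C * t powr (- p) * (R - (p - 1)\<^sup>2 / p * g powr q)"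
    using C0 by (intro mult_left_mono) auto
  have B: "t powr (- p) * hardy_weight k p (t / D) = C * t powr (- p) * ((p - 1) / p + Xsquares k (t / D) / 2)"
    unfolding hardy_weight_def C_def[symmetric] Cq(2)[symmetric] by (simp add: algebra_simps)
  have 2: "t powr (- p) * hardy_weight k p (t / D) \<le> C * t powr (- p) * (R - (p - 1)\<^sup>2 / p * g powr q)"
    unfolding B by (rule A)
  have "t / D \<le> 1" using bD s by simp
  then have "t \<le> D" using D by (simp add: divide_le_eq_1_pos)
  from hardy_potential_deriv[OF p D t(1) this, of k b]
  have d: "(H has_real_derivative - (C * t powr (- p) * R)) (at t)"
    by (simp add: H_def C_def R_def g_def)
  show "\<exists>H'. (H has_real_derivative H') (at t) \<and>
       H' + (p - 1) * H t powr (p / (p - 1)) \<le> - (t powr (- p) * hardy_weight k p (t / D) 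
          + b powr (- p) * remainder_const k p s)"
    unfolding q_def[symmetric]
    by (intro exI[of _ "- (C * t powr (- p) * R)"] conjI d) (use 1 2 in \<open>simp add: algebra_simps\<close>)
qed

lemma nn_integral_Icc_le:
  fixes f g :: "real \<Rightarrow> real"
  assumes f: "continuous_on {a..b} f" "\<And>x. x \<in> {a..b} \<Longrightarrow> 0 \<le> f x" 
    and g: "continuous_on {a..b} g" "\<And>x. x \<in> {a..b} \<Longrightarrow> 0 \<le> g x" 
    and le: "integral {a..b} f \<le> integral {a..b} g"
  shows "(\<integral>\<^sup>+x\<in>{a..b}. ennreal (f x) \<partial>lborel) \<le> (\<integral>\<^sup>+x\<in>{a..b}. ennreal (g x) \<partial>lborel)"
proof -
  have *: "(\<integral>\<^sup>+x\<in>{a..b}. ennreal (h x) \<partial>lborel) = ennreal (integral {a..b} h)"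
    if "continuous_on {a..b} h" "\<And>x. x \<in> {a..b} \<Longrightarrow> 0 \<le> h x" for h :: "real \<Rightarrow> real"
  proof -
    have "(h has_integral integral {a..b} h) {a..b}" 
      using integrable_continuous_real[OF that(1)] by (simp add: has_integral_integral)
    from nn_integral_has_integral_lebesgue[OF that(2) this]
    have "integral\<^sup>N lborel (\<lambda>x. ennreal (indicator {a..b} x * h x)) = ennreal (integral {a..b} h)" .
    moreover have "(\<integral>\<^sup>+x\<in>{a..b}. ennreal (h x) \<partial>lborel) = integral\<^sup>N lborel (\<lambda>x. ennreal (indicator {a..b} x * h x))"
      by (intro nn_integral_cong) (auto simp: indicator_def)
    ultimately show ?thesis by simp
  qed
  show ?thesis using *[OF f] *[OF g] ennreal_leI[OF le] by simp
qed

text \<open>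
  By Young's inequality and the Riccati inequality, \<open>(\<bar>g\<bar>\<^sup>p H)' \<le> \<bar>g'\<bar>\<^sup>p - \<bar>g\<bar>\<^sup>p w\<close>. The integral of the
  left-hand side over \<open>[0, b]\<close> is zero: \<open>g\<close> vanishes near \<open>0\<close>, and \<open>H\<close> vanishes at \<open>b\<close>.
\<close>

lemma hardy_half_interval:
  fixes p D b s e :: real and g g' :: "real \<Rightarrow> real"
  assumes p: "1 < p" and adm: "admissible k p s" and D: "0 < D" and b: "0 < b" "b \<le> D * s"
    and g: "\<And>t. (g has_real_derivative g' t) (at t)" and g': "continuous_on UNIV g'"
    and e: "0 < e" "\<And>t. t \<le> e \<Longrightarrow> g t = 0"
  shows "(\<integral>\<^sup>+t\<in>{0<..b}. ennreal (\<bar>g t\<bar> powr p * (t powr (- p) * hardy_weight k p (t / D) 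
            + b powr (- p) * remainder_const k p s)) \<partial>lborel)
         \<le> (\<integral>\<^sup>+t\<in>{0<..b}. ennreal (\<bar>g' t\<bar> powr p) \<partial>lborel)"
    (is "?L \<le> ?R")
proof -
  define e' where "e' = min e b"
  have e': "0 < e'" "e' \<le> b" "e' \<le> e" using e b by (auto simp: e'_def)
  define w where "w t = t powr (- p) * hardy_weight k p (t / D) + b powr (- p) * remainder_const k p s" for t
  define H where "H = hardy_potential k p D b"
  define q where "q = p / (p - 1)"
  have s: "0 < s" "s \<le> 1" using adm by (auto simp: admissible_def)
  have q: "q > 1" "1 / p + 1 / q = 1" "p / q = p - 1" using p by (auto simp: q_def field_simps)
  have bD: "b \<le> D" using b mult_left_mono[of s 1 D] s D by linarith
  have contg: "continuous_on X g" for X using g by (meson DERIV_continuous_on has_field_derivative_at_within)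
  have contX: "continuous_on {e'..b} (\<lambda>t. Xsquares k (t / D))"
    unfolding Xsquares_def
  proof (intro continuous_on_sum continuous_on_prod continuous_on_power)
    fix i j :: nat
    have im: "(\<lambda>t. t / D) ` {e'..b} \<subseteq> {0<..1}"
      unfolding image_subset_iff using e' D bD by (auto simp: divide_le_eq)
    have c: "continuous_on {0<..1} (X_iter j)"
      by (intro DERIV_continuous_on[OF DERIV_subset[OF X_iter_deriv]]) auto
    have "continuous_on {e'..b} (\<lambda>t. t / D)" using D by (intro continuous_intros) auto
    from continuous_on_compose2[OF c this im] show "continuous_on {e'..b} (\<lambda>t. X_iter j (t / D))" .
  qed
  have contPw: "continuous_on {e'..b} (\<lambda>t. \<bar>g t\<bar> powr p * w t)"
    unfolding w_def hardy_weight_def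
  proof (intro continuous_on_mult continuous_on_add continuous_on_const contX)
    show "continuous_on {e'..b} (\<lambda>t. \<bar>g t\<bar> powr p)"
      by (intro continuous_on_powr' continuous_on_rabs contg continuous_on_const) (use p in auto)
    show "continuous_on {e'..b} (\<lambda>t. t powr - p)"
      by (intro continuous_on_powr continuous_on_id continuous_on_const) (use e' in auto)
  qed
  have contg'p: "continuous_on {e'..b} (\<lambda>t. \<bar>g' t\<bar> powr p)"
    by (intro continuous_on_powr' continuous_on_rabs continuous_on_const continuous_on_subset[OF g']) (use p in auto)
  have w0: "0 \<le> w t" for t unfolding w_def
    using hardy_weight_nonneg remainder_const_nonneg[OF p] by simp
  define F where "F t = \<bar>g t\<bar> powr p * H t" for t
  have "\<exists>F'. (F has_real_derivative F') (at t) \<and> F' \<le> \<bar>g' t\<bar> powr p - \<bar>g t\<bar> powr p * w t" if t: "t \<in> {e'..b}" for t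
  proof -
    have t': "0 < t" "t \<le> b" using t e' by auto
    obtain H' where H': "(H has_real_derivative H') (at t)" "H' + (p - 1) * H t powr q \<le> - w t"
      using hardy_potential_riccati(2)[OF p adm D b(2) t'] unfolding H_def w_def q_def by blast
    have H0: "0 \<le> H t" using hardy_potential_riccati(1)[OF p adm D b(2) t'] unfolding H_def .
    have P': "((\<lambda>t. \<bar>g t\<bar> powr p) has_real_derivative p * \<bar>g t\<bar> powr (p - 1) * sgn (g t) * g' t) (at t)"
      by (rule DERIV_chain2[where f="\<lambda>x. \<bar>x\<bar> powr p" and g=g, OF DERIV_abs_powr[OF p] g])
    have "(F has_real_derivative \<bar>g t\<bar> powr p * H' + p * \<bar>g t\<bar> powr (p - 1) * sgn (g t) * g' t * H t) (at t)"
      unfolding F_def[abs_def] by (rule DERIV_mult'[OF P' H'(1)])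
    moreover have "p * \<bar>g t\<bar> powr (p - 1) * sgn (g t) * g' t * H t \<le> \<bar>g' t\<bar> powr p + \<bar>g t\<bar> powr p * ((p - 1) * H t powr q)"
    proof -
      have "sgn (g t) * g' t \<le> \<bar>g' t\<bar>" by (auto simp: sgn_if)
      then have "(\<bar>g t\<bar> powr (p - 1) * H t) * (sgn (g t) * g' t) \<le> (\<bar>g t\<bar> powr (p - 1) * H t) * \<bar>g' t\<bar>"
        using H0 by (intro mult_left_mono) auto
      also have "\<dots> = \<bar>g' t\<bar> * (\<bar>g t\<bar> powr (p - 1) * H t)" by simp
      also have "\<dots> \<le> \<bar>g' t\<bar> powr p / p + (\<bar>g t\<bar> powr (p - 1) * H t) powr q / q"
        using p q H0 by (intro Youngs_inequality) auto
      also have "(\<bar>g t\<bar> powr (p - 1) * H t) powr q = \<bar>g t\<bar> powr p * H t powr q"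
        using p H0 by (simp add: powr_mult powr_powr q_def)
      finally have "p * ((\<bar>g t\<bar> powr (p - 1) * H t) * (sgn (g t) * g' t)) 
          \<le> p * (\<bar>g' t\<bar> powr p / p + \<bar>g t\<bar> powr p * H t powr q / q)"
        using p by (intro mult_left_mono) auto
      also have "\<dots> = \<bar>g' t\<bar> powr p + (p / q) * (\<bar>g t\<bar> powr p * H t powr q)"
        using p by (simp add: algebra_simps)
      finally show ?thesis unfolding q(3) by (simp add: algebra_simps)
    qed
    moreover have "\<bar>g t\<bar> powr p * (H' + (p - 1) * H t powr q) \<le> \<bar>g t\<bar> powr p * (- w t)"
      using H'(2) by (intro mult_left_mono) auto
    ultimately show ?thesis
      by (intro exI[of _ "\<bar>g t\<bar> powr p * H' + p * \<bar>g t\<bar> powr (p - 1) * sgn (g t) * g' t * H t"])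
        (simp add: algebra_simps)
  qed
  then obtain F' where F': "\<And>t. t \<in> {e'..b} \<Longrightarrow> (F has_real_derivative F' t) (at t)" 
    "\<And>t. t \<in> {e'..b} \<Longrightarrow> F' t \<le> \<bar>g' t\<bar> powr p - \<bar>g t\<bar> powr p * w t" by metis
  have "(F' has_integral (F b - F e')) {e'..b}"
    using F'(1) e' by (intro fundamental_theorem_of_calculus)
      (auto simp: has_real_derivative_iff_has_vector_derivative[symmetric] intro: DERIV_subset)
  moreover have "F b = 0" by (simp add: F_def H_def hardy_potential_def)
  moreover have "F e' = 0" using e e' by (simp add: F_def)
  ultimately have "(F' has_integral 0) {e'..b}" by simp
  moreover have I: "(\<lambda>t. \<bar>g' t\<bar> powr p) integrable_on {e'..b}" "(\<lambda>t. \<bar>g t\<bar> powr p * w t) integrable_on {e'..b}"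
    using contPw contg'p by (auto intro: integrable_continuous_real)
  ultimately have "0 \<le> integral {e'..b} (\<lambda>t. \<bar>g' t\<bar> powr p - \<bar>g t\<bar> powr p * w t)"
    using F'(2) by (intro has_integral_le[of F' 0 "{e'..b}"]) (auto intro!: integrable_integral integrable_diff)
  then have le: "integral {e'..b} (\<lambda>t. \<bar>g t\<bar> powr p * w t) \<le> integral {e'..b} (\<lambda>t. \<bar>g' t\<bar> powr p)"
    using I by (simp add: Henstock_Kurzweil_Integration.integral_diff)
  have "?L = (\<integral>\<^sup>+t\<in>{e'..b}. ennreal (\<bar>g t\<bar> powr p * w t) \<partial>lborel)"
    unfolding w_def[symmetric]
    by (intro nn_integral_cong) (use e e' p in \<open>auto simp: indicator_def\<close>)
  also have "\<dots> \<le> (\<integral>\<^sup>+t\<in>{e'..b}. ennreal (\<bar>g' t\<bar> powr p) \<partial>lborel)"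
    by (intro nn_integral_Icc_le contPw contg'p le) (use w0 in auto)
  also have "\<dots> \<le> ?R"
    by (intro nn_integral_mono) (use e' in \<open>auto simp: indicator_def\<close>)
  finally show ?thesis .
qed

text \<open>
  The preceding inequality is used from both ends of the chord up to the midpoint. The halves do not
  interact, since both potentials vanish at the midpoint.
\<close>

lemma hardy_chord:
  fixes p D s e l u :: real and g g' :: "real \<Rightarrow> real"
  assumes p: "1 < p" and adm: "admissible k p s" and D: "0 < D" and lu: "l < u" "(u - l) / 2 \<le> D * s"
    and g: "\<And>t. (g has_real_derivative g' t) (at t)" and g': "continuous_on UNIV g'"
    and e: "0 < e" "\<And>t. t \<le> l + e \<or> u - e \<le> t \<Longrightarrow> g t = 0"
  shows "(\<integral>\<^sup>+t\<in>{l<..<u}. ennreal (\<bar>g t\<bar> powr p * (min (t - l) (u - t) powr (- p) * 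
            hardy_weight k p (min (t - l) (u - t) / D) 
            + ((u - l) / 2) powr (- p) * remainder_const k p s)) \<partial>lborel)
         \<le> (\<integral>\<^sup>+t\<in>{l<..<u}. ennreal (\<bar>g' t\<bar> powr p) \<partial>lborel)"
    (is "?L \<le> ?R")
proof -
  define b where "b = (u - l) / 2"
  define w where "w t = t powr (- p) * hardy_weight k p (t / D) + b powr (- p) * remainder_const k p s" for t
  have b: "0 < b" "b \<le> D * s" "l + b = u - b" using lu by (auto simp: b_def field_simps)
  have wm [measurable]: "w \<in> borel_measurable borel"
    unfolding w_def[abs_def] by measurable
  have gm [measurable]: "g \<in> borel_measurable borel"
    by (intro borel_measurable_continuous_onI continuous_at_imp_continuous_on ballI DERIV_isCont[OF g])
  have g'm [measurable]: "g' \<in> borel_measurable borel"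
    by (intro borel_measurable_continuous_onI g')
  have split: "(\<integral>\<^sup>+t\<in>{l<..<u}. f t \<partial>lborel) = 
      (\<integral>\<^sup>+t\<in>{0<..b}. f (l + t) \<partial>lborel) + (\<integral>\<^sup>+t\<in>{0<..b}. f (u - t) \<partial>lborel)"
    if [measurable]: "f \<in> borel_measurable borel" for f :: "real \<Rightarrow> ennreal"
  proof -
    have "(\<integral>\<^sup>+t\<in>{l<..<u}. f t \<partial>lborel) = (\<integral>\<^sup>+t. f t * indicator {l<..l+b} t + f t * indicator {u-b..<u} t \<partial>lborel)"
      using AE_lborel_singleton[of "l + b"] b
      by (intro nn_integral_cong_AE) (auto elim!: eventually_mono simp: indicator_def)
    also have "\<dots> = (\<integral>\<^sup>+t. f t * indicator {l<..l+b} t \<partial>lborel) + (\<integral>\<^sup>+t. f t * indicator {u-b..<u} t \<partial>lborel)"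
      by (rule nn_integral_add) auto
    also have "(\<integral>\<^sup>+t. f t * indicator {l<..l+b} t \<partial>lborel) = (\<integral>\<^sup>+t. f (l + t) * indicator {0<..b} t \<partial>lborel)"
      by (subst nn_integral_real_affine[where c=1 and t=l])
         (auto intro!: nn_integral_cong simp: indicator_def)
    also have "(\<integral>\<^sup>+t. f t * indicator {u-b..<u} t \<partial>lborel) = (\<integral>\<^sup>+t. f (u - t) * indicator {0<..b} t \<partial>lborel)"
      by (subst nn_integral_real_affine[where c="-1" and t=u])
         (auto intro!: nn_integral_cong simp: indicator_def)
    finally show ?thesis .
  qed
  have L: "?L = (\<integral>\<^sup>+t\<in>{0<..b}. ennreal (\<bar>g (l + t)\<bar> powr p * w t) \<partial>lborel)
     + (\<integral>\<^sup>+t\<in>{0<..b}. ennreal (\<bar>g (u - t)\<bar> powr p * w t) \<partial>lborel)"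
  proof -
    have "?L = (\<integral>\<^sup>+t\<in>{l<..<u}. ennreal (\<bar>g t\<bar> powr p * w (min (t - l) (u - t))) \<partial>lborel)"
      by (simp add: w_def b_def)
    also have "\<dots> = (\<integral>\<^sup>+t\<in>{0<..b}. ennreal (\<bar>g (l + t)\<bar> powr p * w (min (l + t - l) (u - (l + t)))) \<partial>lborel)
     + (\<integral>\<^sup>+t\<in>{0<..b}. ennreal (\<bar>g (u - t)\<bar> powr p * w (min (u - t - l) (u - (u - t)))) \<partial>lborel)"
      by (subst split) auto
    also have "\<dots> = (\<integral>\<^sup>+t\<in>{0<..b}. ennreal (\<bar>g (l + t)\<bar> powr p * w t) \<partial>lborel)
     + (\<integral>\<^sup>+t\<in>{0<..b}. ennreal (\<bar>g (u - t)\<bar> powr p * w t) \<partial>lborel)"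
      using b by (intro arg_cong2[of _ _ _ _ "(+)"] nn_integral_cong) (auto simp: indicator_def min_def)
    finally show ?thesis .
  qed
  have R: "?R = (\<integral>\<^sup>+t\<in>{0<..b}. ennreal (\<bar>g' (l + t)\<bar> powr p) \<partial>lborel)
     + (\<integral>\<^sup>+t\<in>{0<..b}. ennreal (\<bar>g' (u - t)\<bar> powr p) \<partial>lborel)"
    by (subst split) auto
  have 1: "(\<integral>\<^sup>+t\<in>{0<..b}. ennreal (\<bar>g (l + t)\<bar> powr p * w t) \<partial>lborel)
     \<le> (\<integral>\<^sup>+t\<in>{0<..b}. ennreal (\<bar>g' (l + t)\<bar> powr p) \<partial>lborel)"
    unfolding w_def
  proof (rule hardy_half_interval[OF p adm D b(1,2) _ _ e(1)])
    show "((\<lambda>t. g (l + t)) has_real_derivative g' (l + t)) (at t)" for t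
    proof -
      have "((\<lambda>t. l + t) has_real_derivative 1) (at t)" by (auto intro!: derivative_eq_intros)
      from DERIV_chain2[where f=g and g="\<lambda>t. l + t" and x=t, OF g[of "l + t"] this] show ?thesis by simp
    qed
    show "continuous_on UNIV (\<lambda>t. g' (l + t))"
      by (intro continuous_on_compose2[OF g']) (auto intro!: continuous_intros)
  qed (use e in auto)
  have 2: "(\<integral>\<^sup>+t\<in>{0<..b}. ennreal (\<bar>g (u - t)\<bar> powr p * w t) \<partial>lborel)
     \<le> (\<integral>\<^sup>+t\<in>{0<..b}. ennreal (\<bar>- g' (u - t)\<bar> powr p) \<partial>lborel)"
    unfolding w_def
  proof (rule hardy_half_interval[OF p adm D b(1,2) _ _ e(1)])
    show "((\<lambda>t. g (u - t)) has_real_derivative - g' (u - t)) (at t)" for t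
    proof -
      have "((\<lambda>t. u - t) has_real_derivative - 1) (at t)" by (auto intro!: derivative_eq_intros)
      from DERIV_chain2[where f=g and g="\<lambda>t. u - t" and x=t, OF g[of "u - t"] this] show ?thesis by simp
    qed
    show "continuous_on UNIV (\<lambda>t. - g' (u - t))"
      by (intro continuous_intros continuous_on_compose2[OF g']) auto
  qed (use e in auto)
  show ?thesis unfolding L R by (rule add_mono[OF 1 2[unfolded abs_minus_cancel]])
qed

section \<open>Lebesgue measure, lines and rays\<close>

abbreviation LN :: "nat \<Rightarrow> (nat \<Rightarrow> real) measure" where
  "LN N \<equiv> Pi\<^sub>M {..<N} (\<lambda>_. lborel)"

definition along :: "nat \<Rightarrow> (nat \<Rightarrow> real) \<Rightarrow> real \<Rightarrow> (nat \<Rightarrow> real) \<Rightarrow> nat \<Rightarrow> real" where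
  "along N x t z = (\<lambda>i\<in>{..<N}. x i + t * z i)"

lemma along_apply [simp]: "i < N \<Longrightarrow> along N x t z i = x i + t * z i"
  by (simp add: along_def)

lemma topspace_RN: "topspace (RN N) = {..<N} \<rightarrow>\<^sub>E UNIV"
  by (simp add: topspace_product_topology)

lemma space_LN: "space (LN N) = {..<N} \<rightarrow>\<^sub>E UNIV"
  by (simp add: space_PiM)

lemma along_in_space [simp]: "along N x t z \<in> {..<N} \<rightarrow>\<^sub>E UNIV"
  by (auto simp: along_def)

lemma measurable_LN_component:
  "f \<in> M \<rightarrow>\<^sub>M LN N \<Longrightarrow> i < N \<Longrightarrow> (\<lambda>w. f w i) \<in> borel_measurable M"
  using measurable_compose[OF _ measurable_component_singleton[of i "{..<N}" "\<lambda>_. lborel :: real measure"]] by simp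

lemma measurable_along [measurable]:
  assumes [measurable]: "f \<in> M \<rightarrow>\<^sub>M LN N" "g \<in> borel_measurable M" "h \<in> M \<rightarrow>\<^sub>M LN N"
  shows "(\<lambda>w. along N (f w) (g w) (h w)) \<in> M \<rightarrow>\<^sub>M LN N"
  unfolding along_def
proof (rule measurable_restrict)
  fix i assume "i \<in> {..<N}"
  then have [measurable]: "(\<lambda>w. f w i) \<in> borel_measurable M" "(\<lambda>w. h w i) \<in> borel_measurable M"
    by (auto intro!: measurable_LN_component assms)
  show "(\<lambda>w. f w i + g w * h w i) \<in> M \<rightarrow>\<^sub>M lborel" by simp
qed

lemma sigma_finite_LN: "sigma_finite_measure (LN N)"
proof -
  interpret finite_product_sigma_finite "\<lambda>_. lborel :: real measure" "{..<N}" by standard simp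
  show ?thesis by (rule sigma_finite_measure_axioms)
qed

lemma pair_sigma_finite_LN: "pair_sigma_finite lborel (LN N)" "pair_sigma_finite (LN N) (LN N)"
  using sigma_finite_LN lborel.sigma_finite_measure_axioms
  by (auto simp: pair_sigma_finite_def)

lemma nn_integral_leb: "(\<integral>\<^sup>+x. f x \<partial>leb N) = (\<integral>\<^sup>+x. f x \<partial>LN N)"
  unfolding leb_def by (rule nn_integral_completion)

lemma space_leb: "space (leb N) = {..<N} \<rightarrow>\<^sub>E UNIV"
  by (simp add: leb_def space_LN)

lemma measurable_leb: "f \<in> measurable (LN N) M \<Longrightarrow> f \<in> measurable (leb N) M"
  unfolding leb_def by (rule measurable_completion)

lemma emeasure_LN_PiE:
  "(\<And>i. i < N \<Longrightarrow> A i \<in> sets borel) \<Longrightarrow> emeasure (LN N) (Pi\<^sub>E {..<N} A) = (\<Prod>i<N. emeasure lborel (A i))"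
proof -
  assume A: "\<And>i. i < N \<Longrightarrow> A i \<in> sets borel"
  interpret finite_product_sigma_finite "\<lambda>_. lborel :: real measure" "{..<N}" by standard simp
  show ?thesis using A by (intro emeasure_PiM) auto
qed

lemma distr_LN_affine:
  assumes c: "c \<noteq> 0"
  shows "scale_measure (ennreal (\<bar>c\<bar> ^ N)) (distr (LN N) (LN N) (along N v c)) = LN N" (is "?P = _")
proof -
  interpret product_sigma_finite "\<lambda>_. lborel :: real measure" ..
  have m: "along N v c \<in> LN N \<rightarrow>\<^sub>M LN N"
    unfolding along_def by (rule measurable_restrict) simp
  show ?thesis
  proof (rule PiM_eqI)
    fix A :: "nat \<Rightarrow> real set" assume "\<And>i. i \<in> {..<N} \<Longrightarrow> A i \<in> sets lborel"
    then have A [measurable]: "\<And>i. i < N \<Longrightarrow> A i \<in> sets borel" by auto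
    have box: "Pi\<^sub>E {..<N} A \<in> sets (LN N)" by (rule sets_PiM_I_finite) (use A in auto)
    have pre: "along N v c -` Pi\<^sub>E {..<N} A \<inter> space (LN N) = Pi\<^sub>E {..<N} (\<lambda>i. (\<lambda>t. v i + c * t) -` A i)"
      unfolding along_def space_LN by (auto simp: PiE_def Pi_def)
    have mpre: "(\<lambda>t. v i + c * t) -` A i \<in> sets borel" if "i < N" for i
      using A[OF that] by (auto intro!: measurable_sets_borel[OF borel_measurable_continuous_onI] continuous_intros)
    have one: "ennreal \<bar>c\<bar> * emeasure lborel ((\<lambda>t. v i + c * t) -` A i) = emeasure lborel (A i)" if i: "i < N" for i
    proof -
      have "emeasure lborel (A i) = (\<integral>\<^sup>+x. indicator (A i) x \<partial>lborel)" using A[OF i] by simp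
      also have "\<dots> = ennreal \<bar>c\<bar> * (\<integral>\<^sup>+x. indicator (A i) (v i + c * x) \<partial>lborel)"
        using A[OF i] c by (intro nn_integral_real_affine) auto
      also have "(\<integral>\<^sup>+x. indicator (A i) (v i + c * x) \<partial>lborel) = (\<integral>\<^sup>+x. indicator ((\<lambda>t. v i + c * t) -` A i) x \<partial>lborel)"
        by (intro nn_integral_cong) (auto simp: indicator_def)
      also have "\<dots> = emeasure lborel ((\<lambda>t. v i + c * t) -` A i)" using mpre[OF i] by simp
      finally show ?thesis by simp
    qed
    have "emeasure ?P (Pi\<^sub>E {..<N} A) = ennreal (\<bar>c\<bar> ^ N) * (\<Prod>i<N. emeasure lborel ((\<lambda>t. v i + c * t) -` A i))"
      using m box by (simp add: emeasure_distr pre emeasure_LN_PiE mpre)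
    also have "\<dots> = (\<Prod>i<N. ennreal \<bar>c\<bar> * emeasure lborel ((\<lambda>t. v i + c * t) -` A i))"
      by (simp add: prod.distrib ennreal_power)
    also have "\<dots> = (\<Prod>i<N. emeasure lborel (A i))" by (intro prod.cong) (auto simp: one)
    finally show "emeasure ?P (Pi\<^sub>E {..<N} A) = (\<Prod>i<N. emeasure lborel (A i))" .
  qed auto
qed

lemma nn_integral_LN_affine:
  assumes [measurable]: "f \<in> borel_measurable (LN N)" and c: "c \<noteq> 0"
  shows "(\<integral>\<^sup>+x. f x \<partial>LN N) = ennreal (\<bar>c\<bar> ^ N) * (\<integral>\<^sup>+x. f (along N v c x) \<partial>LN N)"
proof -
  have m: "along N v c \<in> LN N \<rightarrow>\<^sub>M LN N"
    unfolding along_def by (rule measurable_restrict) simp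
  have "(\<integral>\<^sup>+x. f x \<partial>LN N) = (\<integral>\<^sup>+x. f x \<partial>scale_measure (ennreal (\<bar>c\<bar> ^ N)) (distr (LN N) (LN N) (along N v c)))"
    by (subst distr_LN_affine[OF c]) simp
  also have "\<dots> = ennreal (\<bar>c\<bar> ^ N) * (\<integral>\<^sup>+x. f (along N v c x) \<partial>LN N)"
    using m by (subst nn_integral_scale_measure) (auto simp: nn_integral_distr)
  finally show ?thesis .
qed

lemma nn_integral_LN_shift:
  assumes [measurable]: "f \<in> borel_measurable (LN N)"
  shows "(\<integral>\<^sup>+x. f (along N x t z) \<partial>LN N) = (\<integral>\<^sup>+x. f x \<partial>LN N)"
proof -
  have "along N (\<lambda>i. t * z i) 1 x = along N x t z" for x by (auto simp: along_def)
  then show ?thesis using nn_integral_LN_affine[OF assms, of 1 "\<lambda>i. t * z i"] by simp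
qed

text \<open>
  The space of extensional functions on \<open>{..<N}\<close> is a retract of the space of all functions on the
  natural numbers, by extension with zero and by restriction. Both maps are measurable, and in the
  larger space the Borel sets are the sets of the product measure.
\<close>

lemma sets_LN_openin:
  assumes "openin (RN N) U"
  shows "U \<in> sets (LN N)"
proof -
  define e :: "(nat \<Rightarrow> real) \<Rightarrow> nat \<Rightarrow> real" where "e x i = (if i < N then x i else 0)" for x i
  define r :: "(nat \<Rightarrow> real) \<Rightarrow> nat \<Rightarrow> real" where "r x = restrict x {..<N}" for x
  have "continuous_map (powertop_real UNIV) (RN N) r"
    unfolding continuous_map_componentwise r_def
    by (auto simp: restrict_def extensional_def intro: continuous_map_product_projection[of _ UNIV "\<lambda>_. euclideanreal", simplified])
  then have "openin (powertop_real UNIV) {x \<in> topspace (powertop_real UNIV). r x \<in> U}"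
    using assms by (rule openin_continuous_map_preimage)
  then have "open {x. r x \<in> U}"
    by (simp add: euclidean_product_topology)
  then have "{x. r x \<in> U} \<in> sets (Pi\<^sub>M UNIV (\<lambda>_. borel))"
    unfolding sets_PiM_equal_borel by simp
  moreover have "e \<in> LN N \<rightarrow>\<^sub>M Pi\<^sub>M UNIV (\<lambda>_. borel)"
  proof (rule measurable_PiM_single')
    fix i :: nat show "(\<lambda>x. e x i) \<in> borel_measurable (LN N)"
      by (cases "i < N") (simp_all add: e_def)
  qed auto
  ultimately have "e -` {x. r x \<in> U} \<inter> space (LN N) \<in> sets (LN N)"
    by (rule measurable_sets[rotated])
  moreover have "r (e x) = x" if "x \<in> space (LN N)" for x
    using that unfolding space_LN r_def e_def by (auto simp: restrict_def PiE_def extensional_def)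
  then have "e -` {x. r x \<in> U} \<inter> space (LN N) = U"
    using openin_subset[OF assms] by (auto simp: space_LN topspace_RN)
  ultimately show ?thesis by simp
qed

lemma measurable_LN_continuous_map:
  assumes "continuous_map (RN N) euclideanreal f"
  shows "f \<in> borel_measurable (LN N)"
proof (rule borel_measurableI)
  fix S :: "real set" assume "open S"
  then have "openin (RN N) {x \<in> topspace (RN N). f x \<in> S}"
    by (intro openin_continuous_map_preimage[OF assms]) auto
  moreover have "f -` S \<inter> space (LN N) = {x \<in> topspace (RN N). f x \<in> S}"
    by (auto simp: space_LN topspace_RN)
  ultimately show "f -` S \<inter> space (LN N) \<in> sets (LN N)"
    by (metis sets_LN_openin)
qed

text \<open>
  Fubini's theorem for the lines in an arbitrary direction \<open>z\<close>, without a change of coordinates: among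
  the points \<open>x\<close> whose \<open>i\<close>-th coordinate lies in \<open>[0, 1]\<close>, every line is counted for a parameter set of
  length \<open>1 / \<bar>z i\<bar>\<close>. The reason is translation invariance.
\<close>

lemma nn_integral_lines:
  assumes F [measurable]: "F \<in> borel_measurable (LN N)" and z [measurable]: "z \<in> space (LN N)" and i: "i < N" "z i \<noteq> 0"
  shows "(\<integral>\<^sup>+x. F x \<partial>LN N) = ennreal \<bar>z i\<bar> *
    (\<integral>\<^sup>+x. indicator {0..1} (x i) * (\<integral>\<^sup>+t. F (along N x t z) \<partial>lborel) \<partial>LN N)"
proof -
  interpret pair_sigma_finite lborel "LN N" by (rule pair_sigma_finite_LN)
  have [measurable]: "(\<lambda>x. x i) \<in> borel_measurable (LN N)" using i by simp
  have [measurable]: "(\<lambda>w. along N (f w) (g w) z) \<in> M \<rightarrow>\<^sub>M LN N" 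
    if "f \<in> M \<rightarrow>\<^sub>M LN N" "g \<in> borel_measurable M" for M and f :: "'b \<Rightarrow> _" and g
    using that by (intro measurable_along measurable_const z)
  have 1: "ennreal \<bar>z i\<bar> * (\<integral>\<^sup>+t. indicator {0..1} (y i + (- t) * z i) \<partial>lborel) = 1" for y :: "nat \<Rightarrow> real"
    using nn_integral_real_affine[of "indicator {0..1}" "- z i" "y i"] i by (simp add: mult.commute)
  have "(\<integral>\<^sup>+x. indicator {0..1} (x i) * (\<integral>\<^sup>+t. F (along N x t z) \<partial>lborel) \<partial>LN N) =
    (\<integral>\<^sup>+x. \<integral>\<^sup>+t. indicator {0..1} (x i) * F (along N x t z) \<partial>lborel \<partial>LN N)"
    by (intro nn_integral_cong nn_integral_cmult[symmetric]) auto
  also have "\<dots> = (\<integral>\<^sup>+t. \<integral>\<^sup>+x. indicator {0..1} (x i) * F (along N x t z) \<partial>LN N \<partial>lborel)"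
    by (rule Fubini') measurable
  also have "\<dots> = (\<integral>\<^sup>+t. \<integral>\<^sup>+x. indicator {0..1} (x i + (- t) * z i) * F x \<partial>LN N \<partial>lborel)"
  proof (rule nn_integral_cong)
    fix t :: real
    have "(\<integral>\<^sup>+x. indicator {0..1} (x i) * F (along N x t z) \<partial>LN N) =
      (\<integral>\<^sup>+x. indicator {0..1} (along N x t z i + (- t) * z i) * F (along N x t z) \<partial>LN N)"
      using i by simp
    also have "\<dots> = (\<integral>\<^sup>+x. indicator {0..1} (x i + (- t) * z i) * F x \<partial>LN N)"
      by (rule nn_integral_LN_shift) measurable
    finally show "(\<integral>\<^sup>+x. indicator {0..1} (x i) * F (along N x t z) \<partial>LN N) = \<dots>" .
  qed
  also have "\<dots> = (\<integral>\<^sup>+x. \<integral>\<^sup>+t. indicator {0..1} (x i + (- t) * z i) * F x \<partial>lborel \<partial>LN N)"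
    by (rule Fubini'[symmetric]) measurable
  also have "\<dots> = (\<integral>\<^sup>+x. (\<integral>\<^sup>+t. indicator {0..1} (x i + (- t) * z i) \<partial>lborel) * F x \<partial>LN N)"
    by (intro nn_integral_cong nn_integral_multc) auto
  finally have "ennreal \<bar>z i\<bar> * (\<integral>\<^sup>+x. indicator {0..1} (x i) * (\<integral>\<^sup>+t. F (along N x t z) \<partial>lborel) \<partial>LN N)
    = (\<integral>\<^sup>+x. ennreal \<bar>z i\<bar> * ((\<integral>\<^sup>+t. indicator {0..1} (x i + (- t) * z i) \<partial>lborel) * F x) \<partial>LN N)"
    by (simp only:) (rule nn_integral_cmult[symmetric], measurable)
  also have "\<dots> = (\<integral>\<^sup>+x. F x \<partial>LN N)"
    by (simp only: mult.assoc[symmetric] 1 mult_1_left)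
  finally show ?thesis by simp
qed

lemma nn_integral_le_of_lines:
  assumes "F \<in> borel_measurable (LN N)" "G \<in> borel_measurable (LN N)" and "z \<in> space (LN N)" and "i < N" "z i \<noteq> 0"
    and "\<And>x. x \<in> space (LN N) \<Longrightarrow> (\<integral>\<^sup>+t. F (along N x t z) \<partial>lborel) \<le> (\<integral>\<^sup>+t. G (along N x t z) \<partial>lborel)"
  shows "(\<integral>\<^sup>+x. F x \<partial>LN N) \<le> (\<integral>\<^sup>+x. G x \<partial>LN N)"
  unfolding nn_integral_lines[OF assms(1,3-5)] nn_integral_lines[OF assms(2,3-5)]
  by (intro mult_left_mono nn_integral_mono assms(6)) auto

lemma nn_Gamma_substitution:
  fixes g g' :: "real \<Rightarrow> real"
  assumes a: "a > 0" and g: "bij_betw g {0<..} {0<..}" 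
    and d: "\<And>s. s > 0 \<Longrightarrow> (g has_real_derivative g' s) (at s)"
  shows "(\<integral>\<^sup>+s\<in>{0<..}. ennreal (\<bar>g' s\<bar> * (g s powr (a - 1) / exp (g s))) \<partial>lborel) = ennreal (Gamma a)"
proof -
  let ?f = "\<lambda>t::real. t powr (a - 1) / exp t"
  have "negligible {x \<in> {0..} - {0<..}. ?f x \<noteq> 0}" "negligible {x \<in> {0<..} - {0..}. ?f x \<noteq> 0}"
    by (rule negligible_subset[OF negligible_sing[of "0::real"]]; auto)+
  from has_integral_spike_set_eq[OF this] Gamma_integral_real[OF a]
  have f: "(?f has_integral Gamma a) {0<..}" by blast
  have f_abs: "?f absolutely_integrable_on {0<..}"
    by (rule nonnegative_absolutely_integrable_1[OF has_integral_integrable[OF f]]) simp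
  have im: "g ` {0<..} = {0<..}" and inj: "inj_on g {0<..}" using g by (auto simp: bij_betw_def)
  have "(\<lambda>x. \<bar>g' x\<bar> * ?f (g x)) absolutely_integrable_on {0<..} \<and> integral {0<..} (\<lambda>x. \<bar>g' x\<bar> * ?f (g x)) = Gamma a"
  proof (rule iffD2[OF has_absolute_integral_change_of_variables_1'[where f="?f" and g=g and g'=g' and S="{0<..}" and b="Gamma a"]])
    show "(g has_field_derivative g' x) (at x within {0<..})" if "x \<in> {0<..}" for x
      using d that by (auto intro: has_field_derivative_at_within)
    show "?f absolutely_integrable_on g ` {0<..} \<and> integral (g ` {0<..}) ?f = Gamma a"
      unfolding im using f_abs integral_unique[OF f] by blast
  qed (use inj in auto)
  then have "((\<lambda>x. \<bar>g' x\<bar> * ?f (g x)) has_integral Gamma a) {0<..}"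
    unfolding has_integral_iff using set_lebesgue_integral_eq_integral(1) by blast
  from nn_integral_has_integral_lebesgue[OF _ this]
  have "integral\<^sup>N lborel (\<lambda>x. ennreal (indicator {0<..} x * (\<bar>g' x\<bar> * ?f (g x)))) = ennreal (Gamma a)"
    by (simp only: abs_ge_zero powr_ge_zero exp_ge_zero mult_nonneg_nonneg divide_nonneg_nonneg)
  moreover have "(\<integral>\<^sup>+s\<in>{0<..}. ennreal (\<bar>g' s\<bar> * (g s powr (a - 1) / exp (g s))) \<partial>lborel) = 
    integral\<^sup>N lborel (\<lambda>x. ennreal (indicator {0<..} x * (\<bar>g' x\<bar> * ?f (g x))))"
    by (intro nn_integral_cong) (auto simp: indicator_def)
  ultimately show ?thesis by (simp only:)
qed

text \<open>
  Half of the Gamma integral, with \<open>h(s)\<^sup>2\<close> as the variable of integration. The identity \<open>h\<close> gives the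
  moments of the Gaussian measure, and \<open>h(s) = r / s\<close> the integral over \<open>ds / s\<close> in \<open>nn_integral_rays\<close>.
\<close>

lemma nn_Gamma_square_substitution:
  fixes h h' :: "real \<Rightarrow> real"
  assumes [measurable]: "h \<in> borel_measurable borel" "h' \<in> borel_measurable borel"
    and q: "0 < q" and h: "bij_betw h {0<..} {0<..}" 
    and d: "\<And>s. s > 0 \<Longrightarrow> (h has_real_derivative h' s) (at s)"
  shows "(\<integral>\<^sup>+s\<in>{0<..}. ennreal (\<bar>h' s\<bar> * (h s powr (q - 1) * exp (- (h s)\<^sup>2))) \<partial>lborel) = ennreal (Gamma (q / 2) / 2)"
proof -
  let ?g = "\<lambda>s. (h s)\<^sup>2" and ?g' = "\<lambda>s. 2 * h s * h' s"
  have pos: "0 < h s" if "s > 0" for s using h that by (auto simp: bij_betw_def)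
  have "bij_betw (\<lambda>t::real. t\<^sup>2) {0<..} {0<..}"
    by (rule bij_betwI[of _ _ _ sqrt]) auto
  from bij_betw_trans[OF h this] have "bij_betw ?g {0<..} {0<..}" by (simp add: o_def)
  moreover have "(?g has_real_derivative ?g' s) (at s)" if "s > 0" for s
    using d[OF that] by (auto intro!: derivative_eq_intros)
  ultimately have G: "(\<integral>\<^sup>+s\<in>{0<..}. ennreal (\<bar>?g' s\<bar> * (?g s powr (q / 2 - 1) / exp (?g s))) \<partial>lborel) = ennreal (Gamma (q / 2))"
    using q by (intro nn_Gamma_substitution) auto
  have pt: "\<bar>h' s\<bar> * (h s powr (q - 1) * exp (- (h s)\<^sup>2)) = 1 / 2 * (\<bar>?g' s\<bar> * (?g s powr (q / 2 - 1) / exp (?g s)))" if "s > 0" for s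
  proof -
    have "?g s powr (q / 2 - 1) = (h s powr 2) powr (q / 2 - 1)" using pos[OF that] by simp
    also have "\<dots> = h s powr (q - 1 - 1)" by (simp only: powr_powr) (simp add: algebra_simps)
    also have "\<dots> = h s powr (q - 1) / h s" using pos[OF that] by (subst powr_diff) auto
    finally have e: "?g s powr (q / 2 - 1) = h s powr (q - 1) / h s" .
    show ?thesis unfolding e using pos[OF that] by (simp add: exp_minus abs_mult field_simps)
  qed
  have "(\<integral>\<^sup>+s\<in>{0<..}. ennreal (\<bar>h' s\<bar> * (h s powr (q - 1) * exp (- (h s)\<^sup>2))) \<partial>lborel) =
    (\<integral>\<^sup>+s. ennreal (1 / 2) * (ennreal (\<bar>?g' s\<bar> * (?g s powr (q / 2 - 1) / exp (?g s))) * indicator {0<..} s) \<partial>lborel)"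
  proof (rule nn_integral_cong)
    fix s :: real
    show "ennreal (\<bar>h' s\<bar> * (h s powr (q - 1) * exp (- (h s)\<^sup>2))) * indicator {0<..} s =
       ennreal (1 / 2) * (ennreal (\<bar>?g' s\<bar> * (?g s powr (q / 2 - 1) / exp (?g s))) * indicator {0<..} s)"
    proof (cases "s > 0")
      case True
      have "ennreal (1 / 2 * (\<bar>?g' s\<bar> * (?g s powr (q / 2 - 1) / exp (?g s)))) =
         ennreal (1 / 2) * ennreal (\<bar>?g' s\<bar> * (?g s powr (q / 2 - 1) / exp (?g s)))"
        by (rule ennreal_mult) auto
      then show ?thesis unfolding pt[OF True] using True by (simp only: indicator_simps greaterThan_iff mult_1_right)
    qed simp
  qed
  also have "\<dots> = ennreal (1 / 2) * ennreal (Gamma (q / 2))"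
    unfolding G[symmetric] by (rule nn_integral_cmult) measurable
  also have "\<dots> = ennreal (Gamma (q / 2) / 2)" 
    using q by (subst ennreal_mult[symmetric]) (auto intro!: Gamma_real_nonneg)
  finally show ?thesis .
qed

lemma nn_integral_radial:
  fixes r q :: real
  assumes r: "0 < r" and q: "0 < q"
  shows "(\<integral>\<^sup>+s\<in>{0<..}. ennreal ((r / s) powr q * exp (- ((r / s)\<^sup>2)) / s) \<partial>lborel) = ennreal (Gamma (q / 2) / 2)"
proof -
  have "bij_betw (\<lambda>s. r / s) {0<..} {0<..}"
    by (rule bij_betwI[of _ _ _ "\<lambda>s. r / s"]) (use r in auto)
  moreover have "((\<lambda>s. r / s) has_real_derivative - (r / s\<^sup>2)) (at s)" if "s > 0" for s
    using that by (auto intro!: derivative_eq_intros simp: power2_eq_square)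
  ultimately have "(\<integral>\<^sup>+s\<in>{0<..}. ennreal (\<bar>- (r / s\<^sup>2)\<bar> * ((r / s) powr (q - 1) * exp (- (r / s)\<^sup>2))) \<partial>lborel) = ennreal (Gamma (q / 2) / 2)"
    using q by (intro nn_Gamma_square_substitution) auto
  moreover have "\<bar>- (r / s\<^sup>2)\<bar> * ((r / s) powr (q - 1) * exp (- (r / s)\<^sup>2)) = (r / s) powr q * exp (- ((r / s)\<^sup>2)) / s" if "s > 0" for s
  proof -
    have "(r / s) powr (q - 1) = (r / s) powr q / (r / s)" using that r by (subst powr_diff) auto
    then show ?thesis using that r by (simp add: power2_eq_square)
  qed
  then have "(\<integral>\<^sup>+s\<in>{0<..}. ennreal (\<bar>- (r / s\<^sup>2)\<bar> * ((r / s) powr (q - 1) * exp (- (r / s)\<^sup>2))) \<partial>lborel) = 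
    (\<integral>\<^sup>+s\<in>{0<..}. ennreal ((r / s) powr q * exp (- ((r / s)\<^sup>2)) / s) \<partial>lborel)"
    by (intro nn_integral_cong) (simp split: split_indicator)
  ultimately show ?thesis by (simp only:)
qed

section \<open>Gaussian averages\<close>

lemma measurable_L2_set [measurable]:
  assumes "f \<in> M \<rightarrow>\<^sub>M LN N"
  shows "(\<lambda>w. L2_set (f w) {..<N}) \<in> borel_measurable M"
proof -
  have [measurable]: "(\<lambda>w. f w i) \<in> borel_measurable M" if "i \<in> {..<N}" for i
    using measurable_LN_component[OF assms] that by auto
  show ?thesis unfolding L2_set_def by measurable
qed

lemma measurable_edist [measurable]:
  assumes "f \<in> M \<rightarrow>\<^sub>M LN N" "g \<in> M \<rightarrow>\<^sub>M LN N"
  shows "(\<lambda>w. edist N (f w) (g w)) \<in> borel_measurable M"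
proof -
  have "edist N x y = L2_set (along N x (-1) y) {..<N}" for x y
    unfolding edist_def by (intro L2_set_cong) auto
  then show ?thesis using assms by simp
qed

lemma edist_nonneg [simp]: "0 \<le> edist N x y"
  by (simp add: edist_def)

lemma LN_ext:
  assumes "x \<in> space (LN N)" "y \<in> space (LN N)" "\<And>i. i < N \<Longrightarrow> x i = y i"
  shows "x = y"
  by (rule PiE_ext[OF assms(1,2)[unfolded space_LN]]) (use assms(3) in auto)

lemma edist_pos:
  assumes "x \<in> space (LN N)" "y \<in> space (LN N)" "x \<noteq> y"
  shows "0 < edist N x y"
proof -
  have "\<exists>i<N. x i \<noteq> y i"
    using LN_ext assms by blast
  then have "edist N x y \<noteq> 0" by (auto simp: edist_def L2_set_eq_0_iff)
  then show ?thesis using edist_nonneg[of N x y] by linarith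
qed

lemma AE_LN_neq:
  assumes N: "N \<ge> 1"
  shows "AE y in LN N. y \<noteq> x"
proof (cases "x \<in> space (LN N)")
  case True
  have "emeasure (LN N) (Pi\<^sub>E {..<N} (\<lambda>i. {x i})) = (\<Prod>i<N. emeasure lborel {x i})"
    by (rule emeasure_LN_PiE) auto
  also have "\<dots> = 0" using N by (auto simp: prod_zero_iff intro!: bexI[of _ 0])
  finally have "Pi\<^sub>E {..<N} (\<lambda>i. {x i}) \<in> null_sets (LN N)"
    by (auto intro!: sets_PiM_I_finite)
  moreover have "Pi\<^sub>E {..<N} (\<lambda>i. {x i}) = {x}"
  proof (intro set_eqI iffI)
    fix y assume y: "y \<in> Pi\<^sub>E {..<N} (\<lambda>i. {x i})"
    then have "y = x" by (intro LN_ext[of _ N] True) (auto simp: space_LN PiE_def Pi_iff)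
    then show "y \<in> {x}" by simp
  qed (use True in \<open>auto simp: space_LN PiE_def\<close>)
  ultimately have "{x} \<in> null_sets (LN N)" by simp
  from AE_not_in[OF this] show ?thesis by simp
next
  case False
  then show ?thesis by (intro AE_I2) auto
qed

text \<open>
  This is integration in polar coordinates about \<open>x\<close>, with the Gaussian factor in place of the surface
  measure. For fixed \<open>s\<close> the substitution \<open>y = x + s z\<close> moves the scaling from \<open>U\<close> to this factor. It then
  depends on \<open>\<bar>y - x\<bar> / s\<close> only, and its integral with respect to \<open>ds / s\<close> is the same for all \<open>y \<noteq> x\<close>.
\<close>

lemma nn_integral_rays:
  assumes N: "N \<ge> 1" and U [measurable]: "U \<in> sets (LN N)" and x [measurable]: "x \<in> space (LN N)" and q: "0 < q"
  shows "(\<integral>\<^sup>+z. ennreal (L2_set z {..<N} powr q * exp (- (L2_set z {..<N})\<^sup>2)) *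
       (\<integral>\<^sup>+s\<in>{0<..}. ennreal (s ^ (N - 1)) * indicator U (along N x s z) \<partial>lborel) \<partial>LN N)
     = ennreal (Gamma (q / 2) / 2) * emeasure (LN N) U"
proof -
  interpret pair_sigma_finite lborel "LN N" by (rule pair_sigma_finite_LN)
  define w where "w z = ennreal (L2_set z {..<N} powr q * exp (- (L2_set z {..<N})\<^sup>2))" for z
  have [measurable]: "w \<in> borel_measurable (LN N)" unfolding w_def[abs_def] by measurable
  have [measurable]: "(\<lambda>v. along N x (g v) (f v)) \<in> M \<rightarrow>\<^sub>M LN N" 
    if "f \<in> M \<rightarrow>\<^sub>M LN N" "g \<in> borel_measurable M" for M and f :: "'b \<Rightarrow> _" and g
    using that by (intro measurable_along measurable_const x)
  have [measurable]: "(\<lambda>y. edist N y x) \<in> borel_measurable (LN N)"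
    by (intro measurable_edist measurable_const x) simp
  define R where "R s y = ennreal ((edist N y x / s) powr q * exp (- ((edist N y x / s)\<^sup>2)) / s) * indicator {0<..} s" for s y
  have slice: "(\<integral>\<^sup>+z. w z * (ennreal (s ^ (N - 1)) * indicator U (along N x s z) * indicator {0<..} s) \<partial>LN N) =
      (\<integral>\<^sup>+y. R s y * indicator U y \<partial>LN N)" for s
  proof (cases "s > 0")
    case True
    define f where "f y = R s y * indicator U y" for y
    have [measurable]: "f \<in> borel_measurable (LN N)" unfolding f_def[abs_def] R_def by measurable
    have "f (along N x s z) = ennreal (1 / s) * (w z * indicator U (along N x s z))" if "z \<in> space (LN N)" for z
    proof -
      have "edist N (along N x s z) x = s * L2_set z {..<N}"
        unfolding edist_def using True by (subst L2_set_right_distrib) (auto intro!: L2_set_cong)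
      then show ?thesis using True 
        by (simp add: f_def R_def w_def indicator_def ennreal_mult'[symmetric])
    qed
    then have "(\<integral>\<^sup>+y. f y \<partial>LN N) = ennreal (s ^ N) * (\<integral>\<^sup>+z. ennreal (1 / s) * (w z * indicator U (along N x s z)) \<partial>LN N)"
      using True by (subst nn_integral_LN_affine[where c=s and v=x]) (auto intro!: arg_cong2[of _ _ _ _ "(*)"] nn_integral_cong)
    also have "\<dots> = ennreal (s ^ N) * (ennreal (1 / s) * (\<integral>\<^sup>+z. w z * indicator U (along N x s z) \<partial>LN N))"
      by (subst nn_integral_cmult) auto
    also have "\<dots> = ennreal (s ^ N * (1 / s)) * (\<integral>\<^sup>+z. w z * indicator U (along N x s z) \<partial>LN N)"
      using True by (subst ennreal_mult) (auto simp: mult.assoc)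
    also have "s ^ N * (1 / s) = s ^ (N - 1)" 
      using True N by (cases N) auto
    also have "ennreal (s ^ (N - 1)) * (\<integral>\<^sup>+z. w z * indicator U (along N x s z) \<partial>LN N) = 
      (\<integral>\<^sup>+z. ennreal (s ^ (N - 1)) * (w z * indicator U (along N x s z)) \<partial>LN N)"
      by (subst nn_integral_cmult) auto
    finally show ?thesis using True by (simp add: f_def mult_ac)
  qed (simp add: R_def)
  have "(\<integral>\<^sup>+z. w z * (\<integral>\<^sup>+s\<in>{0<..}. ennreal (s ^ (N - 1)) * indicator U (along N x s z) \<partial>lborel) \<partial>LN N) =
    (\<integral>\<^sup>+z. \<integral>\<^sup>+s. w z * (ennreal (s ^ (N - 1)) * indicator U (along N x s z) * indicator {0<..} s) \<partial>lborel \<partial>LN N)"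
    by (intro nn_integral_cong nn_integral_cmult[symmetric]) auto
  also have "\<dots> = (\<integral>\<^sup>+s. \<integral>\<^sup>+z. w z * (ennreal (s ^ (N - 1)) * indicator U (along N x s z) * indicator {0<..} s) \<partial>LN N \<partial>lborel)"
    by (rule Fubini') measurable
  also have "\<dots> = (\<integral>\<^sup>+s. \<integral>\<^sup>+y. R s y * indicator U y \<partial>LN N \<partial>lborel)"
    by (simp only: slice)
  also have "\<dots> = (\<integral>\<^sup>+y. \<integral>\<^sup>+s. R s y * indicator U y \<partial>lborel \<partial>LN N)"
    unfolding R_def by (rule Fubini'[symmetric]) measurable
  also have "\<dots> = (\<integral>\<^sup>+y. ennreal (Gamma (q / 2) / 2) * indicator U y \<partial>LN N)"
  proof (rule nn_integral_cong_AE)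
    show "AE y in LN N. (\<integral>\<^sup>+s. R s y * indicator U y \<partial>lborel) = ennreal (Gamma (q / 2) / 2) * indicator U y"
      using AE_LN_neq[OF N, of x] AE_space
    proof eventually_elim
      case (elim y)
      have "(\<integral>\<^sup>+s. R s y * indicator U y \<partial>lborel) = (\<integral>\<^sup>+s. R s y \<partial>lborel) * indicator U y"
        unfolding R_def by (rule nn_integral_multc) measurable
      also have "(\<integral>\<^sup>+s. R s y \<partial>lborel) = ennreal (Gamma (q / 2) / 2)"
        unfolding R_def using elim x q by (intro nn_integral_radial edist_pos) auto
      finally show ?case .
    qed
  qed
  also have "\<dots> = ennreal (Gamma (q / 2) / 2) * emeasure (LN N) U"
    by (rule nn_integral_cmult_indicator) simp
  finally show ?thesis unfolding w_def .
qed

lemma nn_integral_power_upto: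
  fixes b :: real
  assumes "N \<ge> 1" "0 \<le> b"
  shows "(\<integral>\<^sup>+s\<in>{0<..<b}. ennreal (s ^ (N - 1)) \<partial>lborel) = ennreal (b ^ N / real N)"
proof -
  have "(\<integral>\<^sup>+s\<in>{0..b}. ennreal (s ^ (N - 1)) \<partial>lborel) = ennreal (b ^ N / real N - 0 ^ N / real N)"
  proof (rule nn_integral_FTC_Icc)
    fix s assume "s \<in> {0..b}"
    have "((\<lambda>s. s ^ N / real N) has_real_derivative real N * s ^ (N - 1) / real N) (at s)"
      by (auto intro!: derivative_eq_intros)
    then show "((\<lambda>s. s ^ N / real N) has_real_derivative s ^ (N - 1)) (at s)"
      using assms by simp
  qed (use assms in auto)
  moreover have "(\<integral>\<^sup>+s\<in>{0..b}. ennreal (s ^ (N - 1)) \<partial>lborel) = (\<integral>\<^sup>+s\<in>{0<..<b}. ennreal (s ^ (N - 1)) \<partial>lborel)"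
    using AE_lborel_singleton[of "0::real"] AE_lborel_singleton[of b]
    by (intro nn_integral_cong_AE) (auto simp: indicator_def)
  moreover have "(0::real) ^ N = 0" using assms by (simp add: power_0_left)
  ultimately show ?thesis by simp
qed

lemma L2_set_pos:
  assumes "z \<in> space (LN N)" "z \<noteq> (\<lambda>i\<in>{..<N}. 0)"
  shows "0 < L2_set z {..<N}"
proof -
  have "\<exists>i<N. z i \<noteq> 0"
    using LN_ext[of z N "\<lambda>i\<in>{..<N}. 0"] assms by (auto simp: space_LN)
  then have "L2_set z {..<N} \<noteq> 0" by (auto simp: L2_set_eq_0_iff)
  then show ?thesis using L2_set_nonneg[of z "{..<N}"] by linarith
qed

lemma continuous_map_component: "i < N \<Longrightarrow> continuous_map (RN N) euclideanreal (\<lambda>x. x i)"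
  by (rule continuous_map_product_projection[of i "{..<N}" "\<lambda>_. euclideanreal"]) simp

lemma continuous_map_L2_set: "continuous_map (RN N) euclideanreal (\<lambda>x. L2_set x {..<N})"
proof -
  have "continuous_map (RN N) euclideanreal (sqrt \<circ> (\<lambda>x. \<Sum>i<N. (x i)\<^sup>2))"
    by (rule continuous_map_compose[where X'=euclideanreal])
      (auto intro!: continuous_map_sum continuous_map_real_pow continuous_map_component continuous_intros)
  then show ?thesis by (simp add: L2_set_def o_def)
qed

lemma openin_unit_ball: "openin (RN N) (unit_ball N)"
proof -
  have "openin (RN N) {x \<in> topspace (RN N). L2_set x {..<N} \<in> {..<1}}"
    by (intro openin_continuous_map_preimage[OF continuous_map_L2_set]) auto
  then show ?thesis by (simp add: unit_ball_def)
qed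

text \<open>
  The case of the unit ball in \<open>nn_integral_rays\<close>, where the integral over the ray in direction \<open>z\<close> is
  \<open>\<bar>z\<bar>\<^sup>-\<^sup>N / N\<close>.
\<close>

lemma nn_integral_gauss_powr:
  assumes N: "N \<ge> 1" and p: "0 \<le> p"
  shows "(\<integral>\<^sup>+z. ennreal (L2_set z {..<N} powr p * exp (- (L2_set z {..<N})\<^sup>2)) \<partial>LN N)
     = ennreal (real N * Gamma ((real N + p) / 2) / 2) * emeasure (LN N) (unit_ball N)"
proof -
  let ?o = "\<lambda>i\<in>{..<N}. 0 :: real"
  have o [measurable]: "?o \<in> space (LN N)" by (auto simp: space_LN)
  have U [measurable]: "unit_ball N \<in> sets (LN N)" by (rule sets_LN_openin[OF openin_unit_ball])
  have "ennreal (real N) * (ennreal (L2_set z {..<N} powr (p + real N) * exp (- (L2_set z {..<N})\<^sup>2)) *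
       (\<integral>\<^sup>+s\<in>{0<..}. ennreal (s ^ (N - 1)) * indicator (unit_ball N) (along N ?o s z) \<partial>lborel)) = 
     ennreal (L2_set z {..<N} powr p * exp (- (L2_set z {..<N})\<^sup>2))" 
    if z: "z \<in> space (LN N)" "z \<noteq> ?o" for z
  proof -
    let ?r = "L2_set z {..<N}"
    have r: "0 < ?r" using L2_set_pos[OF z] .
    have "L2_set (along N ?o s z) {..<N} = s * ?r" if "s > 0" for s
      using that by (subst L2_set_right_distrib) (auto intro!: L2_set_cong)
    then have "along N ?o s z \<in> unit_ball N \<longleftrightarrow> s < 1 / ?r" if "s > 0" for s
      using that r by (simp add: unit_ball_def topspace_RN pos_less_divide_eq)
    then have "(\<integral>\<^sup>+s\<in>{0<..}. ennreal (s ^ (N - 1)) * indicator (unit_ball N) (along N ?o s z) \<partial>lborel) =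
       (\<integral>\<^sup>+s\<in>{0<..<1 / ?r}. ennreal (s ^ (N - 1)) \<partial>lborel)"
      by (intro nn_integral_cong) (auto simp: indicator_def)
    also have "\<dots> = ennreal ((1 / ?r) ^ N / real N)"
      using N r by (intro nn_integral_power_upto) auto
    finally have I: "(\<integral>\<^sup>+s\<in>{0<..}. ennreal (s ^ (N - 1)) * indicator (unit_ball N) (along N ?o s z) \<partial>lborel) =
       ennreal ((1 / ?r) ^ N / real N)" .
    have "ennreal (real N) * (ennreal (?r powr (p + real N) * exp (- ?r\<^sup>2)) *
       (\<integral>\<^sup>+s\<in>{0<..}. ennreal (s ^ (N - 1)) * indicator (unit_ball N) (along N ?o s z) \<partial>lborel)) = 
       ennreal (real N * (?r powr (p + real N) * exp (- ?r\<^sup>2) * ((1 / ?r) ^ N / real N)))"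
      unfolding I by (subst ennreal_mult'[symmetric], simp, subst ennreal_mult'[symmetric], simp, rule refl)
    also have "real N * (?r powr (p + real N) * exp (- ?r\<^sup>2) * ((1 / ?r) ^ N / real N)) = ?r powr p * exp (- ?r\<^sup>2)"
      using N r by (simp add: powr_add powr_realpow power_divide)
    finally show ?thesis .
  qed
  then have "(\<integral>\<^sup>+z. ennreal (L2_set z {..<N} powr p * exp (- (L2_set z {..<N})\<^sup>2)) \<partial>LN N) = 
    (\<integral>\<^sup>+z. ennreal (real N) * (ennreal (L2_set z {..<N} powr (p + real N) * exp (- (L2_set z {..<N})\<^sup>2)) *
       (\<integral>\<^sup>+s\<in>{0<..}. ennreal (s ^ (N - 1)) * indicator (unit_ball N) (along N ?o s z) \<partial>lborel)) \<partial>LN N)"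
    using AE_LN_neq[OF N, of ?o] AE_space 
    by (intro nn_integral_cong_AE) (auto elim!: eventually_elim2)
  also have "\<dots> = ennreal (real N) * (\<integral>\<^sup>+z. (ennreal (L2_set z {..<N} powr (p + real N) * exp (- (L2_set z {..<N})\<^sup>2)) *
       (\<integral>\<^sup>+s\<in>{0<..}. ennreal (s ^ (N - 1)) * indicator (unit_ball N) (along N ?o s z) \<partial>lborel)) \<partial>LN N)"
    by (intro nn_integral_cmult) measurable
  also have "\<dots> = ennreal (real N) * (ennreal (Gamma ((p + real N) / 2) / 2) * emeasure (LN N) (unit_ball N))"
    using N p by (subst nn_integral_rays[OF N U o]) auto
  also have "\<dots> = ennreal (real N * Gamma ((real N + p) / 2) / 2) * emeasure (LN N) (unit_ball N)"
    using N p by (simp add: mult.assoc[symmetric] ennreal_mult[symmetric] add.commute)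
  finally show ?thesis .
qed

text \<open>
  The normal density of mean \<open>0\<close> and variance \<open>1 / 2\<close>.
\<close>

definition gauss :: "real \<Rightarrow> real" where
  "gauss t = exp (- t\<^sup>2) / sqrt pi"

lemma gauss_nonneg: "0 \<le> gauss t" by (simp add: gauss_def)

lemma measurable_gauss [measurable]: "gauss \<in> borel_measurable borel"
  unfolding gauss_def[abs_def] by measurable

lemma gauss_scale: "a > 0 \<Longrightarrow> gauss (t / a) / a = normal_density 0 (a / sqrt 2) t"
  by (simp add: gauss_def normal_density_def power_divide real_sqrt_mult)

lemma nn_integral_gauss: "(\<integral>\<^sup>+t. ennreal (gauss t) \<partial>lborel) = 1"
proof -
  have "gauss t = normal_density 0 (1 / sqrt 2) t" for t using gauss_scale[of 1 t] by simp
  then show ?thesis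
    using prob_space.emeasure_space_1[OF prob_space_normal_density[of "1 / sqrt 2" 0]]
    by (simp add: emeasure_density)
qed

lemma nn_integral_gauss_scale:
  assumes [measurable]: "h \<in> borel_measurable borel" and a: "a \<noteq> 0"
  shows "(\<integral>\<^sup>+t. h (a * t + c) * ennreal (gauss t) \<partial>lborel) = 
    (\<integral>\<^sup>+x. h x * ennreal (normal_density 0 (\<bar>a\<bar> / sqrt 2) (x - c)) \<partial>lborel)"
proof -
  have "(\<integral>\<^sup>+x. h x * ennreal (normal_density 0 (\<bar>a\<bar> / sqrt 2) (x - c)) \<partial>lborel) = 
    ennreal \<bar>a\<bar> * (\<integral>\<^sup>+t. h (c + a * t) * ennreal (normal_density 0 (\<bar>a\<bar> / sqrt 2) (c + a * t - c)) \<partial>lborel)"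
    using a by (intro nn_integral_real_affine) auto
  also have "\<dots> = (\<integral>\<^sup>+t. ennreal \<bar>a\<bar> * (h (c + a * t) * ennreal (normal_density 0 (\<bar>a\<bar> / sqrt 2) (c + a * t - c))) \<partial>lborel)"
    by (intro nn_integral_cmult[symmetric]) auto
  also have "\<dots> = (\<integral>\<^sup>+t. h (a * t + c) * ennreal (gauss t) \<partial>lborel)"
  proof (rule nn_integral_cong)
    fix t
    have "\<bar>a\<bar> * normal_density 0 (\<bar>a\<bar> / sqrt 2) (a * t) = gauss t"
      using a by (subst gauss_scale[symmetric]) (auto simp: gauss_def power_divide power_mult_distrib)
    then have "ennreal \<bar>a\<bar> * ennreal (normal_density 0 (\<bar>a\<bar> / sqrt 2) (a * t)) = ennreal (gauss t)"
      by (simp add: ennreal_mult[symmetric])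
    then show "ennreal \<bar>a\<bar> * (h (c + a * t) * ennreal (normal_density 0 (\<bar>a\<bar> / sqrt 2) (c + a * t - c))) = h (a * t + c) * ennreal (gauss t)"
      by (metis add.commute add_diff_cancel_left' mult.commute mult.left_commute)
  qed
  finally show ?thesis ..
qed

text \<open>
  A linear combination of two independent centred normal variables is normal, and the variances
  add.
\<close>

lemma nn_integral_gauss_two:
  assumes [measurable]: "h \<in> borel_measurable borel"
  shows "(\<integral>\<^sup>+y. (\<integral>\<^sup>+t. h (a * t + b * y) * ennreal (gauss t) \<partial>lborel) * ennreal (gauss y) \<partial>lborel)
     = (\<integral>\<^sup>+t. h (sqrt (a\<^sup>2 + b\<^sup>2) * t) * ennreal (gauss t) \<partial>lborel)"
proof -
  have abs: "(\<integral>\<^sup>+t. h (a * t) * ennreal (gauss t) \<partial>lborel) = (\<integral>\<^sup>+t. h (\<bar>a\<bar> * t) * ennreal (gauss t) \<partial>lborel)" for a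
    using nn_integral_gauss_scale[of h a 0] nn_integral_gauss_scale[of h "\<bar>a\<bar>" 0] by (cases "a = 0") auto
  consider "a = 0" | "b = 0" | "a \<noteq> 0" "b \<noteq> 0" by auto
  then show ?thesis
  proof cases
    case 1
    then show ?thesis using abs[of b] by (simp add: nn_integral_cmult nn_integral_gauss)
  next
    case 2
    then show ?thesis using abs[of a] by (simp add: nn_integral_cmult nn_integral_gauss)
  next
    case 3
    let ?n = "\<lambda>a. normal_density 0 (\<bar>a\<bar> / sqrt 2)"
    have "(\<integral>\<^sup>+y. (\<integral>\<^sup>+t. h (a * t + b * y) * ennreal (gauss t) \<partial>lborel) * ennreal (gauss y) \<partial>lborel)
     = (\<integral>\<^sup>+y. (\<integral>\<^sup>+x. h x * ennreal (?n a (x - b * y)) \<partial>lborel) * ennreal (gauss y) \<partial>lborel)"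
      using 3 by (simp add: nn_integral_gauss_scale)
    also have "\<dots> = (\<integral>\<^sup>+y. (\<integral>\<^sup>+x. h x * ennreal (?n a (x - (b * y + 0))) \<partial>lborel) * ennreal (gauss y) \<partial>lborel)"
      by simp
    also have "\<dots> = (\<integral>\<^sup>+w. (\<integral>\<^sup>+x. h x * ennreal (?n a (x - w)) \<partial>lborel) * ennreal (?n b (w - 0)) \<partial>lborel)"
      using 3 by (intro nn_integral_gauss_scale) measurable
    also have "\<dots> = (\<integral>\<^sup>+w. \<integral>\<^sup>+x. h x * ennreal (?n a (x - w)) * ennreal (?n b w) \<partial>lborel \<partial>lborel)"
      by (intro nn_integral_cong) (simp add: nn_integral_multc)
    also have "\<dots> = (\<integral>\<^sup>+x. \<integral>\<^sup>+w. h x * ennreal (?n a (x - w)) * ennreal (?n b w) \<partial>lborel \<partial>lborel)"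
      by (rule lborel_pair.Fubini') measurable
    also have "\<dots> = (\<integral>\<^sup>+x. h x * (\<integral>\<^sup>+w. ennreal (?n a (x - w) * ?n b w) \<partial>lborel) \<partial>lborel)"
      by (intro nn_integral_cong) (subst nn_integral_cmult[symmetric], auto simp: ennreal_mult mult.assoc)
    also have "\<dots> = (\<integral>\<^sup>+x. h x * ennreal (normal_density 0 (sqrt ((\<bar>a\<bar> / sqrt 2)\<^sup>2 + (\<bar>b\<bar> / sqrt 2)\<^sup>2)) x) \<partial>lborel)"
      using 3 by (subst conv_normal_density_zero_mean[THEN fun_cong]) auto
    also have "sqrt ((\<bar>a\<bar> / sqrt 2)\<^sup>2 + (\<bar>b\<bar> / sqrt 2)\<^sup>2) = \<bar>sqrt (a\<^sup>2 + b\<^sup>2)\<bar> / sqrt 2"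
      by (simp add: power_divide add_divide_distrib[symmetric] real_sqrt_divide)
    also have "(\<integral>\<^sup>+x. h x * ennreal (normal_density 0 (\<bar>sqrt (a\<^sup>2 + b\<^sup>2)\<bar> / sqrt 2) x) \<partial>lborel) = 
      (\<integral>\<^sup>+t. h (sqrt (a\<^sup>2 + b\<^sup>2) * t) * ennreal (gauss t) \<partial>lborel)"
      using nn_integral_gauss_scale[of h "sqrt (a\<^sup>2 + b\<^sup>2)" 0] 3 by simp
    finally show ?thesis .
  qed
qed

text \<open>
  This expresses the rotation invariance of the Gaussian measure: the scalar product with \<open>v\<close> is
  distributed like \<open>\<bar>v\<bar>\<close> times one coordinate. The coordinates are added one at a
  time, by \<open>nn_integral_gauss_two\<close>.
\<close>

lemma nn_integral_gauss_projection:
  fixes v :: "'i \<Rightarrow> real"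
  assumes "finite I" and [measurable]: "h \<in> borel_measurable borel"
  shows "(\<integral>\<^sup>+z. h (\<Sum>i\<in>I. v i * z i) * (\<Prod>i\<in>I. ennreal (gauss (z i))) \<partial>Pi\<^sub>M I (\<lambda>_. lborel))
     = (\<integral>\<^sup>+t. h (L2_set v I * t) * ennreal (gauss t) \<partial>lborel)"
  using assms
proof (induction I arbitrary: h rule: finite_induct)
  case empty
  interpret product_sigma_finite "\<lambda>_. lborel :: real measure" ..
  show ?case
    using empty by (simp add: PiM_empty nn_integral_count_space_finite nn_integral_cmult nn_integral_gauss)
next
  case (insert j I)
  note [measurable] = insert.prems
  interpret product_sigma_finite "\<lambda>_. lborel :: real measure" ..
  interpret P: finite_product_sigma_finite "\<lambda>_. lborel :: real measure" I by standard (fact insert)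
  interpret pair_sigma_finite lborel "Pi\<^sub>M I (\<lambda>_. lborel :: real measure)" 
    using P.sigma_finite_measure_axioms lborel.sigma_finite_measure_axioms by (auto simp: pair_sigma_finite_def)
  have eq: "(\<Sum>i\<in>insert j I. v i * (z(j := y)) i) = (\<Sum>i\<in>I. v i * z i) + v j * y"
     "(\<Prod>i\<in>insert j I. ennreal (gauss ((z(j := y)) i))) = (\<Prod>i\<in>I. ennreal (gauss (z i))) * ennreal (gauss y)" for z y
  proof -
    have *: "\<And>i. i \<in> I \<Longrightarrow> (z(j := y)) i = z i" using insert by auto
    show "(\<Sum>i\<in>insert j I. v i * (z(j := y)) i) = (\<Sum>i\<in>I. v i * z i) + v j * y"
      using insert * by (simp cong: sum.cong)
    show "(\<Prod>i\<in>insert j I. ennreal (gauss ((z(j := y)) i))) = (\<Prod>i\<in>I. ennreal (gauss (z i))) * ennreal (gauss y)"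
      using insert * by (simp add: mult.commute cong: prod.cong)
  qed
  have "(\<integral>\<^sup>+z. h (\<Sum>i\<in>insert j I. v i * z i) * (\<Prod>i\<in>insert j I. ennreal (gauss (z i))) \<partial>Pi\<^sub>M (insert j I) (\<lambda>_. lborel))
    = (\<integral>\<^sup>+z. \<integral>\<^sup>+y. h ((\<Sum>i\<in>I. v i * z i) + v j * y) * ((\<Prod>i\<in>I. ennreal (gauss (z i))) * ennreal (gauss y)) \<partial>lborel \<partial>Pi\<^sub>M I (\<lambda>_. lborel))"
    by (subst product_nn_integral_insert[OF insert.hyps(1,2)]; (simp only: eq | measurable))
  also have "\<dots> = (\<integral>\<^sup>+y. \<integral>\<^sup>+z. h ((\<Sum>i\<in>I. v i * z i) + v j * y) * ((\<Prod>i\<in>I. ennreal (gauss (z i))) * ennreal (gauss y)) \<partial>Pi\<^sub>M I (\<lambda>_. lborel) \<partial>lborel)"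
    by (rule Fubini') measurable
  also have "\<dots> = (\<integral>\<^sup>+y. (\<integral>\<^sup>+z. h ((\<Sum>i\<in>I. v i * z i) + v j * y) * (\<Prod>i\<in>I. ennreal (gauss (z i))) \<partial>Pi\<^sub>M I (\<lambda>_. lborel)) * ennreal (gauss y) \<partial>lborel)"
    by (intro nn_integral_cong) (subst nn_integral_multc[symmetric], auto simp: mult.assoc)
  also have "\<dots> = (\<integral>\<^sup>+y. (\<integral>\<^sup>+t. h (L2_set v I * t + v j * y) * ennreal (gauss t) \<partial>lborel) * ennreal (gauss y) \<partial>lborel)"
    by (intro nn_integral_cong arg_cong2[of _ _ _ _ "(*)"] insert.IH[of "\<lambda>x. h (x + v j * _)"]) auto
  also have "\<dots> = (\<integral>\<^sup>+t. h (sqrt ((L2_set v I)\<^sup>2 + (v j)\<^sup>2) * t) * ennreal (gauss t) \<partial>lborel)"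
    by (rule nn_integral_gauss_two) simp
  also have "sqrt ((L2_set v I)\<^sup>2 + (v j)\<^sup>2) = L2_set v (insert j I)"
    using insert by (simp add: L2_set_def sum_nonneg add.commute)
  finally show ?case .
qed

lemma nn_integral_gauss_abs_powr:
  assumes p: "0 \<le> p"
  shows "(\<integral>\<^sup>+t. ennreal (\<bar>t\<bar> powr p) * ennreal (gauss t) \<partial>lborel) = ennreal (Gamma ((p + 1) / 2) / sqrt pi)"
proof -
  let ?h = "\<lambda>t. ennreal (t powr p * exp (- t\<^sup>2)) * indicator {0<..} t"
  have h: "(\<integral>\<^sup>+t. ?h t \<partial>lborel) = ennreal (Gamma ((p + 1) / 2) / 2)"
    using nn_Gamma_square_substitution[of "\<lambda>t. t" "\<lambda>_. 1" "p + 1"] p by (simp add: bij_betw_def)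
  have G: "Gamma ((p + 1) / 2) \<ge> 0" using p by (intro Gamma_real_nonneg) auto
  have "(\<integral>\<^sup>+t. ennreal (\<bar>t\<bar> powr p) * ennreal (gauss t) \<partial>lborel) = 
    (\<integral>\<^sup>+t. ennreal (1 / sqrt pi) * (?h t + ?h (0 + (- 1) * t)) \<partial>lborel)"
  proof (rule nn_integral_cong_AE)
    show "AE t in lborel. ennreal (\<bar>t\<bar> powr p) * ennreal (gauss t) = ennreal (1 / sqrt pi) * (?h t + ?h (0 + (- 1) * t))"
      using AE_lborel_singleton[of 0]
    proof eventually_elim
      case (elim t)
      have "ennreal (\<bar>t\<bar> powr p) * ennreal (gauss t) = ennreal (1 / sqrt pi) * ennreal (\<bar>t\<bar> powr p * exp (- t\<^sup>2))"
        by (subst (1 2) ennreal_mult[symmetric]) (auto simp: gauss_def)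
      also have "ennreal (\<bar>t\<bar> powr p * exp (- t\<^sup>2)) = ?h t + ?h (0 + (- 1) * t)"
        using elim by (cases "t > 0") auto
      finally show ?case .
    qed
  qed
  also have "\<dots> = ennreal (1 / sqrt pi) * ((\<integral>\<^sup>+t. ?h t \<partial>lborel) + (\<integral>\<^sup>+t. ?h (0 + (- 1) * t) \<partial>lborel))"
    by (subst nn_integral_cmult, measurable, subst nn_integral_add, measurable)
  also have "(\<integral>\<^sup>+t. ?h (0 + (- 1) * t) \<partial>lborel) = (\<integral>\<^sup>+t. ?h t \<partial>lborel)"
    by (subst (2) nn_integral_real_affine[where c="-1" and t=0]) auto
  also have "ennreal (1 / sqrt pi) * ((\<integral>\<^sup>+t. ?h t \<partial>lborel) + (\<integral>\<^sup>+t. ?h t \<partial>lborel)) = ennreal (1 / sqrt pi * (Gamma ((p + 1) / 2) / 2 + Gamma ((p + 1) / 2) / 2))"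
    unfolding h using G by (subst ennreal_plus[symmetric], simp, simp, subst ennreal_mult[symmetric]) auto
  also have "1 / sqrt pi * (Gamma ((p + 1) / 2) / 2 + Gamma ((p + 1) / 2) / 2) = Gamma ((p + 1) / 2) / sqrt pi" by simp
  finally show ?thesis .
qed

definition gweight :: "nat \<Rightarrow> (nat \<Rightarrow> real) \<Rightarrow> real" where
  "gweight N z = exp (- (L2_set z {..<N})\<^sup>2)"

lemma gweight_pos: "0 < gweight N z" by (simp add: gweight_def)

lemma measurable_gweight [measurable]: "gweight N \<in> borel_measurable (LN N)"
  unfolding gweight_def[abs_def] by measurable

lemma gweight_eq: "ennreal (gweight N z) = ennreal (sqrt pi ^ N) * (\<Prod>i<N. ennreal (gauss (z i)))"
proof -
  have "gweight N z = (\<Prod>i<N. exp (- (z i)\<^sup>2))"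
    by (simp add: gweight_def L2_set_def sum_nonneg exp_sum[symmetric] sum_negf)
  also have "\<dots> = sqrt pi ^ N * (\<Prod>i<N. gauss (z i))"
    by (simp add: gauss_def prod_dividef)
  finally show ?thesis
    by (simp add: ennreal_mult' prod_ennreal gauss_nonneg)
qed

lemma nn_integral_gweight_projection:
  assumes p: "0 \<le> p" and N: "N \<ge> 1"
  shows "(\<integral>\<^sup>+z. ennreal (\<bar>\<Sum>i<N. v i * z i\<bar> powr p * gweight N z) \<partial>LN N) =
     ennreal (L2_set v {..<N} powr p * (Gamma ((p + 1) / 2) * sqrt pi ^ (N - 1)))"
proof -
  let ?h = "\<lambda>x::real. ennreal (\<bar>x\<bar> powr p)" and ?r = "L2_set v {..<N}"
  have "(\<integral>\<^sup>+z. ennreal (\<bar>\<Sum>i<N. v i * z i\<bar> powr p * gweight N z) \<partial>LN N) = 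
     (\<integral>\<^sup>+z. ennreal (sqrt pi ^ N) * (?h (\<Sum>i<N. v i * z i) * (\<Prod>i<N. ennreal (gauss (z i)))) \<partial>LN N)"
    by (intro nn_integral_cong) (simp add: ennreal_mult' gweight_eq mult.left_commute)
  also have "\<dots> = ennreal (sqrt pi ^ N) * (\<integral>\<^sup>+z. (?h (\<Sum>i<N. v i * z i) * (\<Prod>i<N. ennreal (gauss (z i)))) \<partial>LN N)"
    by (intro nn_integral_cmult) measurable
  also have "(\<integral>\<^sup>+z. (?h (\<Sum>i<N. v i * z i) * (\<Prod>i<N. ennreal (gauss (z i)))) \<partial>LN N) = 
     (\<integral>\<^sup>+t. ?h (?r * t) * ennreal (gauss t) \<partial>lborel)"
    by (rule nn_integral_gauss_projection) auto
  also have "\<dots> = (\<integral>\<^sup>+t. ennreal (?r powr p) * (ennreal (\<bar>t\<bar> powr p) * ennreal (gauss t)) \<partial>lborel)"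
    by (intro nn_integral_cong) (simp add: abs_mult powr_mult ennreal_mult' mult.assoc)
  also have "\<dots> = ennreal (?r powr p) * ennreal (Gamma ((p + 1) / 2) / sqrt pi)"
    by (subst nn_integral_cmult) (auto simp: nn_integral_gauss_abs_powr[OF p])
  also have "ennreal (sqrt pi ^ N) * \<dots> = ennreal (sqrt pi ^ N * (?r powr p * (Gamma ((p + 1) / 2) / sqrt pi)))"
    by (subst ennreal_mult'[symmetric], simp, subst ennreal_mult'[symmetric], simp, rule refl)
  also have "sqrt pi ^ N * (?r powr p * (Gamma ((p + 1) / 2) / sqrt pi)) = ?r powr p * (Gamma ((p + 1) / 2) * sqrt pi ^ (N - 1))"
    using N by (cases N) auto
  finally show ?thesis .
qed

section \<open>Chords of a bounded convex domain\<close>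

lemma along_shift: "along N (along N x t z) s z = along N x (t + s) z"
  by (auto simp: along_def algebra_simps)

lemma along_0: "x \<in> space (LN N) \<Longrightarrow> along N x 0 z = x"
  by (intro LN_ext[of _ N]) (auto simp: space_LN)

lemma edist_along: "edist N (along N x s z) (along N x t z) = \<bar>s - t\<bar> * L2_set z {..<N}"
proof -
  have "L2_set (\<lambda>i. along N x s z i - along N x t z i) {..<N} = L2_set (\<lambda>i. \<bar>s - t\<bar> * z i) {..<N}"
    unfolding L2_set_def by (intro arg_cong[of _ _ sqrt] sum.cong) (auto simp: power2_eq_square algebra_simps)
  then show ?thesis unfolding edist_def by (simp add: L2_set_right_distrib)
qed

lemma edist_commute: "edist N x y = edist N y x"
  unfolding edist_def L2_set_def by (intro arg_cong[of _ _ sqrt] sum.cong) (auto simp: power2_commute)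

lemma edist_le_L2: "edist N x y \<le> L2_set x {..<N} + L2_set y {..<N}"
proof -
  have "L2_set (\<lambda>i. x i + - y i) {..<N} \<le> L2_set x {..<N} + L2_set (\<lambda>i. - y i) {..<N}"
    by (rule L2_set_triangle_ineq)
  then show ?thesis by (simp add: edist_def L2_set_def)
qed

lemma abs_component_le_L2:
  fixes x :: "nat \<Rightarrow> real"
  assumes "i < N"
  shows "\<bar>x i\<bar> \<le> L2_set x {..<N}"
proof -
  have "\<bar>x i\<bar> \<le> L2_set (\<lambda>i. \<bar>x i\<bar>) {..<N}" using assms by (intro member_le_L2_set) auto
  then show ?thesis by (simp add: L2_set_def)
qed

lemma continuous_map_along: "continuous_map euclideanreal (RN N) (\<lambda>t. along N x t z)"
  unfolding continuous_map_componentwise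
proof (intro conjI ballI)
  show "(\<lambda>t. along N x t z) ` topspace euclideanreal \<subseteq> extensional {..<N}"
    by (auto simp: along_def)
  fix i assume i: "i \<in> {..<N}"
  have "continuous_on UNIV (\<lambda>t. x i + t * z i)" by (intro continuous_intros)
  then show "continuous_map euclideanreal euclideanreal (\<lambda>t. along N x t z i)"
    using i by simp
qed

lemma continuous_map_edist: "continuous_map (RN N) euclideanreal (\<lambda>y. edist N x y)"
proof -
  have "continuous_map (RN N) euclideanreal (\<lambda>y. sqrt (\<Sum>i<N. (x i - y i)\<^sup>2))"
    by (intro continuous_map_sqrt continuous_map_sum continuous_map_real_pow continuous_map_diff continuous_map_component) auto
  then show ?thesis by (simp add: edist_def L2_set_def)
qed

lemma real_interval_open:
  fixes S :: "real set"
  assumes "open S" "convex S" "bounded S" "S \<noteq> {}"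
  shows "\<exists>l u. l < u \<and> S = {l<..<u}"
proof -
  have bd: "bdd_below S" "bdd_above S" using assms(3) by (auto simp: bounded_imp_bdd_below bounded_imp_bdd_above)
  have ne: "Inf S \<notin> S" "Sup S \<notin> S"
  proof -
    obtain a b where "\<forall>x\<in>S. a \<le> x" "\<forall>x\<in>S. x \<le> b" using bd by (auto simp: bdd_below_def bdd_above_def)
    then have "\<forall>x\<in>S. a - 1 < x" "\<forall>x\<in>S. x < b + 1" by force+
    then show "Inf S \<notin> S" "Sup S \<notin> S" using Inf_notin_open[OF assms(1)] Sup_notin_open[OF assms(1)] by blast+
  qed
  have "S \<subseteq> {Inf S<..<Sup S}"
  proof
    fix x assume x: "x \<in> S"
    then have "Inf S \<le> x" "x \<le> Sup S" using bd by (auto intro: cInf_lower cSup_upper)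
    then show "x \<in> {Inf S<..<Sup S}" using x ne by (auto simp: less_le)
  qed
  moreover have "{Inf S<..<Sup S} \<subseteq> S"
  proof
    fix x assume x: "x \<in> {Inf S<..<Sup S}"
    then obtain a b where "a \<in> S" "a < x" "b \<in> S" "x < b"
      using cInf_less_iff[of S x] less_cSup_iff[of S x] assms bd by auto
    then show "x \<in> S" using assms(2) by (meson convex_contains_segment is_interval_1 is_interval_convex_1 less_imp_le)
  qed
  ultimately have "S = {Inf S<..<Sup S}" by blast
  moreover from this have "Inf S < Sup S" using assms(4) by (metis greaterThanLessThan_empty_iff2 linorder_not_less)
  ultimately show ?thesis by blast
qed

locale convex_domain =
  fixes N :: nat and \<Omega> :: "(nat \<Rightarrow> real) set"
  assumes N: "N \<ge> 1" and domain: "bounded_convex_domain N \<Omega>"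
begin

lemma openin_domain: "openin (RN N) \<Omega>" and domain_nonempty: "\<Omega> \<noteq> {}"
  using domain by (auto simp: bounded_convex_domain_def)

lemma sets_domain [measurable]: "\<Omega> \<in> sets (LN N)"
  by (rule sets_LN_openin[OF openin_domain])

lemma domain_space: "x \<in> \<Omega> \<Longrightarrow> x \<in> space (LN N)"
  using openin_subset[OF openin_domain] by (auto simp: space_LN topspace_RN)

lemma domain_bound: "\<exists>B. \<forall>x\<in>\<Omega>. L2_set x {..<N} \<le> B"
  using domain by (simp add: bounded_convex_domain_def)

lemma domain_convex:
  "x \<in> \<Omega> \<Longrightarrow> y \<in> \<Omega> \<Longrightarrow> 0 \<le> t \<Longrightarrow> t \<le> 1 \<Longrightarrow> (\<lambda>i\<in>{..<N}. (1 - t) * x i + t * y i) \<in> \<Omega>"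
  using domain by (simp add: bounded_convex_domain_def)

lemma edist_le_ediam:
  assumes "x \<in> \<Omega>" "y \<in> \<Omega>"
  shows "edist N x y \<le> ediam N \<Omega>"
proof -
  obtain B where B: "\<And>x. x \<in> \<Omega> \<Longrightarrow> L2_set x {..<N} \<le> B" using domain_bound by blast
  have "bdd_above ((\<lambda>(x, y). edist N x y) ` (\<Omega> \<times> \<Omega>))"
  proof (rule bdd_aboveI2[of _ _ "B + B"])
    fix w assume "w \<in> \<Omega> \<times> \<Omega>"
    then show "(case w of (x, y) \<Rightarrow> edist N x y) \<le> B + B"
      using edist_le_L2[of N "fst w" "snd w"] B[of "fst w"] B[of "snd w"] by (auto simp: case_prod_beta)
  qed
  then show ?thesis unfolding ediam_def
    using cSUP_upper[of "(x, y)" "\<Omega> \<times> \<Omega>" "\<lambda>(x, y). edist N x y"] assms by auto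
qed

definition chord :: "(nat \<Rightarrow> real) \<Rightarrow> (nat \<Rightarrow> real) \<Rightarrow> real set" where
  "chord x z = {t. along N x t z \<in> \<Omega>}"

lemma open_chord: "open (chord x z)"
  using openin_continuous_map_preimage[OF continuous_map_along openin_domain, of x z]
  by (simp add: chord_def)

lemma convex_chord: "convex (chord x z)"
proof -
  have "(1 - r) * s + r * t \<in> chord x z" if "s \<in> chord x z" "t \<in> chord x z" "0 \<le> r" "r \<le> 1" for s t r
  proof -
    have "(\<lambda>i\<in>{..<N}. (1 - r) * along N x s z i + r * along N x t z i) \<in> \<Omega>"
      using that by (intro domain_convex) (auto simp: chord_def)
    also have "(\<lambda>i\<in>{..<N}. (1 - r) * along N x s z i + r * along N x t z i) = along N x ((1 - r) * s + r * t) z"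
      by (auto simp: along_def algebra_simps)
    finally show ?thesis by (simp add: chord_def)
  qed
  then show ?thesis by (simp add: convex_alt)
qed

lemma chord_diam: "s \<in> chord x z \<Longrightarrow> t \<in> chord x z \<Longrightarrow> \<bar>s - t\<bar> * L2_set z {..<N} \<le> ediam N \<Omega>"
  using edist_le_ediam[of "along N x s z" "along N x t z"] by (simp add: chord_def edist_along)

lemma chord_interval:
  assumes z: "0 < L2_set z {..<N}" and ne: "chord x z \<noteq> {}"
  obtains l u where "l < u" "chord x z = {l<..<u}" "(u - l) * L2_set z {..<N} \<le> ediam N \<Omega>"
    "along N x l z \<in> RN N frontier_of \<Omega>" "along N x u z \<in> RN N frontier_of \<Omega>"
proof -
  let ?r = "L2_set z {..<N}"
  obtain t0 where t0: "t0 \<in> chord x z" using ne by auto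
  have "bounded (chord x z)"
  proof (rule boundedI)
    fix t assume "t \<in> chord x z"
    then have "\<bar>t - t0\<bar> \<le> ediam N \<Omega> / ?r" using chord_diam[OF _ t0, of t] z by (simp add: pos_le_divide_eq)
    then show "norm t \<le> ediam N \<Omega> / ?r + \<bar>t0\<bar>" by auto
  qed
  then obtain l u where lu: "l < u" "chord x z = {l<..<u}"
    using real_interval_open[OF open_chord convex_chord _ ne] by blast
  have "(u - l) * ?r \<le> ediam N \<Omega>"
  proof (rule ccontr)
    assume "\<not> (u - l) * ?r \<le> ediam N \<Omega>"
    then have "ediam N \<Omega> / ?r < u - l" using z by (simp add: pos_divide_less_eq)
    then obtain c where c: "ediam N \<Omega> / ?r < c" "c < u - l" using dense by blast
    \<comment> \<open>The end points are not in \<open>\<Omega>\<close>, so the diameter is compared with points at distance \<open>e\<close> from them.\<close>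
    define e where "e = (u - l - max c 0) / 2"
    have e: "0 < e" "l + e \<in> chord x z" "u - e \<in> chord x z" unfolding e_def lu(2) using c lu(1) by (auto simp: max_def field_simps)
    have "\<bar>(u - e) - (l + e)\<bar> * ?r \<le> ediam N \<Omega>" using e chord_diam by blast
    then have "\<bar>(u - e) - (l + e)\<bar> \<le> ediam N \<Omega> / ?r" using z by (simp add: pos_le_divide_eq)
    moreover have "(u - e) - (l + e) = max c 0" by (simp add: e_def field_simps)
    ultimately show False using c by auto
  qed
  moreover have "along N x t z \<in> RN N frontier_of \<Omega>" if t: "t = l \<or> t = u" for t
  proof -
    have "(\<lambda>t. along N x t z) ` (euclideanreal closure_of {l<..<u}) \<subseteq> RN N closure_of ((\<lambda>t. along N x t z) ` {l<..<u})"
      by (rule continuous_map_image_closure_subset[OF continuous_map_along])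
    moreover have "t \<in> euclideanreal closure_of {l<..<u}" using t lu(1) by auto
    moreover have "(\<lambda>t. along N x t z) ` {l<..<u} \<subseteq> \<Omega>" using lu(2) by (auto simp: chord_def)
    then have "RN N closure_of ((\<lambda>t. along N x t z) ` {l<..<u}) \<subseteq> RN N closure_of \<Omega>" by (rule closure_of_mono)
    ultimately have "along N x t z \<in> RN N closure_of \<Omega>" by blast
    moreover have "t \<notin> chord x z" using t lu by auto
    then have "along N x t z \<notin> \<Omega>" by (simp add: chord_def)
    ultimately show ?thesis using interior_of_openin[OF openin_domain] by (simp add: frontier_of_def)
  qed
  ultimately show thesis using that lu by blast
qed

lemma frontier_not_domain: "y \<in> RN N frontier_of \<Omega> \<Longrightarrow> y \<notin> \<Omega>"
  using interior_of_openin[OF openin_domain] by (auto simp: frontier_of_def)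

lemma frontier_space: "y \<in> RN N frontier_of \<Omega> \<Longrightarrow> y \<in> space (LN N)"
  using frontier_of_subset_topspace[of "RN N" \<Omega>] by (auto simp: space_LN topspace_RN)

lemma zero_in_chord: "x \<in> \<Omega> \<Longrightarrow> 0 \<in> chord x z"
  by (simp add: chord_def along_0 domain_space)

lemma chord_through:
  assumes x: "x \<in> \<Omega>" and z: "0 < L2_set z {..<N}"
  obtains l u where "l < 0" "0 < u" "chord x z = {l<..<u}" "(u - l) * L2_set z {..<N} \<le> ediam N \<Omega>"
    "along N x l z \<in> RN N frontier_of \<Omega>" "along N x u z \<in> RN N frontier_of \<Omega>"
  using chord_interval[OF z, of x] zero_in_chord[OF x, of z] by (metis empty_iff greaterThanLessThan_iff)

lemma direction_exists: "0 < L2_set (\<lambda>i. 1) {..<N}"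
  using N by (simp add: L2_set_def)

lemma frontier_nonempty: "RN N frontier_of \<Omega> \<noteq> {}"
  using domain_nonempty chord_through[OF _ direction_exists] by (metis all_not_in_conv)

lemma ediam_pos: "0 < ediam N \<Omega>"
proof -
  obtain x where x: "x \<in> \<Omega>" using domain_nonempty by auto
  obtain l u where "l < 0" "0 < u" "(u - l) * L2_set (\<lambda>i. 1) {..<N} \<le> ediam N \<Omega>"
    using chord_through[OF x direction_exists] by metis
  then have "0 < (u - l) * L2_set (\<lambda>i. 1) {..<N}" using direction_exists by (intro mult_pos_pos) auto
  with \<open>(u - l) * L2_set (\<lambda>i. 1) {..<N} \<le> ediam N \<Omega>\<close> show ?thesis by linarith
qed

lemma bdry_dist_le: "y \<in> RN N frontier_of \<Omega> \<Longrightarrow> bdry_dist N \<Omega> x \<le> edist N x y"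
  unfolding bdry_dist_def by (rule cINF_lower) (auto intro!: bdd_belowI[of _ 0])

lemma compactin_frontier: "compactin (RN N) (RN N frontier_of \<Omega>)"
proof -
  obtain B where B: "\<And>x. x \<in> \<Omega> \<Longrightarrow> L2_set x {..<N} \<le> B" using domain_bound by blast
  have "closedin (RN N) {x \<in> topspace (RN N). L2_set x {..<N} \<in> {..B}}"
    by (intro closedin_continuous_map_preimage[OF continuous_map_L2_set]) auto
  moreover have "\<Omega> \<subseteq> {x \<in> topspace (RN N). L2_set x {..<N} \<in> {..B}}"
    using B openin_subset[OF openin_domain] by auto
  ultimately have cl: "RN N closure_of \<Omega> \<subseteq> {x \<in> topspace (RN N). L2_set x {..<N} \<in> {..B}}"
    by (rule closure_of_minimal[rotated])
  have "RN N frontier_of \<Omega> \<subseteq> Pi\<^sub>E {..<N} (\<lambda>i. {-B..B})"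
  proof
    fix x assume "x \<in> RN N frontier_of \<Omega>"
    then have x: "x \<in> topspace (RN N)" "L2_set x {..<N} \<le> B" using cl by (auto simp: frontier_of_def)
    have "\<bar>x i\<bar> \<le> B" if "i < N" for i
      using abs_component_le_L2[OF that, of x] x by simp
    then show "x \<in> Pi\<^sub>E {..<N} (\<lambda>i. {-B..B})"
      using x by (auto simp: topspace_RN PiE_def Pi_iff abs_le_iff minus_le_iff)
  qed
  moreover have "compactin (RN N) (Pi\<^sub>E {..<N} (\<lambda>i. {-B..B}))"
    by (simp add: compactin_PiE)
  ultimately show ?thesis using closed_compactin closedin_frontier_of by blast
qed

lemma nearest_frontier_point:
  obtains y where "y \<in> RN N frontier_of \<Omega>" "bdry_dist N \<Omega> x = edist N x y"
proof -
  have "compact (edist N x ` (RN N frontier_of \<Omega>))"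
    using image_compactin[OF compactin_frontier continuous_map_edist[of N x]] by simp
  then obtain y where y: "y \<in> RN N frontier_of \<Omega>" "\<And>w. w \<in> RN N frontier_of \<Omega> \<Longrightarrow> edist N x y \<le> edist N x w"
    using compact_attains_inf[of "edist N x ` (RN N frontier_of \<Omega>)"] frontier_nonempty by auto
  have "bdry_dist N \<Omega> x = edist N x y"
    by (rule antisym[OF bdry_dist_le[OF y(1)]]) (auto simp: bdry_dist_def intro!: cINF_greatest frontier_nonempty y(2))
  with y that show ?thesis by blast
qed

lemma bdry_dist_pos:
  assumes x: "x \<in> \<Omega>" shows "0 < bdry_dist N \<Omega> x"
proof -
  obtain y where y: "y \<in> RN N frontier_of \<Omega>" "bdry_dist N \<Omega> x = edist N x y" using nearest_frontier_point .
  have "x \<noteq> y" using frontier_not_domain[OF y(1)] x by auto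
  then show ?thesis unfolding y(2) by (rule edist_pos[OF domain_space[OF x] frontier_space[OF y(1)]])
qed

lemma ball_subset_domain:
  assumes x: "x \<in> \<Omega>" and q: "q \<in> space (LN N)" "edist N x q < bdry_dist N \<Omega> x"
  shows "q \<in> \<Omega>"
proof (rule ccontr)
  assume nq: "q \<notin> \<Omega>"
  define z where "z = (\<lambda>i. q i - x i)"
  have q1: "along N x 1 z = q" 
    using q domain_space[OF x] by (intro LN_ext[of _ N]) (auto simp: z_def space_LN)
  have r: "edist N x q = L2_set z {..<N}" unfolding edist_commute[of N x q] by (simp add: edist_def z_def)
  have "q \<noteq> x" using nq x by auto
  then have z: "0 < L2_set z {..<N}" 
    unfolding r[symmetric] using q domain_space[OF x] by (intro edist_pos) auto
  obtain l u where lu: "l < 0" "0 < u" "chord x z = {l<..<u}" "along N x u z \<in> RN N frontier_of \<Omega>"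
    using chord_through[OF x z] by metis
  have "1 \<notin> chord x z" using nq q1 by (simp add: chord_def)
  then have "u \<le> 1" using lu by auto
  have "bdry_dist N \<Omega> x \<le> edist N x (along N x u z)" by (rule bdry_dist_le[OF lu(4)])
  also have "\<dots> = edist N (along N x 0 z) (along N x u z)" by (simp add: along_0 domain_space[OF x])
  also have "\<dots> \<le> 1 * L2_set z {..<N}"
    unfolding edist_along using lu \<open>u \<le> 1\<close> by (intro mult_right_mono) auto
  finally show False using q r by simp
qed

text \<open>
  If \<open>w\<close> were strictly beyond the hyperplane, then for small \<open>e > 0\<close> the point \<open>y - e (w - y)\<close> would be
  closer to \<open>x\<close> than \<open>y\<close> is, hence in \<open>\<Omega>\<close>. But \<open>y\<close> is on the segment from this point to \<open>w\<close>, and so it would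
  be in \<open>\<Omega>\<close> as well.
\<close>

lemma supporting_hyperplane:
  assumes x: "x \<in> \<Omega>" and y: "y \<in> RN N frontier_of \<Omega>" "bdry_dist N \<Omega> x = edist N x y" and w: "w \<in> \<Omega>"
  shows "(\<Sum>i<N. (y i - x i) * (w i - y i)) \<le> 0"
proof (rule ccontr)
  assume "\<not> ?thesis"
  then have c: "0 < (\<Sum>i<N. (y i - x i) * (w i - y i))" (is "0 < ?c") by simp
  define M where "M = (\<Sum>i<N. (w i - y i)\<^sup>2)"
  have M: "0 \<le> M" by (simp add: M_def sum_nonneg)
  define e where "e = ?c / (M + 1)"
  have e: "0 < e" "e * (M + 1) = ?c" using c M by (auto simp: e_def)
  define q where "q = (\<lambda>i\<in>{..<N}. y i - e * (w i - y i))"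
  have "(\<Sum>i<N. (x i - q i)\<^sup>2) = (\<Sum>i<N. (x i - y i)\<^sup>2 - 2 * e * ((y i - x i) * (w i - y i)) + e\<^sup>2 * (w i - y i)\<^sup>2)"
    by (intro sum.cong) (auto simp: q_def power2_eq_square algebra_simps)
  also have "\<dots> = (\<Sum>i<N. (x i - y i)\<^sup>2) - 2 * e * ?c + e\<^sup>2 * M"
    by (simp add: sum.distrib sum_subtractf sum_distrib_left M_def)
  also have "e\<^sup>2 * M - 2 * e * ?c < 0"
  proof -
    have "e * M < 2 * ?c" using e c by (simp add: algebra_simps)
    then have "e * (e * M) < e * (2 * ?c)" using e by (intro mult_strict_left_mono) auto
    then show ?thesis by (simp add: power2_eq_square algebra_simps)
  qed
  then have "(\<Sum>i<N. (x i - y i)\<^sup>2) - 2 * e * ?c + e\<^sup>2 * M < (\<Sum>i<N. (x i - y i)\<^sup>2)" by linarith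
  finally have "edist N x q < bdry_dist N \<Omega> x" unfolding y(2) edist_def L2_set_def by simp
  then have "q \<in> \<Omega>" by (intro ball_subset_domain[OF x]) (auto simp: q_def space_LN)
  then have "(\<lambda>i\<in>{..<N}. (1 - e / (1 + e)) * q i + e / (1 + e) * w i) \<in> \<Omega>"
    using w e by (intro domain_convex) auto
  also have "(\<lambda>i\<in>{..<N}. (1 - e / (1 + e)) * q i + e / (1 + e) * w i) = y"
  proof (rule LN_ext[of _ N])
    fix i assume i: "i < N"
    have "1 - e / (1 + e) = 1 / (1 + e)" using e by (simp add: field_simps)
    then have "(1 - e / (1 + e)) * q i + e / (1 + e) * w i = (q i + e * w i) / (1 + e)" 
      by (simp add: add_divide_distrib)
    also have "q i + e * w i = (1 + e) * y i" using i by (simp add: q_def algebra_simps)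
    finally show "(\<lambda>i\<in>{..<N}. (1 - e / (1 + e)) * q i + e / (1 + e) * w i) i = y i" using i e by simp
  qed (use frontier_space[OF y(1)] in \<open>auto simp: space_LN\<close>)
  finally show False using frontier_not_domain[OF y(1)] by simp
qed

lemma chord_hyperplane:
  assumes x: "x \<in> \<Omega>" and y: "y \<in> RN N frontier_of \<Omega>" "bdry_dist N \<Omega> x = edist N x y"
    and t: "t \<in> chord x z"
  shows "t * (\<Sum>i<N. (y i - x i) * z i) \<le> (bdry_dist N \<Omega> x)\<^sup>2"
proof -
  have "(\<Sum>i<N. (y i - x i) * (along N x t z i - y i)) \<le> 0"
    using supporting_hyperplane[OF x y, of "along N x t z"] t by (simp add: chord_def)
  also have "(\<Sum>i<N. (y i - x i) * (along N x t z i - y i)) = 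
     (\<Sum>i<N. t * ((y i - x i) * z i) - (x i - y i)\<^sup>2)"
    by (intro sum.cong) (auto simp: power2_eq_square algebra_simps)
  also have "\<dots> = t * (\<Sum>i<N. (y i - x i) * z i) - (bdry_dist N \<Omega> x)\<^sup>2"
    by (simp add: sum_subtractf sum_distrib_left y(2) edist_def L2_set_def sum_nonneg)
  finally show ?thesis by simp
qed

end

section \<open>Averages over all directions\<close>

lemma nn_integral_gweight:
  "(\<integral>\<^sup>+z. ennreal (gweight N z) \<partial>LN N) = ennreal (sqrt pi ^ N)"
proof -
  have "(\<integral>\<^sup>+z. ennreal (gweight N z) \<partial>LN N) = ennreal (sqrt pi ^ N) * (\<integral>\<^sup>+z. (\<Prod>i<N. ennreal (gauss (z i))) \<partial>LN N)"
    unfolding gweight_eq by (rule nn_integral_cmult) measurable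
  also have "(\<integral>\<^sup>+z. (\<Prod>i<N. ennreal (gauss (z i))) \<partial>LN N) = 1"
    using nn_integral_gauss_projection[of "{..<N}" "\<lambda>_. 1" "\<lambda>_. 0"] by (simp add: nn_integral_gauss)
  finally show ?thesis by simp
qed

lemma unit_ball_volume:
  assumes N: "N \<ge> 1"
  shows "emeasure (LN N) (unit_ball N) = ennreal (volume N (unit_ball N))"
    and "real N * Gamma (real N / 2) / 2 * volume N (unit_ball N) = sqrt pi ^ N"
proof -
  have "ennreal (real N * Gamma ((real N + 0) / 2) / 2) * emeasure (LN N) (unit_ball N) = 
     (\<integral>\<^sup>+z. ennreal (L2_set z {..<N} powr 0 * exp (- (L2_set z {..<N})\<^sup>2)) \<partial>LN N)"
    by (rule nn_integral_gauss_powr[OF N order_refl, symmetric])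
  also have "\<dots> = (\<integral>\<^sup>+z. ennreal (gweight N z) \<partial>LN N)"
  proof (rule nn_integral_cong_AE)
    show "AE z in LN N. ennreal (L2_set z {..<N} powr 0 * exp (- (L2_set z {..<N})\<^sup>2)) = ennreal (gweight N z)"
      using AE_LN_neq[OF N, of "\<lambda>i\<in>{..<N}. 0"] AE_space
    proof eventually_elim
      case (elim z)
      then show ?case using L2_set_pos[of z N] by (simp add: gweight_def)
    qed
  qed
  also have "\<dots> = ennreal (sqrt pi ^ N)" by (rule nn_integral_gweight)
  finally have e: "ennreal (real N * Gamma (real N / 2) / 2) * emeasure (LN N) (unit_ball N) = ennreal (sqrt pi ^ N)" by simp
  have G: "0 < real N * Gamma (real N / 2) / 2" using N by (auto intro!: Gamma_real_pos)
  have "emeasure (LN N) (unit_ball N) \<noteq> \<infinity>"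
  proof
    assume "emeasure (LN N) (unit_ball N) = \<infinity>"
    moreover have "ennreal (real N * Gamma (real N / 2) / 2) * emeasure (LN N) (unit_ball N) \<noteq> top" unfolding e by simp
    ultimately show False using G by (auto simp: ennreal_mult_eq_top_iff)
  qed
  then show em: "emeasure (LN N) (unit_ball N) = ennreal (volume N (unit_ball N))"
    using sets_LN_openin[OF openin_unit_ball, of N]
    unfolding volume_def leb_def by (simp add: emeasure_eq_ennreal_measure)
  show "real N * Gamma (real N / 2) / 2 * volume N (unit_ball N) = sqrt pi ^ N"
    using e[unfolded em] G by (simp add: ennreal_mult[symmetric] volume_def)
qed

lemma unit_ball_volume_pos: "N \<ge> 1 \<Longrightarrow> 0 < volume N (unit_ball N)"
  using unit_ball_volume(2)[of N] by (smt (verit) mult_eq_0_iff measure_nonneg pi_gt_zero real_sqrt_gt_zero volume_def zero_less_power)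

text \<open>
  The tangent at \<open>y0\<close> to a convex function of \<open>y\<close>. Integrated over \<open>y\<close> with mean \<open>y0\<close>, it is Jensen's
  inequality.
\<close>

lemma tangent_powr:
  fixes a y y0 :: real
  assumes "0 < a" "0 < y" "0 < y0"
  shows "(1 + a) * y0 powr (- a) \<le> y powr (- a) + a * y0 powr (- a - 1) * y"
proof -
  define s where "s = y / y0"
  have s: "0 < s" using assms by (simp add: s_def)
  have "(s powr (- a)) powr (1 / (1 + a)) * s powr (a / (1 + a)) \<le> 1 / (1 + a) * s powr (- a) + a / (1 + a) * s"
    using assms s by (intro Youngs_inequality_0) (auto simp: add_divide_distrib[symmetric])
  moreover have "(s powr (- a)) powr (1 / (1 + a)) * s powr (a / (1 + a)) = 1"
    using s assms by (simp add: powr_powr powr_add[symmetric])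
  ultimately have "1 \<le> (s powr (- a) + a * s) / (1 + a)" by (simp add: add_divide_distrib)
  then have "1 + a \<le> s powr (- a) + a * s" using assms by (simp add: pos_le_divide_eq)
  then have "y0 powr (- a) * (1 + a) \<le> y0 powr (- a) * (s powr (- a) + a * s)"
    by (intro mult_left_mono) auto
  also have "\<dots> = y powr (- a) + a * y0 powr (- a - 1) * y"
    using assms by (simp add: s_def powr_divide powr_diff field_simps)
  finally show ?thesis by (simp add: mult.commute)
qed

lemma power_mean_le:
  fixes u v :: real
  assumes "0 \<le> u" "0 \<le> v"
  shows "((u + v) / 2) ^ n \<le> (u ^ n + v ^ n) / 2"
proof (induction n)
  case (Suc n)
  have "0 \<le> (u ^ n - v ^ n) * (u - v)"
  proof (cases "u \<le> v")
    case True
    then have "u ^ n \<le> v ^ n" using assms by (intro power_mono) auto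
    with True show ?thesis by (intro mult_nonpos_nonpos) auto
  next
    case False
    then have "v ^ n \<le> u ^ n" using assms by (intro power_mono) auto
    with False show ?thesis by (intro mult_nonneg_nonneg) auto
  qed
  then have "(u + v) / 2 * ((u ^ n + v ^ n) / 2) \<le> (u ^ Suc n + v ^ Suc n) / 2"
    by (simp add: algebra_simps)
  moreover have "(u + v) / 2 * ((u + v) / 2) ^ n \<le> (u + v) / 2 * ((u ^ n + v ^ n) / 2)"
    using Suc assms by (intro mult_left_mono) auto
  ultimately show ?case by simp
qed simp

lemma ennreal_lincomb:
  "0 \<le> A \<Longrightarrow> 0 \<le> K \<Longrightarrow> 0 \<le> B \<Longrightarrow> 0 \<le> C \<Longrightarrow>
    ennreal (A + K * (B + C)) = ennreal A + ennreal K * (ennreal B + ennreal C)"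
  by (simp add: ennreal_mult)

context convex_domain begin

text \<open>
  For \<open>c = 1\<close> and \<open>c = - 1\<close>, the length of the ray from \<open>x\<close> in the direction of \<open>c z\<close>, measured in units of
  \<open>\<bar>z\<bar>\<close>. As an integral it is evidently measurable in \<open>x\<close> and \<open>z\<close> jointly.
\<close>

definition reach :: "real \<Rightarrow> (nat \<Rightarrow> real) \<Rightarrow> (nat \<Rightarrow> real) \<Rightarrow> real" where
  "reach c x z = enn2real (\<integral>\<^sup>+t\<in>{0<..}. indicator \<Omega> (along N x (c * t) z) \<partial>lborel)"

definition near :: "(nat \<Rightarrow> real) \<Rightarrow> (nat \<Rightarrow> real) \<Rightarrow> real" where
  "near x z = min (reach 1 x z) (reach (-1) x z)"

definition half_chord :: "(nat \<Rightarrow> real) \<Rightarrow> (nat \<Rightarrow> real) \<Rightarrow> real" where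
  "half_chord x z = (reach 1 x z + reach (-1) x z) / 2"

lemma measurable_reach [measurable]:
  assumes [measurable]: "f \<in> M \<rightarrow>\<^sub>M LN N" "g \<in> M \<rightarrow>\<^sub>M LN N"
  shows "(\<lambda>w. reach c (f w) (g w)) \<in> borel_measurable M"
  unfolding reach_def by measurable

lemma measurable_near [measurable]:
  assumes [measurable]: "f \<in> M \<rightarrow>\<^sub>M LN N" "g \<in> M \<rightarrow>\<^sub>M LN N"
  shows "(\<lambda>w. near (f w) (g w)) \<in> borel_measurable M"
  unfolding near_def by measurable

lemma measurable_half_chord [measurable]:
  assumes [measurable]: "f \<in> M \<rightarrow>\<^sub>M LN N" "g \<in> M \<rightarrow>\<^sub>M LN N"
  shows "(\<lambda>w. half_chord (f w) (g w)) \<in> borel_measurable M"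
  unfolding half_chord_def by measurable

lemma reach_chord:
  assumes "chord x z = {l<..<u}" "l < 0" "0 < u"
  shows "reach 1 x z = u" "reach (-1) x z = - l"
proof -
  have mem: "along N x t z \<in> \<Omega> \<longleftrightarrow> l < t \<and> t < u" for t
    using assms(1) by (auto simp: chord_def set_eq_iff)
  have "(\<integral>\<^sup>+t\<in>{0<..}. indicator \<Omega> (along N x (1 * t) z) \<partial>lborel) = (\<integral>\<^sup>+t. indicator {0<..<u} t \<partial>lborel)"
    using assms by (intro nn_integral_cong) (auto simp: indicator_def mem)
  then show "reach 1 x z = u" using assms by (simp add: reach_def)
  have "(\<integral>\<^sup>+t\<in>{0<..}. indicator \<Omega> (along N x (-1 * t) z) \<partial>lborel) = (\<integral>\<^sup>+t. indicator {0<..<-l} t \<partial>lborel)"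
    using assms by (intro nn_integral_cong) (auto simp: indicator_def mem)
  then show "reach (-1) x z = - l" using assms by (simp add: reach_def)
qed

lemma near_ge_bdry_dist:
  assumes x: "x \<in> \<Omega>" and z: "0 < L2_set z {..<N}"
  shows "bdry_dist N \<Omega> x \<le> near x z * L2_set z {..<N}"
proof -
  obtain l u where lu: "l < 0" "0 < u" "chord x z = {l<..<u}" 
    "along N x l z \<in> RN N frontier_of \<Omega>" "along N x u z \<in> RN N frontier_of \<Omega>"
    using chord_through[OF x z] by metis
  have e: "edist N x (along N x t z) = \<bar>t\<bar> * L2_set z {..<N}" for t
    using edist_along[of N x 0 z t] along_0[OF domain_space[OF x]] by simp
  have "bdry_dist N \<Omega> x \<le> u * L2_set z {..<N}" "bdry_dist N \<Omega> x \<le> - l * L2_set z {..<N}"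
    using bdry_dist_le[OF lu(4), of x] bdry_dist_le[OF lu(5), of x] lu(1,2) by (auto simp: e)
  then show ?thesis unfolding near_def reach_chord[OF lu(3,1,2)] by (simp add: min_def)
qed

lemma near_hyperplane:
  assumes x: "x \<in> \<Omega>" and z: "0 < L2_set z {..<N}" 
    and y: "y \<in> RN N frontier_of \<Omega>" "bdry_dist N \<Omega> x = edist N x y"
  shows "0 < near x z" "near x z * \<bar>\<Sum>i<N. (y i - x i) * z i\<bar> \<le> (bdry_dist N \<Omega> x)\<^sup>2"
proof -
  obtain l u where lu: "l < 0" "0 < u" "chord x z = {l<..<u}" 
    using chord_through[OF x z] by metis
  let ?c = "\<Sum>i<N. (y i - x i) * z i"
  have near: "near x z = min u (- l)" unfolding near_def reach_chord[OF lu(3,1,2)] ..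
  then show pos: "0 < near x z" using lu by simp
  have lim: "t * ?c \<le> (bdry_dist N \<Omega> x)\<^sup>2" if "t \<in> {l..u}" for t
  proof (rule continuous_le_on_closure[where S="{l<..<u}" and f="\<lambda>t. t * ?c"])
    show "t \<in> closure {l<..<u}" using that lu by simp
    show "continuous_on (closure {l<..<u}) (\<lambda>t. t * ?c)" by (intro continuous_intros)
    show "t * ?c \<le> (bdry_dist N \<Omega> x)\<^sup>2" if "t \<in> {l<..<u}" for t
      using chord_hyperplane[OF x y, of t z] that lu(3) by auto
  qed
  show "near x z * \<bar>?c\<bar> \<le> (bdry_dist N \<Omega> x)\<^sup>2"
  proof (cases "0 \<le> ?c")
    case True
    then have "near x z * \<bar>?c\<bar> \<le> u * ?c" unfolding near by (simp add: mult_right_mono)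
    also have "\<dots> \<le> (bdry_dist N \<Omega> x)\<^sup>2" using lu by (intro lim) auto
    finally show ?thesis .
  next
    case False
    then have "near x z * \<bar>?c\<bar> = min u (- l) * (- ?c)" unfolding near by simp
    also have "\<dots> \<le> (- l) * (- ?c)" using False by (intro mult_right_mono) auto
    also have "\<dots> = l * ?c" by simp
    also have "\<dots> \<le> (bdry_dist N \<Omega> x)\<^sup>2" using lu by (intro lim) auto
    finally show ?thesis .
  qed
qed

lemma AE_direction: "AE z in LN N. 0 < L2_set z {..<N}"
  using AE_LN_neq[OF N, of "\<lambda>i\<in>{..<N}. 0"] AE_space by eventually_elim (rule L2_set_pos)

text \<open>
  By \<open>near_hyperplane\<close> the power of \<open>near\<close> is at least that of \<open>\<bar>z \<cdot> (y - x)\<bar> / d\<^sup>2\<close>, where \<open>y\<close> is a nearest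
  boundary point. Since \<open>\<bar>y - x\<bar> = d\<close>, the Gaussian average of the latter is a constant times \<open>d\<^sup>-\<^sup>p\<close>.
\<close>

lemma average_near:
  assumes x: "x \<in> \<Omega>" and p: "0 \<le> p"
  shows "ennreal (bdry_dist N \<Omega> x powr (- p) * (Gamma ((p + 1) / 2) * sqrt pi ^ (N - 1)))
     \<le> (\<integral>\<^sup>+z. ennreal (near x z powr (- p) * gweight N z) \<partial>LN N)"
proof -
  obtain y where y: "y \<in> RN N frontier_of \<Omega>" "bdry_dist N \<Omega> x = edist N x y" using nearest_frontier_point .
  let ?d = "bdry_dist N \<Omega> x" and ?c = "\<lambda>z. \<Sum>i<N. (y i - x i) * z i"
  have d: "0 < ?d" by (rule bdry_dist_pos[OF x])
  have L2: "L2_set (\<lambda>i. y i - x i) {..<N} = ?d" unfolding y(2) by (subst edist_commute) (simp add: edist_def)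
  have "ennreal (?d powr (- p) * (Gamma ((p + 1) / 2) * sqrt pi ^ (N - 1))) = 
     ennreal (?d powr (- 2 * p)) * ennreal (?d powr p * (Gamma ((p + 1) / 2) * sqrt pi ^ (N - 1)))"
    using d by (subst ennreal_mult'[symmetric]) (simp_all add: mult.assoc[symmetric] powr_add[symmetric])
  also have "\<dots> = ennreal (?d powr (- 2 * p)) * (\<integral>\<^sup>+z. ennreal (\<bar>?c z\<bar> powr p * gweight N z) \<partial>LN N)"
    by (subst nn_integral_gweight_projection[OF p N]) (simp add: L2)
  also have "\<dots> = (\<integral>\<^sup>+z. ennreal (?d powr (- 2 * p)) * ennreal (\<bar>?c z\<bar> powr p * gweight N z) \<partial>LN N)"
    by (rule nn_integral_cmult[symmetric]) measurable
  also have "\<dots> \<le> (\<integral>\<^sup>+z. ennreal (near x z powr (- p) * gweight N z) \<partial>LN N)"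
  proof (rule nn_integral_mono_AE)
    show "AE z in LN N. ennreal (?d powr (- 2 * p)) * ennreal (\<bar>?c z\<bar> powr p * gweight N z) \<le> ennreal (near x z powr (- p) * gweight N z)"
      using AE_direction
    proof eventually_elim
      case (elim z)
      note n = near_hyperplane[OF x elim y]
      have "\<bar>?c z\<bar> / ?d\<^sup>2 \<le> 1 / near x z" using n d by (simp add: field_simps)
      then have "(\<bar>?c z\<bar> / ?d\<^sup>2) powr p \<le> (1 / near x z) powr p" using p by (intro powr_mono2) auto
      also have "(1 / near x z) powr p = near x z powr (- p)" using n by (simp add: powr_divide powr_minus_divide)
      also have "(\<bar>?c z\<bar> / ?d\<^sup>2) powr p = ?d powr (- 2 * p) * \<bar>?c z\<bar> powr p"
      proof -
        have "?d\<^sup>2 powr p = (?d powr 2) powr p" using d by simp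
        also have "\<dots> = ?d powr (2 * p)" by (rule powr_powr)
        finally show ?thesis using d by (simp add: powr_divide powr_minus_divide)
      qed
      finally have "?d powr (- 2 * p) * \<bar>?c z\<bar> powr p * gweight N z \<le> near x z powr (- p) * gweight N z"
        using gweight_pos[of N z] by (intro mult_right_mono) auto
      then have "ennreal (?d powr (- 2 * p) * (\<bar>?c z\<bar> powr p * gweight N z)) \<le> ennreal (near x z powr (- p) * gweight N z)"
        by (intro ennreal_leI) (simp add: mult.assoc)
      then show ?case by (subst ennreal_mult'[symmetric]) auto
    qed
  qed
  finally show ?thesis .
qed

lemma emeasure_domain: "emeasure (LN N) \<Omega> = ennreal (volume N \<Omega>)"
proof -
  obtain B where B: "\<And>x. x \<in> \<Omega> \<Longrightarrow> L2_set x {..<N} \<le> B" using domain_bound by blast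
  have "\<Omega> \<subseteq> Pi\<^sub>E {..<N} (\<lambda>i. {-B..B})"
  proof
    fix x assume x: "x \<in> \<Omega>"
    have "\<bar>x i\<bar> \<le> B" if "i < N" for i
      using abs_component_le_L2[OF that, of x] B[OF x] by simp
    then show "x \<in> Pi\<^sub>E {..<N} (\<lambda>i. {-B..B})"
      using domain_space[OF x] by (auto simp: space_LN PiE_def Pi_iff abs_le_iff minus_le_iff)
  qed
  then have "emeasure (LN N) \<Omega> \<le> emeasure (LN N) (Pi\<^sub>E {..<N} (\<lambda>i. {-B..B}))"
    by (intro emeasure_mono sets_PiM_I_finite) auto
  also have "\<dots> = (\<Prod>i<N. emeasure lborel {-B..B})" by (rule emeasure_LN_PiE) auto
  also have "\<dots> < \<infinity>" by (simp add: emeasure_lborel_Icc_eq power_less_top_ennreal)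
  finally have "emeasure (LN N) \<Omega> \<noteq> \<infinity>" by simp
  then show ?thesis
    unfolding volume_def leb_def by (simp add: emeasure_eq_ennreal_measure)
qed

text \<open>
  For \<open>c = 1\<close> this is \<open>nn_integral_rays\<close> for the star-shaped set \<open>\<Omega>\<close>; the case \<open>c = - 1\<close> follows by the
  reflection of \<open>z\<close>.
\<close>

lemma nn_integral_reach:
  assumes x: "x \<in> \<Omega>" and q: "0 < q" and c: "c = 1 \<or> c = -1"
  shows "(\<integral>\<^sup>+z. ennreal (L2_set z {..<N} powr q * gweight N z * reach c x z ^ N) \<partial>LN N) =
     ennreal (real N * Gamma (q / 2) / 2 * volume N \<Omega>)"
proof -
  have xs [measurable]: "x \<in> space (LN N)" by (rule domain_space[OF x])
  have [measurable]: "(\<lambda>v. along N x (g v) (f v)) \<in> M \<rightarrow>\<^sub>M LN N" 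
    if "f \<in> M \<rightarrow>\<^sub>M LN N" "g \<in> borel_measurable M" for M and f :: "'b \<Rightarrow> _" and g
    using that by (intro measurable_along measurable_const xs)
  define w where "w z = ennreal (L2_set z {..<N} powr q * gweight N z)" for z
  have [measurable]: "w \<in> borel_measurable (LN N)" unfolding w_def[abs_def] by measurable
  define I where "I c z = (\<integral>\<^sup>+s\<in>{0<..}. ennreal (s ^ (N - 1)) * indicator \<Omega> (along N x (c * s) z) \<partial>lborel)" for c z
  have [measurable]: "I c \<in> borel_measurable (LN N)" for c unfolding I_def[abs_def] by measurable
  have 1: "(\<integral>\<^sup>+z. w z * I 1 z \<partial>LN N) = ennreal (Gamma (q / 2) / 2) * emeasure (LN N) \<Omega>"
    using nn_integral_rays[OF N sets_domain xs q] by (simp add: w_def I_def gweight_def)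
  have 2: "(\<integral>\<^sup>+z. w z * I (-1) z \<partial>LN N) = ennreal (Gamma (q / 2) / 2) * emeasure (LN N) \<Omega>"
  proof -
    let ?r = "along N (\<lambda>_. 0) (-1)"
    have r: "L2_set (?r z) {..<N} = L2_set z {..<N}" for z by (simp add: L2_set_def)
    have "along N x s (?r z) = along N x (- s) z" for s z by (auto simp: along_def)
    then have "w (?r z) * I 1 (?r z) = w z * I (-1) z" for z by (simp add: w_def r gweight_def I_def)
    then show ?thesis using nn_integral_LN_affine[of "\<lambda>z. w z * I 1 z" N "-1" "\<lambda>_. 0"] 1 by simp
  qed
  have "(\<integral>\<^sup>+z. ennreal (L2_set z {..<N} powr q * gweight N z * reach c x z ^ N) \<partial>LN N) = 
    (\<integral>\<^sup>+z. ennreal (real N) * (w z * I c z) \<partial>LN N)"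
  proof (rule nn_integral_cong_AE)
    show "AE z in LN N. ennreal (L2_set z {..<N} powr q * gweight N z * reach c x z ^ N) = ennreal (real N) * (w z * I c z)"
      using AE_direction
    proof eventually_elim
      case (elim z)
      obtain l u where lu: "l < 0" "0 < u" "chord x z = {l<..<u}" using chord_through[OF x elim] by metis
      have mem: "along N x t z \<in> \<Omega> \<longleftrightarrow> l < t \<and> t < u" for t
        using lu(3) by (auto simp: chord_def set_eq_iff)
      define b where "b = reach c x z"
      have b: "0 \<le> b" using c reach_chord[OF lu(3,1,2)] lu by (auto simp: b_def)
      have "I c z = (\<integral>\<^sup>+s\<in>{0<..<b}. ennreal (s ^ (N - 1)) \<partial>lborel)"
        unfolding I_def b_def using c reach_chord[OF lu(3,1,2)] lu
        by (intro nn_integral_cong) (auto simp: indicator_def mem)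
      also have "\<dots> = ennreal (b ^ N / real N)" by (rule nn_integral_power_upto[OF N b])
      finally have I: "I c z = ennreal (b ^ N / real N)" .
      have "ennreal (real N) * (w z * I c z) = ennreal (real N * (L2_set z {..<N} powr q * gweight N z * (b ^ N / real N)))"
        unfolding I w_def
        by (subst ennreal_mult'[symmetric], simp add: less_imp_le[OF gweight_pos], subst ennreal_mult'[symmetric], simp, rule refl)
      then show ?case using N by (simp add: b_def)
    qed
  qed
  also have "\<dots> = ennreal (real N) * (\<integral>\<^sup>+z. w z * I c z \<partial>LN N)" by (rule nn_integral_cmult) measurable
  also have "(\<integral>\<^sup>+z. w z * I c z \<partial>LN N) = ennreal (Gamma (q / 2) / 2) * ennreal (volume N \<Omega>)"
    using c 1 2 by (auto simp: emeasure_domain)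
  also have "ennreal (real N) * \<dots> = ennreal (real N * (Gamma (q / 2) / 2 * volume N \<Omega>))"
    by (subst ennreal_mult'[symmetric], simp add: q, subst ennreal_mult'[symmetric], simp, rule refl)
  finally show ?thesis by (simp add: algebra_simps)
qed

text \<open>
  Jensen's inequality for \<open>y = (b \<bar>z\<bar>)\<^sup>N\<close> and the convex function with exponent \<open>- p / N\<close>, where \<open>b\<close> is half
  of the chord. The mean of \<open>y\<close> is at most \<open>y0 = \<bar>\<Omega>\<bar> / a\<^sub>N\<close>: the \<open>N\<close>-th power of the mean of the two ray
  lengths is at most the mean of their \<open>N\<close>-th powers, and these average to \<open>y0\<close> by \<open>nn_integral_reach\<close>.
\<close>

lemma average_half_chord:
  assumes x: "x \<in> \<Omega>" and p: "0 < p"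
  shows "ennreal (real N * Gamma ((real N + p) / 2) / 2 * volume N (unit_ball N) *
       (volume N (unit_ball N) / volume N \<Omega>) powr (p / real N))
     \<le> (\<integral>\<^sup>+z. ennreal (half_chord x z powr (- p) * gweight N z) \<partial>LN N)"
proof (cases "volume N \<Omega> = 0")
  case False
  have vol: "0 < volume N \<Omega>" "0 < volume N (unit_ball N)"
    using False unit_ball_volume_pos[OF N] by (auto simp: volume_def less_le)
  have xs [measurable]: "x \<in> space (LN N)" by (rule domain_space[OF x])
  have [measurable]: "(\<lambda>z. reach c x z) \<in> borel_measurable (LN N)" "(\<lambda>z. half_chord x z) \<in> borel_measurable (LN N)" for c
    by (intro measurable_reach measurable_half_chord measurable_const xs; simp)+
  define a where "a = p / real N"
  define y0 where "y0 = volume N \<Omega> / volume N (unit_ball N)"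
  define J where "J = real N * Gamma ((real N + p) / 2) / 2 * volume N (unit_ball N)"
  define r where "r z = L2_set z {..<N}" for z :: "nat \<Rightarrow> real"
  have [measurable]: "r \<in> borel_measurable (LN N)" unfolding r_def[abs_def] by measurable
  have a: "0 < a" using p N by (simp add: a_def)
  have y0: "0 < y0" using vol by (simp add: y0_def)
  have J: "0 \<le> J" using N p vol by (auto simp: J_def intro!: mult_nonneg_nonneg Gamma_real_nonneg)
  have G0: "0 \<le> real N * Gamma ((real N + p) / 2) / 2" using p N by (auto intro!: Gamma_real_nonneg)
  have I1: "(\<integral>\<^sup>+z. ennreal (r z powr p * gweight N z) \<partial>LN N) = ennreal J"
    unfolding r_def gweight_def J_def using p N
    by (subst nn_integral_gauss_powr[OF N])
      (simp_all only: unit_ball_volume(1)[OF N] less_imp_le ennreal_mult'[OF G0])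
  have I2: "(\<integral>\<^sup>+z. ennreal (r z powr (p + real N) * gweight N z * reach c x z ^ N) \<partial>LN N) = ennreal (J * y0)" 
    if "c = 1 \<or> c = -1" for c
    unfolding r_def using that p N vol
    by (subst nn_integral_reach[OF x]) (auto simp: J_def y0_def add.commute)
  let ?K = "a * y0 powr (- a - 1) / 2"
  have K: "0 \<le> ?K" using a by simp
  have key: "AE z in LN N. ennreal ((1 + a) * y0 powr (- a)) * ennreal (r z powr p * gweight N z) \<le> 
     ennreal (half_chord x z powr (- p) * gweight N z) + 
     ennreal ?K * (ennreal (r z powr (p + real N) * gweight N z * reach 1 x z ^ N) + ennreal (r z powr (p + real N) * gweight N z * reach (-1) x z ^ N))"
    using AE_direction
  proof eventually_elim
    case (elim z)
    obtain l u where lu: "l < 0" "0 < u" "chord x z = {l<..<u}" using chord_through[OF x elim] by metis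
    note rc = reach_chord[OF lu(3,1,2)]
    let ?b = "half_chord x z"
    have b: "0 < ?b" "?b = (u + - l) / 2" using lu by (auto simp: half_chord_def rc)
    have r: "0 < r z" using elim by (simp add: r_def)
    have g: "0 < gweight N z" by (rule gweight_pos)
    have "(1 + a) * y0 powr (- a) \<le> ((?b * r z) ^ N) powr (- a) + a * y0 powr (- a - 1) * (?b * r z) ^ N"
      using a y0 b r by (intro tangent_powr) auto
    also have "((?b * r z) ^ N) powr (- a) = ?b powr (- p) * r z powr (- p)"
    proof -
      have "((?b * r z) ^ N) powr (- a) = ((?b * r z) powr real N) powr (- a)" using b r by (simp add: powr_realpow)
      also have "\<dots> = (?b * r z) powr (- p)" using N by (simp add: powr_powr a_def)
      finally show ?thesis using b(1) r by (simp add: powr_mult)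
    qed
    also have "a * y0 powr (- a - 1) * (?b * r z) ^ N \<le> a * y0 powr (- a - 1) * ((u ^ N + (- l) ^ N) / 2 * r z ^ N)"
      unfolding power_mult_distrib b(2) using a r lu by (intro mult_left_mono mult_right_mono power_mean_le) auto
    finally have "(r z powr p * gweight N z) * ((1 + a) * y0 powr (- a)) \<le> (r z powr p * gweight N z) * 
        (?b powr (- p) * r z powr (- p) + a * y0 powr (- a - 1) * ((u ^ N + (- l) ^ N) / 2 * r z ^ N))"
      using g by (intro mult_left_mono) auto
    also have "\<dots> = (r z powr p * r z powr (- p)) * ?b powr (- p) * gweight N z + 
        ?K * ((r z powr p * r z ^ N) * gweight N z * u ^ N + (r z powr p * r z ^ N) * gweight N z * (- l) ^ N)"
      by (simp add: algebra_simps add_divide_distrib)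
    also have "r z powr p * r z powr (- p) = 1" using r by (simp add: powr_add[symmetric])
    also have "r z powr p * r z ^ N = r z powr (p + real N)" using r by (simp add: powr_add powr_realpow)
    finally have *: "(1 + a) * y0 powr (- a) * (r z powr p * gweight N z) \<le> ?b powr (- p) * gweight N z + 
        ?K * (r z powr (p + real N) * gweight N z * u ^ N + r z powr (p + real N) * gweight N z * (- l) ^ N)"
      by (simp add: mult.commute)
    have nn: "0 \<le> r z powr (p + real N) * gweight N z * u ^ N" "0 \<le> r z powr (p + real N) * gweight N z * (- l) ^ N"
      using g lu by auto
    have "ennreal ((1 + a) * y0 powr (- a)) * ennreal (r z powr p * gweight N z) = ennreal ((1 + a) * y0 powr (- a) * (r z powr p * gweight N z))"
      using a by (subst ennreal_mult') auto
    also have "\<dots> \<le> ennreal (?b powr (- p) * gweight N z + 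
        ?K * (r z powr (p + real N) * gweight N z * u ^ N + r z powr (p + real N) * gweight N z * (- l) ^ N))"
      by (rule ennreal_leI[OF *])
    also have "\<dots> = ennreal (?b powr (- p) * gweight N z) + 
        ennreal ?K * (ennreal (r z powr (p + real N) * gweight N z * u ^ N) + ennreal (r z powr (p + real N) * gweight N z * (- l) ^ N))"
      using K nn g by (intro ennreal_lincomb) auto
    finally show ?case unfolding rc .
  qed
  define I where "I = (\<integral>\<^sup>+z. ennreal (half_chord x z powr (- p) * gweight N z) \<partial>LN N)"
  have "ennreal ((1 + a) * y0 powr (- a)) * ennreal J = (\<integral>\<^sup>+z. ennreal ((1 + a) * y0 powr (- a)) * ennreal (r z powr p * gweight N z) \<partial>LN N)"
    by (subst nn_integral_cmult) (auto simp: I1)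
  also have "\<dots> \<le> (\<integral>\<^sup>+z. ennreal (half_chord x z powr (- p) * gweight N z) + 
     ennreal ?K * (ennreal (r z powr (p + real N) * gweight N z * reach 1 x z ^ N) + ennreal (r z powr (p + real N) * gweight N z * reach (-1) x z ^ N)) \<partial>LN N)"
    by (rule nn_integral_mono_AE[OF key])
  also have "\<dots> = I + ennreal ?K * (ennreal (J * y0) + ennreal (J * y0))"
    unfolding I_def by (subst nn_integral_add, measurable, subst nn_integral_cmult, measurable, subst nn_integral_add, measurable) (simp add: I2)
  also have "ennreal ?K * (ennreal (J * y0) + ennreal (J * y0)) = ennreal (?K * (J * y0 + J * y0))"
  proof -
    have "0 \<le> J * y0" using J y0 by simp
    from ennreal_lincomb[OF order_refl K this this] show ?thesis by (simp only: add_0 ennreal_0)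
  qed
  also have "?K * (J * y0 + J * y0) = a * y0 powr (- a) * J"
    using y0 by (simp add: powr_diff)
  finally have "ennreal ((1 + a) * y0 powr (- a) * J) \<le> I + ennreal (a * y0 powr (- a) * J)"
    using a by (simp add: ennreal_mult')
  moreover have "ennreal ((1 + a) * y0 powr (- a) * J) = ennreal (y0 powr (- a) * J) + ennreal (a * y0 powr (- a) * J)"
    using a J by (subst ennreal_plus[symmetric]) (auto simp: algebra_simps)
  ultimately have "ennreal (a * y0 powr (- a) * J) + ennreal (y0 powr (- a) * J) \<le> ennreal (a * y0 powr (- a) * J) + I"
    by (simp only: add.commute)
  then have "ennreal (y0 powr (- a) * J) \<le> I"
    unfolding ennreal_add_left_cancel_le by (simp only: ennreal_neq_top infinity_ennreal_def simp_thms)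
  moreover have "y0 powr (- a) = (volume N (unit_ball N) / volume N \<Omega>) powr (p / real N)"
    using vol by (simp add: y0_def a_def powr_divide powr_minus_divide)
  ultimately show ?thesis by (simp add: I_def J_def mult.commute)
qed simp

end

section \<open>The inequality for test functions\<close>

lemma upd_in_space:
  "x \<in> space (LN N) \<Longrightarrow> i < N \<Longrightarrow> x(i := t) \<in> space (LN N)"
  by (auto simp: space_LN PiE_def extensional_def)

lemma smooth_continuous: "smooth N f \<Longrightarrow> continuous_map (RN N) euclideanreal f"
  unfolding smooth_def by (elim allE[of _ "[]"]) simp

lemma smooth_pdiff_continuous: "smooth N f \<Longrightarrow> i < N \<Longrightarrow> continuous_map (RN N) euclideanreal (pdiff i f)"
  unfolding smooth_def by (elim allE[of _ "[i]"]) simp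

lemma smooth_partial_derivative:
  assumes f: "smooth N f" and x: "x \<in> space (LN N)" and i: "i < N"
  shows "((\<lambda>s. f (x(i := s))) has_real_derivative pdiff i f (x(i := t))) (at t)"
proof -
  have mem: "x(i := t) \<in> topspace (RN N)" using upd_in_space[OF x i] by (simp add: topspace_RN space_LN)
  have all: "\<forall>x\<in>topspace (RN N). \<forall>i<N. (\<lambda>t. f (x(i := t))) differentiable (at (x i))"
    using f[unfolded smooth_def, rule_format, of "[]"] by simp
  have "(\<lambda>s. f ((x(i := t))(i := s))) differentiable (at ((x(i := t)) i))"
    by (rule all[rule_format, OF mem i])
  then show ?thesis by (simp add: pdiff_def DERIV_deriv_iff_real_differentiable)
qed

lemma mvt_two_sided:
  fixes k k' :: "real \<Rightarrow> real"
  assumes "\<And>t. (k has_real_derivative k' t) (at t)"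
  shows "\<exists>c. \<bar>c\<bar> \<le> \<bar>h\<bar> \<and> k h - k 0 = h * k' c"
proof (cases h "0::real" rule: linorder_cases)
  case less
  then obtain z where "h < z" "z < 0" "k 0 - k h = (0 - h) * k' z" using MVT2[of h 0 k k'] assms by auto
  then show ?thesis by (intro exI[of _ z]) (auto simp: algebra_simps)
next
  case greater
  then obtain z where "0 < z" "z < h" "k h - k 0 = (h - 0) * k' z" using MVT2[of 0 h k k'] assms by auto
  then show ?thesis by (intro exI[of _ z]) auto
qed auto

text \<open>
  The coordinates of the direction are switched on one at a time. The increment that is due to the
  last one is a mean value of the corresponding partial derivative, and this is continuous.
\<close>

lemma smooth_directional_derivative_aux:
  assumes f: "smooth N f" and x: "x \<in> space (LN N)" and "n \<le> N"
  shows "((\<lambda>t. f (\<lambda>i\<in>{..<N}. x i + (if i < n then t * z i else 0))) has_real_derivative (\<Sum>i<n. z i * pdiff i f x)) (at 0)"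
  using \<open>n \<le> N\<close>
proof (induction n)
  case (Suc n)
  have n: "n < N" using Suc by simp
  define w where "w s t = (\<lambda>i\<in>{..<N}. x i + (if i < n then s * z i else if i = n then t * z i else 0))" for s t
  have w0: "w s 0 = (\<lambda>i\<in>{..<N}. x i + (if i < n then s * z i else 0))" for s by (auto simp: w_def)
  have wh: "w t t = (\<lambda>i\<in>{..<N}. x i + (if i < Suc n then t * z i else 0))" for t by (auto simp: w_def less_Suc_eq)
  have w00: "w 0 0 = x" using x by (intro LN_ext[of _ N]) (auto simp: w_def space_LN)
  have ws: "w s t \<in> space (LN N)" for s t by (auto simp: w_def space_LN)
  have wu: "w s t = (w s 0)(n := x n + t * z n)" for s t using n by (auto simp: w_def fun_eq_iff)
  have d: "((\<lambda>t. f (w s t)) has_real_derivative z n * pdiff n f (w s t)) (at t)" for s t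
  proof -
    have "((\<lambda>t. x n + t * z n) has_real_derivative z n) (at t)" by (auto intro!: derivative_eq_intros)
    from DERIV_chain2[where f="\<lambda>v. f ((w s 0)(n := v))" and g="\<lambda>t. x n + t * z n", OF smooth_partial_derivative[OF f ws n] this]
    show ?thesis unfolding wu[symmetric] by (simp add: mult.commute)
  qed
  have "\<forall>h. \<exists>c. \<bar>c\<bar> \<le> \<bar>h\<bar> \<and> f (w h h) - f (w h 0) = h * (z n * pdiff n f (w h c))"
    using mvt_two_sided[OF d] by blast
  then obtain c where c: "\<And>h. \<bar>c h\<bar> \<le> \<bar>h\<bar>" "\<And>h. f (w h h) - f (w h 0) = h * (z n * pdiff n f (w h (c h)))"
    by metis
  have "continuous_map euclidean (RN N) (\<lambda>v. w (fst v) (snd v))"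
    unfolding continuous_map_componentwise
  proof (intro conjI ballI)
    show "(\<lambda>v. w (fst v) (snd v)) ` topspace euclidean \<subseteq> extensional {..<N}" by (auto simp: w_def)
    fix i assume i: "i \<in> {..<N}"
    have "continuous_on UNIV (\<lambda>v::real \<times> real. x i + (if i < n then fst v * z i else if i = n then snd v * z i else 0))"
      by (cases "i < n"; cases "i = n") (auto intro!: continuous_intros)
    then show "continuous_map euclidean euclideanreal (\<lambda>v::real \<times> real. w (fst v) (snd v) i)"
      using i by (simp add: w_def)
  qed
  from continuous_map_compose[OF this smooth_pdiff_continuous[OF f n]]
  have cont: "continuous_on UNIV (\<lambda>v. pdiff n f (w (fst v) (snd v)))" by (simp add: o_def)
  have "((\<lambda>h. (h, c h)) \<longlongrightarrow> (0, 0)) (at (0::real))"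
  proof (intro tendsto_Pair tendsto_ident_at)
    show "(c \<longlongrightarrow> 0) (at 0)"
      by (rule Lim_null_comparison[of _ "\<lambda>h. \<bar>h\<bar>"]) (auto simp: c intro!: tendsto_rabs_zero tendsto_ident_at)
  qed
  with cont have "((\<lambda>h. pdiff n f (w (fst (h, c h)) (snd (h, c h)))) \<longlongrightarrow> pdiff n f (w (fst (0::real, 0::real)) (snd (0::real, 0::real)))) (at 0)"
    by (intro isCont_tendsto_compose[where g="\<lambda>v. pdiff n f (w (fst v) (snd v))"]) (auto simp: continuous_on_eq_continuous_at)
  then have lim1: "((\<lambda>h. pdiff n f (w h (c h))) \<longlongrightarrow> pdiff n f x) (at 0)" by (simp add: w00)
  have "((\<lambda>t. f (w t 0)) has_real_derivative (\<Sum>i<n. z i * pdiff i f x)) (at 0)"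
    unfolding w0 by (rule Suc.IH) (use Suc.prems in simp)
  then have lim2: "((\<lambda>h. (f (w h 0) - f x) / h) \<longlongrightarrow> (\<Sum>i<n. z i * pdiff i f x)) (at 0)"
    by (simp add: DERIV_def w00)
  have "((\<lambda>h. z n * pdiff n f (w h (c h)) + (f (w h 0) - f x) / h) \<longlongrightarrow> z n * pdiff n f x + (\<Sum>i<n. z i * pdiff i f x)) (at 0)"
    by (intro tendsto_add tendsto_mult_left lim1 lim2)
  moreover have "\<forall>\<^sub>F h in at 0. z n * pdiff n f (w h (c h)) + (f (w h 0) - f x) / h = (f (w h h) - f x) / h"
  proof -
    have "z n * pdiff n f (w h (c h)) + (f (w h 0) - f x) / h = (f (w h h) - f x) / h" if "h \<noteq> 0" for h
    proof -
      have "z n * pdiff n f (w h (c h)) = (f (w h h) - f (w h 0)) / h" using c(2)[of h] that by simp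
      then show ?thesis by (simp add: add_divide_distrib[symmetric])
    qed
    then show ?thesis by (simp add: eventually_at_filter)
  qed
  ultimately have "((\<lambda>h. (f (w h h) - f x) / h) \<longlongrightarrow> z n * pdiff n f x + (\<Sum>i<n. z i * pdiff i f x)) (at 0)"
    by (rule Lim_transform_eventually)
  then show ?case unfolding wh[symmetric] by (simp add: DERIV_def w00 add.commute)
qed simp

lemma smooth_directional_derivative:
  assumes f: "smooth N f"
  shows "((\<lambda>t. f (along N x t z)) has_real_derivative (\<Sum>i<N. z i * pdiff i f (along N x t z))) (at t)"
proof -
  have "((\<lambda>s. f (\<lambda>i\<in>{..<N}. along N x t z i + (if i < N then s * z i else 0))) has_real_derivative (\<Sum>i<N. z i * pdiff i f (along N x t z))) (at 0)"
    by (rule smooth_directional_derivative_aux[OF f]) (auto simp: space_LN)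
  moreover have "(\<lambda>i\<in>{..<N}. along N x t z i + (if i < N then s * z i else 0)) = along N x (t + s) z" for s
    by (auto simp: along_def algebra_simps)
  ultimately have "((\<lambda>s. f (along N x (t + s) z)) has_real_derivative (\<Sum>i<N. z i * pdiff i f (along N x t z))) (at 0)" by simp
  then have "((\<lambda>s. f (along N x (s + t) z)) has_real_derivative (\<Sum>i<N. z i * pdiff i f (along N x t z))) (at 0)"
    by (simp add: add.commute)
  then show ?thesis using DERIV_shift[of "\<lambda>t. f (along N x t z)" _ 0 t] by simp
qed

lemma Hausdorff_RN: "Hausdorff_space (RN N)"
  by (simp add: Hausdorff_space_product_topology)

context convex_domain begin

lemma measurable_bdry_dist [measurable]: "bdry_dist N \<Omega> \<in> borel_measurable (LN N)"
proof (rule borel_measurableI_less)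
  fix r :: real
  have eq: "{x \<in> space (LN N). bdry_dist N \<Omega> x < r} = 
    (\<Union>y\<in>RN N frontier_of \<Omega>. {x \<in> topspace (RN N). edist N y x \<in> {..<r}})"
    unfolding bdry_dist_def
    by (subst cINF_less_iff) (auto simp: frontier_nonempty space_LN topspace_RN edist_commute intro!: bdd_belowI[of _ 0])
  have "openin (RN N) (\<Union>y\<in>RN N frontier_of \<Omega>. {x \<in> topspace (RN N). edist N y x \<in> {..<r}})"
  proof (intro openin_Union ballI, elim imageE, hypsubst)
    fix y show "openin (RN N) {x \<in> topspace (RN N). edist N y x \<in> {..<r}}"
      by (rule openin_continuous_map_preimage[OF continuous_map_edist]) simp
  qed
  then show "{x \<in> space (LN N). bdry_dist N \<Omega> x < r} \<in> sets (LN N)"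
    unfolding eq by (rule sets_LN_openin)
qed

lemma test_function_chord:
  assumes phi: "\<phi> \<in> test_functions N \<Omega>" and c: "chord x z = {l<..<u}" "l < u"
  obtains e where "0 < e" "\<And>t. t \<le> l + e \<or> u - e \<le> t \<Longrightarrow> \<phi> (along N x t z) = 0"
proof -
  obtain K where K: "compactin (RN N) K" "K \<subseteq> \<Omega>" "\<And>w. w \<in> topspace (RN N) - K \<Longrightarrow> \<phi> w = 0"
    using phi by (auto simp: test_functions_def)
  define T where "T = {t. along N x t z \<in> K}"
  have zero: "\<phi> (along N x t z) = 0" if "t \<notin> T" for t
    using that by (intro K(3)) (auto simp: T_def topspace_RN)
  have T: "T \<subseteq> {l<..<u}" using c K(2) by (auto simp: T_def chord_def set_eq_iff)
  have "closedin (RN N) K" by (rule compactin_imp_closedin[OF Hausdorff_RN K(1)])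
  from closedin_continuous_map_preimage[OF continuous_map_along this, of x z]
  have "closed T" by (simp add: T_def)
  moreover have "bounded T" by (rule bounded_subset[OF _ T]) simp
  ultimately have cT: "compact T" by (simp add: compact_eq_bounded_closed)
  show thesis
  proof (cases "T = {}")
    case True
    then show ?thesis using that[of 1] zero by auto
  next
    case False
    obtain m M where m: "m \<in> T" "\<And>t. t \<in> T \<Longrightarrow> m \<le> t" and M: "M \<in> T" "\<And>t. t \<in> T \<Longrightarrow> t \<le> M"
      using compact_attains_inf[OF cT False] compact_attains_sup[OF cT False] by blast
    define e where "e = min (m - l) (u - M) / 2"
    have e: "0 < e" "2 * e \<le> m - l" "2 * e \<le> u - M" using T m(1) M(1) by (auto simp: e_def)
    show ?thesis
    proof (rule that[OF e(1)])
      fix t assume "t \<le> l + e \<or> u - e \<le> t"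
      then have "t \<notin> T" using e m(2)[of t] M(2)[of t] by force
      then show "\<phi> (along N x t z) = 0" by (rule zero)
    qed
  qed
qed

text \<open>
  The parameter \<open>t\<close> of the line \<open>x + t z\<close> is arc length divided by \<open>\<bar>z\<bar>\<close>, so \<open>hardy_chord\<close> is used with
  \<open>D / \<bar>z\<bar>\<close>. The weight may be evaluated at \<open>d\<close> instead of the distance along the line, since the
  latter is at least \<open>d\<close> and the \<open>X\<^sub>i\<close> increase; only the factor with the exponent \<open>- p\<close> decreases.
\<close>

lemma hardy_direction:
  fixes \<phi> :: "(nat \<Rightarrow> real) \<Rightarrow> real"
  assumes p: "1 < p" and adm: "admissible k p (ediam N \<Omega> / (2 * D))" and D: "0 < D"
    and phi: "\<phi> \<in> test_functions N \<Omega>" and zs: "z \<in> space (LN N)" and z: "0 < L2_set z {..<N}"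
  shows "(\<integral>\<^sup>+x\<in>\<Omega>. ennreal (\<bar>\<phi> x\<bar> powr p * (hardy_weight k p (bdry_dist N \<Omega> x / D) * near x z powr (- p)
            + remainder_const k p (ediam N \<Omega> / (2 * D)) * half_chord x z powr (- p))) \<partial>LN N)
     \<le> (\<integral>\<^sup>+x\<in>\<Omega>. ennreal (\<bar>\<Sum>i<N. z i * pdiff i \<phi> x\<bar> powr p) \<partial>LN N)"
proof -
  let ?r = "L2_set z {..<N}" and ?s = "ediam N \<Omega> / (2 * D)"
  have sm: "smooth N \<phi>" using phi by (simp add: test_functions_def)
  have [measurable]: "\<phi> \<in> borel_measurable (LN N)"
    by (rule measurable_LN_continuous_map[OF smooth_continuous[OF sm]])
  have pm [measurable]: "pdiff i \<phi> \<in> borel_measurable (LN N)" if "i \<in> {..<N}" for i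
    using that by (intro measurable_LN_continuous_map smooth_pdiff_continuous[OF sm]) auto
  have [measurable]: "(\<lambda>x. near x z) \<in> borel_measurable (LN N)" "(\<lambda>x. half_chord x z) \<in> borel_measurable (LN N)"
    by (intro measurable_near measurable_half_chord measurable_const zs; simp)+
  have "\<exists>i<N. z i \<noteq> 0"
  proof (rule ccontr)
    assume "\<not> (\<exists>i<N. z i \<noteq> 0)"
    then have "?r = 0" by (simp add: L2_set_def)
    then show False using z by simp
  qed
  then obtain j where j: "j < N" "z j \<noteq> 0" by blast
  have s: "0 < ?s" "?s \<le> 1" using adm by (auto simp: admissible_def)
  show ?thesis
  proof (rule nn_integral_le_of_lines[OF _ _ zs j])
    show "(\<lambda>x. ennreal (\<bar>\<phi> x\<bar> powr p * (hardy_weight k p (bdry_dist N \<Omega> x / D) * near x z powr (- p)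
            + remainder_const k p ?s * half_chord x z powr (- p))) * indicator \<Omega> x) \<in> borel_measurable (LN N)"
      by measurable
    show "(\<lambda>x. ennreal (\<bar>\<Sum>i<N. z i * pdiff i \<phi> x\<bar> powr p) * indicator \<Omega> x) \<in> borel_measurable (LN N)"
      by measurable
    fix x assume x: "x \<in> space (LN N)"
    let ?y = "\<lambda>t. along N x t z"
    have ind: "(indicator \<Omega> (?y t) :: ennreal) = indicator (chord x z) t" for t
      by (simp add: chord_def indicator_def)
    show "(\<integral>\<^sup>+t. ennreal (\<bar>\<phi> (?y t)\<bar> powr p * (hardy_weight k p (bdry_dist N \<Omega> (?y t) / D) * near (?y t) z powr (- p)
            + remainder_const k p ?s * half_chord (?y t) z powr (- p))) * indicator \<Omega> (?y t) \<partial>lborel)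
        \<le> (\<integral>\<^sup>+t. ennreal (\<bar>\<Sum>i<N. z i * pdiff i \<phi> (?y t)\<bar> powr p) * indicator \<Omega> (?y t) \<partial>lborel)"
    proof (cases "chord x z = {}")
      case True
      then show ?thesis unfolding ind by simp
    next
      case False
      obtain l u where lu: "l < u" "chord x z = {l<..<u}" "(u - l) * ?r \<le> ediam N \<Omega>"
        using chord_interval[OF z False] by metis
      obtain e where e: "0 < e" "\<And>t. t \<le> l + e \<or> u - e \<le> t \<Longrightarrow> \<phi> (?y t) = 0"
        using test_function_chord[OF phi lu(2,1)] by metis
      have len: "(u - l) / 2 \<le> D / ?r * ?s" using lu(3) z D by (simp add: field_simps)
      have cont: "continuous_on UNIV (\<lambda>t. \<Sum>i<N. z i * pdiff i \<phi> (?y t))"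
      proof (intro continuous_intros)
        fix i assume "i \<in> {..<N}"
        then have "continuous_map euclideanreal euclideanreal (pdiff i \<phi> \<circ> ?y)"
          by (intro continuous_map_compose[OF continuous_map_along] smooth_pdiff_continuous[OF sm]) auto
        then show "continuous_on UNIV (\<lambda>t. pdiff i \<phi> (?y t))" by (simp add: o_def)
      qed
      have pt: "\<bar>\<phi> (?y t)\<bar> powr p * (hardy_weight k p (bdry_dist N \<Omega> (?y t) / D) * near (?y t) z powr (- p)
            + remainder_const k p ?s * half_chord (?y t) z powr (- p)) \<le> 
          \<bar>\<phi> (?y t)\<bar> powr p * (min (t - l) (u - t) powr (- p) * hardy_weight k p (min (t - l) (u - t) / (D / ?r)) 
            + ((u - l) / 2) powr (- p) * remainder_const k p ?s)" if t: "t \<in> {l<..<u}" for t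
      proof -
        have y: "?y t \<in> \<Omega>" using t lu(2) by (auto simp: chord_def)
        have "chord (?y t) z = {l - t<..<u - t}"
        proof -
          have "chord (?y t) z = {s. t + s \<in> chord x z}" by (simp add: chord_def along_shift)
          also have "\<dots> = {l - t<..<u - t}" unfolding lu(2) by auto
          finally show ?thesis .
        qed
        then have "reach 1 (?y t) z = u - t" "reach (-1) (?y t) z = t - l"
          using reach_chord[of "?y t" z "l - t" "u - t"] t by auto
        then have near: "near (?y t) z = min (t - l) (u - t)" and half: "half_chord (?y t) z = (u - l) / 2"
          by (auto simp: near_def half_chord_def)
        have d: "0 < bdry_dist N \<Omega> (?y t)" "bdry_dist N \<Omega> (?y t) \<le> min (t - l) (u - t) * ?r"
          using near_ge_bdry_dist[OF y z] bdry_dist_pos[OF y] by (auto simp: near)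
        have "min (t - l) (u - t) \<le> (u - l) / 2" by (simp add: min_def field_simps)
        also note len
        finally have "min (t - l) (u - t) / (D / ?r) \<le> ?s" using D z by (simp add: field_simps)
        then have m1: "min (t - l) (u - t) / (D / ?r) \<le> 1" using s by linarith
        have m2: "bdry_dist N \<Omega> (?y t) / D \<le> min (t - l) (u - t) / (D / ?r)"
          using d D by (simp add: divide_right_mono)
        have "hardy_weight k p (bdry_dist N \<Omega> (?y t) / D) \<le> hardy_weight k p (min (t - l) (u - t) / (D / ?r))"
          by (rule hardy_weight_mono[OF _ m2 m1]) (use d D in auto)
        then have "hardy_weight k p (bdry_dist N \<Omega> (?y t) / D) * min (t - l) (u - t) powr (- p) \<le> 
            hardy_weight k p (min (t - l) (u - t) / (D / ?r)) * min (t - l) (u - t) powr (- p)"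
          by (intro mult_right_mono) auto
        then show ?thesis unfolding near half by (intro mult_left_mono) (auto simp: mult.commute)
      qed
      have "(\<integral>\<^sup>+t. ennreal (\<bar>\<phi> (?y t)\<bar> powr p * (hardy_weight k p (bdry_dist N \<Omega> (?y t) / D) * near (?y t) z powr (- p)
            + remainder_const k p ?s * half_chord (?y t) z powr (- p))) * indicator \<Omega> (?y t) \<partial>lborel)
        \<le> (\<integral>\<^sup>+t\<in>{l<..<u}. ennreal (\<bar>\<phi> (?y t)\<bar> powr p * (min (t - l) (u - t) powr (- p) * 
            hardy_weight k p (min (t - l) (u - t) / (D / ?r)) 
            + ((u - l) / 2) powr (- p) * remainder_const k p ?s)) \<partial>lborel)"
        unfolding ind lu(2)
      proof (rule nn_integral_mono)
        fix t
        show "ennreal (\<bar>\<phi> (?y t)\<bar> powr p * (hardy_weight k p (bdry_dist N \<Omega> (?y t) / D) * near (?y t) z powr (- p)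
            + remainder_const k p ?s * half_chord (?y t) z powr (- p))) * indicator {l<..<u} t
          \<le> ennreal (\<bar>\<phi> (?y t)\<bar> powr p * (min (t - l) (u - t) powr (- p) * 
            hardy_weight k p (min (t - l) (u - t) / (D / ?r)) 
            + ((u - l) / 2) powr (- p) * remainder_const k p ?s)) * indicator {l<..<u} t"
        proof (cases "t \<in> {l<..<u}")
          case True
          show ?thesis by (intro mult_right_mono ennreal_leI pt[OF True]) simp
        qed simp
      qed
      also have "\<dots> \<le> (\<integral>\<^sup>+t\<in>{l<..<u}. ennreal (\<bar>\<Sum>i<N. z i * pdiff i \<phi> (?y t)\<bar> powr p) \<partial>lborel)"
        by (rule hardy_chord[OF p adm _ lu(1) len smooth_directional_derivative[OF sm] cont e]) (use D z in auto)
      finally show ?thesis unfolding ind lu(2) .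
    qed
  qed
qed

end

context convex_domain begin

definition total_weight :: "nat \<Rightarrow> real \<Rightarrow> real \<Rightarrow> (nat \<Rightarrow> real) \<Rightarrow> real" where
  "total_weight k p D x = bdry_dist N \<Omega> x powr (- p) * hardy_weight k p (bdry_dist N \<Omega> x / D) +
     k_const N p * defect k p (eta k (ediam N \<Omega> / (2 * D))) powr (p / (p - 1)) *
       (volume N (unit_ball N) / volume N \<Omega>) powr (p / real N)"

lemma k_const_nonneg: "1 < p \<Longrightarrow> 0 \<le> k_const N p"
  using N unfolding k_const_def by (intro mult_nonneg_nonneg divide_nonneg_nonneg Gamma_real_nonneg) auto

lemma total_weight_nonneg: "1 < p \<Longrightarrow> 0 \<le> total_weight k p D x"
  unfolding total_weight_def using k_const_nonneg hardy_weight_nonneg by simp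

lemma measurable_total_weight [measurable]: "total_weight k p D \<in> borel_measurable (LN N)"
  unfolding total_weight_def[abs_def] by measurable

text \<open>
  The average of \<open>half_chord\<close> involves the moment of order \<open>p\<close> of \<open>\<bar>z\<bar>\<close>, that of the gradient the moment
  of one coordinate. Their quotient is the Gamma factor in \<open>k\<^sub>p\<close>.
\<close>

lemma remainder_const_volume:
  assumes p: "1 < p"
  shows "remainder_const k p s * (real N * Gamma ((real N + p) / 2) / 2 * volume N (unit_ball N)) =
     (Gamma ((p + 1) / 2) * sqrt pi ^ (N - 1)) * (k_const N p * defect k p (eta k s) powr (p / (p - 1)))"
proof -
  have G: "0 < Gamma (real N / 2)" "0 < Gamma ((p + 1) / 2)" using N p by (auto intro!: Gamma_real_pos)
  have "real N / 2 * volume N (unit_ball N) = sqrt pi ^ N / Gamma (real N / 2)"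
    using unit_ball_volume(2)[OF N] G by (simp add: field_simps)
  moreover have "sqrt pi ^ N = sqrt pi * sqrt pi ^ (N - 1)" using N by (cases N) auto
  ultimately have "real N * Gamma ((real N + p) / 2) / 2 * volume N (unit_ball N) =
     (Gamma ((p + 1) / 2) * sqrt pi ^ (N - 1)) * (sqrt pi * Gamma ((real N + p) / 2) / (Gamma ((p + 1) / 2) * Gamma (real N / 2)))"
    using G by (simp add: field_simps)
  then show ?thesis unfolding remainder_const_def k_const_def by (simp only: mult_ac)
qed

lemma average_weight:
  assumes p: "1 < p" and x: "x \<in> \<Omega>" and a: "0 \<le> a"
  shows "ennreal (Gamma ((p + 1) / 2) * sqrt pi ^ (N - 1)) * ennreal (a * total_weight k p D x) \<le>
    (\<integral>\<^sup>+z. ennreal (a * (hardy_weight k p (bdry_dist N \<Omega> x / D) * near x z powr (- p)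
            + remainder_const k p (ediam N \<Omega> / (2 * D)) * half_chord x z powr (- p))) * ennreal (gweight N z) \<partial>LN N)"
proof -
  let ?hw = "hardy_weight k p (bdry_dist N \<Omega> x / D)" and ?K = "remainder_const k p (ediam N \<Omega> / (2 * D))"
  define mp where "mp = Gamma ((p + 1) / 2) * sqrt pi ^ (N - 1)"
  define v where "v = (volume N (unit_ball N) / volume N \<Omega>) powr (p / real N)"
  define J where "J = real N * Gamma ((real N + p) / 2) / 2 * volume N (unit_ball N)"
  have xs: "x \<in> space (LN N)" by (rule domain_space[OF x])
  have [measurable]: "(\<lambda>z. near x z) \<in> borel_measurable (LN N)" "(\<lambda>z. half_chord x z) \<in> borel_measurable (LN N)"
    by (intro measurable_near measurable_half_chord measurable_const xs; simp)+
  have hw: "0 \<le> ?hw" by (rule hardy_weight_nonneg)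
  have K: "0 \<le> ?K" by (rule remainder_const_nonneg[OF p])
  have mp: "0 \<le> mp" using p by (auto simp: mp_def intro!: mult_nonneg_nonneg Gamma_real_nonneg)
  have J: "0 \<le> J" using N p unit_ball_volume_pos[OF N] by (auto simp: J_def intro!: mult_nonneg_nonneg Gamma_real_nonneg)
  have KJ: "?K * J = mp * (k_const N p * defect k p (eta k (ediam N \<Omega> / (2 * D))) powr (p / (p - 1)))"
    unfolding J_def mp_def by (rule remainder_const_volume[OF p])
  have "mp * (a * total_weight k p D x) = a * (?hw * (bdry_dist N \<Omega> x powr (- p) * mp) + ?K * J * v)"
    unfolding KJ total_weight_def v_def by (simp add: algebra_simps)
  then have "ennreal mp * ennreal (a * total_weight k p D x) = ennreal (a * (?hw * (bdry_dist N \<Omega> x powr (- p) * mp) + ?K * (J * v)))"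
    by (simp only: ennreal_mult'[OF mp, symmetric] mult.assoc)
  also have "\<dots> = ennreal a * (ennreal ?hw * ennreal (bdry_dist N \<Omega> x powr (- p) * mp) + ennreal ?K * ennreal (J * v))"
    using a hw K mp J by (simp add: ennreal_mult v_def)
  also have "\<dots> \<le> ennreal a * (ennreal ?hw * (\<integral>\<^sup>+z. ennreal (near x z powr (- p) * gweight N z) \<partial>LN N) + 
      ennreal ?K * (\<integral>\<^sup>+z. ennreal (half_chord x z powr (- p) * gweight N z) \<partial>LN N))"
    unfolding mp_def J_def v_def using p
    by (intro mult_left_mono add_mono average_near[OF x] average_half_chord[OF x]) auto
  also have "\<dots> = (\<integral>\<^sup>+z. ennreal a * (ennreal ?hw * ennreal (near x z powr (- p) * gweight N z) + 
      ennreal ?K * ennreal (half_chord x z powr (- p) * gweight N z)) \<partial>LN N)"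
    by (subst nn_integral_cmult, measurable, subst nn_integral_add, measurable, subst nn_integral_cmult, measurable, subst nn_integral_cmult, measurable)
  also have "\<dots> = (\<integral>\<^sup>+z. ennreal (a * (?hw * near x z powr (- p) + ?K * half_chord x z powr (- p))) * ennreal (gweight N z) \<partial>LN N)"
  proof (rule nn_integral_cong)
    fix z
    have "a * (?hw * near x z powr (- p) + ?K * half_chord x z powr (- p)) * gweight N z =
      a * (?hw * (near x z powr (- p) * gweight N z) + ?K * (half_chord x z powr (- p) * gweight N z))"
      by (simp add: algebra_simps)
    moreover have "ennreal (a * (?hw * (near x z powr (- p) * gweight N z) + ?K * (half_chord x z powr (- p) * gweight N z))) = 
      ennreal a * (ennreal ?hw * ennreal (near x z powr (- p) * gweight N z) + ennreal ?K * ennreal (half_chord x z powr (- p) * gweight N z))"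
      using a hw K less_imp_le[OF gweight_pos[of N z]] by (simp add: ennreal_mult)
    moreover have "0 \<le> a * (?hw * near x z powr (- p) + ?K * half_chord x z powr (- p))"
      using a hw K by simp
    ultimately show "ennreal a * (ennreal ?hw * ennreal (near x z powr (- p) * gweight N z) + ennreal ?K * ennreal (half_chord x z powr (- p) * gweight N z)) =
      ennreal (a * (?hw * near x z powr (- p) + ?K * half_chord x z powr (- p))) * ennreal (gweight N z)"
      by (metis ennreal_mult')
  qed
  finally show ?thesis unfolding mp_def .
qed

lemma hardy_test_function:
  fixes \<phi> :: "(nat \<Rightarrow> real) \<Rightarrow> real"
  assumes p: "1 < p" and adm: "admissible k p (ediam N \<Omega> / (2 * D))" and D: "0 < D"
    and phi: "\<phi> \<in> test_functions N \<Omega>"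
  shows "(\<integral>\<^sup>+x\<in>\<Omega>. ennreal (\<bar>\<phi> x\<bar> powr p * total_weight k p D x) \<partial>LN N)
     \<le> (\<integral>\<^sup>+x\<in>\<Omega>. ennreal (L2_set (\<lambda>i. pdiff i \<phi> x) {..<N} powr p) \<partial>LN N)"
proof -
  interpret pair_sigma_finite "LN N" "LN N" by (rule pair_sigma_finite_LN)
  define mp where "mp = Gamma ((p + 1) / 2) * sqrt pi ^ (N - 1)"
  have mp: "0 < mp" using p by (auto simp: mp_def intro!: mult_pos_pos Gamma_real_pos)
  have sm: "smooth N \<phi>" using phi by (simp add: test_functions_def)
  have [measurable]: "\<phi> \<in> borel_measurable (LN N)"
    by (rule measurable_LN_continuous_map[OF smooth_continuous[OF sm]])
  have pm [measurable]: "pdiff i \<phi> \<in> borel_measurable (LN N)" if "i \<in> {..<N}" for i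
    using that by (intro measurable_LN_continuous_map smooth_pdiff_continuous[OF sm]) auto
  have dm [measurable]: "(\<lambda>w. \<Sum>i<N. f w i * pdiff i \<phi> (g w)) \<in> borel_measurable M"
    if "f \<in> M \<rightarrow>\<^sub>M LN N" "g \<in> M \<rightarrow>\<^sub>M LN N" for M f g
  proof (intro borel_measurable_sum borel_measurable_times)
    fix i assume i: "i \<in> {..<N}"
    show "(\<lambda>w. f w i) \<in> borel_measurable M" using i that by (intro measurable_LN_component) auto
    show "(\<lambda>w. pdiff i \<phi> (g w)) \<in> borel_measurable M" using i that pm by (intro measurable_compose[OF that(2)]) auto
  qed
  have Lm [measurable]: "(\<lambda>x. L2_set (\<lambda>i. pdiff i \<phi> x) {..<N}) \<in> borel_measurable (LN N)"
    unfolding L2_set_def by measurable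
  define W where "W z x = \<bar>\<phi> x\<bar> powr p * (hardy_weight k p (bdry_dist N \<Omega> x / D) * near x z powr (- p)
            + remainder_const k p (ediam N \<Omega> / (2 * D)) * half_chord x z powr (- p))" for z x
  have Wm [measurable]: "(\<lambda>w. W (f w) (g w)) \<in> borel_measurable M" 
    if [measurable]: "f \<in> M \<rightarrow>\<^sub>M LN N" "g \<in> M \<rightarrow>\<^sub>M LN N" for M :: "'b measure" and f g
    unfolding W_def by measurable
  have "ennreal mp * (\<integral>\<^sup>+x\<in>\<Omega>. ennreal (\<bar>\<phi> x\<bar> powr p * total_weight k p D x) \<partial>LN N) = 
    (\<integral>\<^sup>+x. ennreal mp * (ennreal (\<bar>\<phi> x\<bar> powr p * total_weight k p D x) * indicator \<Omega> x) \<partial>LN N)"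
    by (rule nn_integral_cmult[symmetric]) measurable
  also have "\<dots> \<le> (\<integral>\<^sup>+x. \<integral>\<^sup>+z. ennreal (W z x) * indicator \<Omega> x * ennreal (gweight N z) \<partial>LN N \<partial>LN N)"
  proof (rule nn_integral_mono)
    fix x
    show "ennreal mp * (ennreal (\<bar>\<phi> x\<bar> powr p * total_weight k p D x) * indicator \<Omega> x) \<le> 
      (\<integral>\<^sup>+z. ennreal (W z x) * indicator \<Omega> x * ennreal (gweight N z) \<partial>LN N)"
      using average_weight[OF p, of x "\<bar>\<phi> x\<bar> powr p" k D] unfolding W_def mp_def
      by (cases "x \<in> \<Omega>") auto
  qed
  also have "\<dots> = (\<integral>\<^sup>+z. \<integral>\<^sup>+x. ennreal (W z x) * indicator \<Omega> x * ennreal (gweight N z) \<partial>LN N \<partial>LN N)"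
    by (rule Fubini') measurable
  also have "\<dots> = (\<integral>\<^sup>+z. (\<integral>\<^sup>+x. ennreal (W z x) * indicator \<Omega> x \<partial>LN N) * ennreal (gweight N z) \<partial>LN N)"
    by (intro nn_integral_cong nn_integral_multc) measurable
  also have "\<dots> \<le> (\<integral>\<^sup>+z. (\<integral>\<^sup>+x. ennreal (\<bar>\<Sum>i<N. z i * pdiff i \<phi> x\<bar> powr p) * indicator \<Omega> x \<partial>LN N) * ennreal (gweight N z) \<partial>LN N)"
  proof (rule nn_integral_mono_AE)
    show "AE z in LN N. (\<integral>\<^sup>+x. ennreal (W z x) * indicator \<Omega> x \<partial>LN N) * ennreal (gweight N z) \<le> 
      (\<integral>\<^sup>+x. ennreal (\<bar>\<Sum>i<N. z i * pdiff i \<phi> x\<bar> powr p) * indicator \<Omega> x \<partial>LN N) * ennreal (gweight N z)"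
      using AE_direction AE_space
    proof eventually_elim
      case (elim z)
      show ?case unfolding W_def
        by (rule mult_right_mono[OF hardy_direction[OF p adm D phi elim(2,1)]]) simp
    qed
  qed
  also have "\<dots> = (\<integral>\<^sup>+z. \<integral>\<^sup>+x. ennreal (\<bar>\<Sum>i<N. z i * pdiff i \<phi> x\<bar> powr p) * indicator \<Omega> x * ennreal (gweight N z) \<partial>LN N \<partial>LN N)"
    by (intro nn_integral_cong nn_integral_multc[symmetric]) measurable
  also have "\<dots> = (\<integral>\<^sup>+x. \<integral>\<^sup>+z. ennreal (\<bar>\<Sum>i<N. z i * pdiff i \<phi> x\<bar> powr p) * indicator \<Omega> x * ennreal (gweight N z) \<partial>LN N \<partial>LN N)"
    by (rule Fubini'[symmetric]) measurable
  also have "\<dots> = (\<integral>\<^sup>+x. ennreal mp * (ennreal (L2_set (\<lambda>i. pdiff i \<phi> x) {..<N} powr p) * indicator \<Omega> x) \<partial>LN N)"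
  proof (rule nn_integral_cong)
    fix x assume "x \<in> space (LN N)"
    have "(\<integral>\<^sup>+z. ennreal (\<bar>\<Sum>i<N. z i * pdiff i \<phi> x\<bar> powr p) * indicator \<Omega> x * ennreal (gweight N z) \<partial>LN N)
      = (\<integral>\<^sup>+z. indicator \<Omega> x * ennreal (\<bar>\<Sum>i<N. pdiff i \<phi> x * z i\<bar> powr p * gweight N z) \<partial>LN N)"
      by (intro nn_integral_cong) (simp add: ennreal_mult less_imp_le[OF gweight_pos] mult.commute mult.left_commute)
    also have "\<dots> = indicator \<Omega> x * (\<integral>\<^sup>+z. ennreal (\<bar>\<Sum>i<N. pdiff i \<phi> x * z i\<bar> powr p * gweight N z) \<partial>LN N)"
      by (intro nn_integral_cmult) measurable
    also have "\<dots> = indicator \<Omega> x * ennreal (L2_set (\<lambda>i. pdiff i \<phi> x) {..<N} powr p * mp)"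
      unfolding mp_def using p by (subst nn_integral_gweight_projection[OF _ N]) auto
    also have "\<dots> = ennreal mp * (ennreal (L2_set (\<lambda>i. pdiff i \<phi> x) {..<N} powr p) * indicator \<Omega> x)"
      using mp by (simp add: ennreal_mult mult.commute mult.left_commute)
    finally show "(\<integral>\<^sup>+z. ennreal (\<bar>\<Sum>i<N. z i * pdiff i \<phi> x\<bar> powr p) * indicator \<Omega> x * ennreal (gweight N z) \<partial>LN N) = \<dots>" .
  qed
  also have "\<dots> = ennreal mp * (\<integral>\<^sup>+x\<in>\<Omega>. ennreal (L2_set (\<lambda>i. pdiff i \<phi> x) {..<N} powr p) \<partial>LN N)"
    by (rule nn_integral_cmult) measurable
  finally show ?thesis
    using mp by (simp add: ennreal_mult_le_mult_iff)
qed

end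

section \<open>Bump functions and the uniqueness of the weak gradient\<close>

text \<open>
  The derivatives of \<open>e\<close> to the power \<open>- 1 / t\<close>, extended by zero to \<open>t \<le> 0\<close>, are of this form with other
  polynomials.
\<close>

definition flat_exp :: "real poly \<Rightarrow> real \<Rightarrow> real" where
  "flat_exp P t = (if t > 0 then poly P (1 / t) * exp (- (1 / t)) else 0)"

lemma poly_times_exp_limit: "((\<lambda>x::real. x ^ k * poly P x * exp (- x)) \<longlongrightarrow> 0) at_top"
proof (induction P arbitrary: k)
  case (pCons a P)
  have "((\<lambda>x. a * (x ^ k / exp x) + x ^ Suc k * poly P x * exp (- x)) \<longlongrightarrow> a * 0 + 0) at_top"
    by (intro tendsto_add tendsto_mult_left tendsto_power_div_exp_0 pCons.IH)
  then show ?case by (simp add: exp_minus field_simps)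
qed simp

lemma flat_exp_quotient_limit: "((\<lambda>h. flat_exp P h / h) \<longlongrightarrow> 0) (at 0)"
proof (rule filterlim_split_at)
  show "((\<lambda>h. flat_exp P h / h) \<longlongrightarrow> 0) (at_left 0)"
    by (rule tendsto_eventually) (auto simp: flat_exp_def eventually_at_filter)
  have "((\<lambda>x::real. x ^ 1 * poly P x * exp (- x)) \<longlongrightarrow> 0) at_top" by (rule poly_times_exp_limit)
  from filterlim_compose[OF this filterlim_inverse_at_top_right]
  have "((\<lambda>h. inverse h ^ 1 * poly P (inverse h) * exp (- inverse h)) \<longlongrightarrow> 0) (at_right (0::real))" .
  moreover have "\<forall>\<^sub>F h in at_right (0::real). inverse h ^ 1 * poly P (inverse h) * exp (- inverse h) = flat_exp P h / h"
    by (auto simp: flat_exp_def eventually_at_filter field_simps inverse_eq_divide)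
  ultimately show "((\<lambda>h. flat_exp P h / h) \<longlongrightarrow> 0) (at_right 0)" by (rule Lim_transform_eventually)
qed

lemma flat_exp_deriv: "(flat_exp P has_real_derivative flat_exp ([:0, 0, 1:] * (P - pderiv P)) t) (at t)"
proof (cases t "0::real" rule: linorder_cases)
  case less
  have "((\<lambda>_. 0) has_real_derivative 0) (at t)" by simp
  moreover have "\<forall>\<^sub>F s in nhds t. 0 = flat_exp P s"
    using eventually_nhds_in_open[of "{..<0}" t] less by (auto elim!: eventually_mono simp: flat_exp_def)
  ultimately show ?thesis using less by (subst (asm) DERIV_cong_ev) (auto simp: flat_exp_def)
next
  case equal
  then show ?thesis using flat_exp_quotient_limit[of P] by (simp add: DERIV_def flat_exp_def)
next
  case greater
  have i: "((\<lambda>s. 1 / s) has_real_derivative - (1 / t\<^sup>2)) (at t)"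
    using greater by (auto intro!: derivative_eq_intros simp: power2_eq_square)
  have "((\<lambda>s. poly P (1 / s)) has_real_derivative poly (pderiv P) (1 / t) * - (1 / t\<^sup>2)) (at t)"
    by (rule DERIV_chain2[where f="poly P" and g="\<lambda>s. 1 / s", OF poly_DERIV i])
  moreover have "((\<lambda>s. exp (- (1 / s))) has_real_derivative exp (- (1 / t)) * (1 / t\<^sup>2)) (at t)"
    using DERIV_fun_exp[OF DERIV_minus[OF i]] by simp
  ultimately have "((\<lambda>s. poly P (1 / s) * exp (- (1 / s))) has_real_derivative 
      poly P (1 / t) * (exp (- (1 / t)) * (1 / t\<^sup>2)) + poly (pderiv P) (1 / t) * - (1 / t\<^sup>2) * exp (- (1 / t))) (at t)"
    by (rule DERIV_mult')
  also have "poly P (1 / t) * (exp (- (1 / t)) * (1 / t\<^sup>2)) + poly (pderiv P) (1 / t) * - (1 / t\<^sup>2) * exp (- (1 / t)) = 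
      flat_exp ([:0, 0, 1:] * (P - pderiv P)) t"
    using greater by (simp add: flat_exp_def power2_eq_square field_simps)
  finally have "((\<lambda>s. poly P (1 / s) * exp (- (1 / s))) has_real_derivative flat_exp ([:0, 0, 1:] * (P - pderiv P)) t) (at t)" .
  moreover have "\<forall>\<^sub>F s in nhds t. poly P (1 / s) * exp (- (1 / s)) = flat_exp P s"
    using eventually_nhds_in_open[of "{0<..}" t] greater by (auto elim!: eventually_mono simp: flat_exp_def)
  ultimately show ?thesis by (subst (asm) DERIV_cong_ev) auto
qed

text \<open>
  An algebra of functions that contains the derivatives of its members. This property replaces the
  Leibniz formula for higher derivatives.
\<close>

inductive smooth_real :: "(real \<Rightarrow> real) \<Rightarrow> bool" where
  smooth_real_flat_exp: "smooth_real (\<lambda>t. flat_exp P (c * t + d))"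
| smooth_real_scale: "smooth_real f \<Longrightarrow> smooth_real (\<lambda>t. c * f t)"
| smooth_real_add: "smooth_real f \<Longrightarrow> smooth_real g \<Longrightarrow> smooth_real (\<lambda>t. f t + g t)"
| smooth_real_mult: "smooth_real f \<Longrightarrow> smooth_real g \<Longrightarrow> smooth_real (\<lambda>t. f t * g t)"

lemma smooth_real_deriv:
  "smooth_real f \<Longrightarrow> \<exists>f'. smooth_real f' \<and> (\<forall>t. (f has_real_derivative f' t) (at t))"
proof (induction rule: smooth_real.induct)
  case (smooth_real_flat_exp P c d)
  let ?Q = "[:0, 0, 1:] * (P - pderiv P)"
  have "((\<lambda>t. flat_exp P (c * t + d)) has_real_derivative flat_exp ?Q (c * t + d) * c) (at t)" for t
    by (rule DERIV_chain2[where f="flat_exp P" and g="\<lambda>t. c * t + d", OF flat_exp_deriv]) (auto intro!: derivative_eq_intros)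
  then have "\<forall>t. ((\<lambda>t. flat_exp P (c * t + d)) has_real_derivative c * flat_exp ?Q (c * t + d)) (at t)"
    by (simp only: mult.commute[of c "flat_exp _ _"] simp_thms)
  moreover have "smooth_real (\<lambda>t. c * flat_exp ?Q (c * t + d))" by (intro smooth_real.intros)
  ultimately show ?case by blast
next
  case (smooth_real_scale f c)
  then show ?case by (metis DERIV_cmult smooth_real.smooth_real_scale)
next
  case (smooth_real_add f g)
  then obtain f' g' where "smooth_real f'" "\<forall>t. (f has_real_derivative f' t) (at t)" "smooth_real g'" "\<forall>t. (g has_real_derivative g' t) (at t)"
    by blast
  then show ?case by (intro exI[of _ "\<lambda>t. f' t + g' t"]) (auto intro: smooth_real.intros DERIV_add)
next
  case (smooth_real_mult f g)
  then obtain f' g' where "smooth_real f'" "\<forall>t. (f has_real_derivative f' t) (at t)" "smooth_real g'" "\<forall>t. (g has_real_derivative g' t) (at t)"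
    by blast
  with smooth_real_mult.hyps show ?case
    by (intro exI[of _ "\<lambda>t. f t * g' t + f' t * g t"]) (auto intro: smooth_real.intros DERIV_mult')
qed

lemma smooth_real_continuous: "smooth_real f \<Longrightarrow> continuous_on UNIV f"
  using smooth_real_deriv by (metis DERIV_isCont continuous_at_imp_continuous_on)

definition prodfun :: "nat \<Rightarrow> (nat \<Rightarrow> real \<Rightarrow> real) \<Rightarrow> (nat \<Rightarrow> real) \<Rightarrow> real" where
  "prodfun N h x = (\<Prod>i<N. h i (x i))"

lemma prodfun_upd:
  assumes "j < N"
  shows "prodfun N h (x(j := t)) = h j t * (\<Prod>i\<in>{..<N} - {j}. h i (x i))"
  unfolding prodfun_def using assms by (subst prod.remove[of _ j]) auto

lemma pdiff_prodfun:
  assumes j: "j < N" and h: "\<And>t. (h j has_real_derivative h' t) (at t)"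
  shows "pdiff j (prodfun N h) = prodfun N (h(j := h'))"
proof
  fix x
  have "((\<lambda>t. prodfun N h (x(j := t))) has_real_derivative h' (x j) * (\<Prod>i\<in>{..<N} - {j}. h i (x i))) (at (x j))"
    unfolding prodfun_upd[OF j] by (rule DERIV_cmult_right[OF h])
  then have "pdiff j (prodfun N h) x = h' (x j) * (\<Prod>i\<in>{..<N} - {j}. h i (x i))"
    unfolding pdiff_def by (rule DERIV_imp_deriv)
  also have "\<dots> = prodfun N (h(j := h')) (x(j := x j))"
    unfolding prodfun_upd[OF j] by simp
  finally show "pdiff j (prodfun N h) x = prodfun N (h(j := h')) x" by simp
qed

lemma smooth_prodfun:
  assumes "\<And>i. i < N \<Longrightarrow> smooth_real (h i)"
  shows "smooth N (prodfun N h)"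
proof -
  have fold: "\<exists>h2. (\<forall>i<N. smooth_real (h2 i)) \<and> fold pdiff is (prodfun N h) = prodfun N h2"
    if "set is \<subseteq> {..<N}" "\<forall>i<N. smooth_real (h i)" for "is" h
    using that
  proof (induction "is" arbitrary: h)
    case (Cons j js)
    then have j: "j < N" by simp
    then obtain h' where h': "smooth_real h'" "\<And>t. (h j has_real_derivative h' t) (at t)"
      using smooth_real_deriv Cons.prems by blast
    have S: "\<forall>i<N. smooth_real ((h(j := h')) i)" using h' Cons.prems by auto
    have "set js \<subseteq> {..<N}" using Cons.prems by simp
    from Cons.IH[OF this S] obtain h2 where h2: "\<forall>i<N. smooth_real (h2 i)" "fold pdiff js (prodfun N (h(j := h'))) = prodfun N h2"
      by blast
    have "pdiff j (prodfun N h) = prodfun N (h(j := h'))" by (rule pdiff_prodfun[where h=h, OF j h'(2)])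
    then have "fold pdiff (j # js) (prodfun N h) = prodfun N h2" by (simp only: fold_simps h2(2))
    with h2(1) show ?case by blast
  qed auto
  show ?thesis
    unfolding smooth_def
  proof (intro allI impI)
    fix js assume "set js \<subseteq> {..<N}"
    then obtain h2 where h2: "\<forall>i<N. smooth_real (h2 i)" "fold pdiff js (prodfun N h) = prodfun N h2"
      using fold[of js h] assms by blast
    have "continuous_map (RN N) euclideanreal (\<lambda>x. h2 i (x i))" if "i < N" for i
    proof -
      have "continuous_map euclideanreal euclideanreal (h2 i)" using h2 that smooth_real_continuous by simp
      from continuous_map_compose[OF continuous_map_component[OF that] this] show ?thesis by (simp add: o_def)
    qed
    then have "continuous_map (RN N) euclideanreal (prodfun N h2)"
      unfolding prodfun_def[abs_def] by (intro continuous_map_prod) auto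
    moreover have "(\<lambda>t. prodfun N h2 (x(i := t))) differentiable (at (x i))" if "i < N" for x i
    proof -
      have "smooth_real (h2 i)" using h2(1) that by blast
      from smooth_real_deriv[OF this] obtain h' where h': "\<And>t. (h2 i has_real_derivative h' t) (at t)" by blast
      have "((\<lambda>t. prodfun N h2 (x(i := t))) has_real_derivative h' (x i) * (\<Prod>j\<in>{..<N} - {i}. h2 j (x j))) (at (x i))"
        unfolding prodfun_upd[OF that] by (rule DERIV_cmult_right[OF h'])
      then show ?thesis using real_differentiable_def by blast
    qed
    ultimately show "continuous_map (RN N) euclideanreal (fold pdiff js (prodfun N h)) \<and>
        (\<forall>x\<in>topspace (RN N). \<forall>i<N. (\<lambda>t. fold pdiff js (prodfun N h) (x(i := t))) differentiable (at (x i)))"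
      unfolding h2(2) by blast
  qed
qed

text \<open>
  The factor \<open>n + 1\<close> amounts to the power \<open>1 / (n + 1)\<close> of the bump for \<open>n = 0\<close>. Therefore the bumps
  converge to the indicator function of \<open>(a, b)\<close>, and they are bounded by \<open>1\<close>.
\<close>

definition bump :: "real \<Rightarrow> real \<Rightarrow> nat \<Rightarrow> real \<Rightarrow> real" where
  "bump a b n t = flat_exp 1 (real (Suc n) * (t - a)) * flat_exp 1 (real (Suc n) * (b - t))"

lemma smooth_real_bump: "smooth_real (bump a b n)"
proof -
  have "bump a b n = (\<lambda>t. flat_exp 1 (real (Suc n) * t + (- real (Suc n) * a)) * flat_exp 1 ((- real (Suc n)) * t + real (Suc n) * b))"
    by (auto simp: bump_def algebra_simps)
  then show ?thesis by (auto intro!: smooth_real.intros)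
qed

lemma flat_exp_1_bounds: "0 \<le> flat_exp 1 t" "flat_exp 1 t \<le> 1"
  by (auto simp: flat_exp_def)

lemma bump_bounds: "0 \<le> bump a b n t" "bump a b n t \<le> 1"
  unfolding bump_def using flat_exp_1_bounds by (auto intro: mult_le_one)

lemma bump_zero: "t \<notin> {a<..<b} \<Longrightarrow> bump a b n t = 0"
  by (auto simp: bump_def flat_exp_def zero_less_mult_iff)

lemma bump_limit: "(\<lambda>n. bump a b n t) \<longlonglongrightarrow> indicator {a<..<b} t"
proof (cases "t \<in> {a<..<b}")
  case True
  have "(\<lambda>n. flat_exp 1 (real (Suc n) * c)) \<longlonglongrightarrow> 1" if "c > 0" for c
  proof -
    have "(\<lambda>n. exp (- ((1 / c) * (1 / real (Suc n))))) \<longlonglongrightarrow> exp (- ((1 / c) * 0))"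
      using LIMSEQ_inverse_real_of_nat
      by (intro tendsto_exp tendsto_minus tendsto_mult_left) (simp add: inverse_eq_divide)
    then show ?thesis using that by (simp add: flat_exp_def mult.commute)
  qed
  then have "(\<lambda>n. flat_exp 1 (real (Suc n) * (t - a)) * flat_exp 1 (real (Suc n) * (b - t))) \<longlonglongrightarrow> 1 * 1"
    using True by (intro tendsto_mult) auto
  then show ?thesis using True by (simp add: bump_def)
next
  case False
  then show ?thesis by (simp add: bump_zero)
qed

lemma sets_LN_boxes:
  "sets (LN N) = sigma_sets ({..<N} \<rightarrow>\<^sub>E UNIV) {Pi\<^sub>E {..<N} (\<lambda>i. {a i<..<b i}) | a b. True}"
proof -
  let ?E = "range (\<lambda>(a, b). {a<..<b}) :: real set set"
  let ?P = "{{f \<in> Pi\<^sub>E {..<N} (\<lambda>_. UNIV). \<forall>i\<in>j. f i \<in> A i} | A j. j \<in> {{..<N}} \<and> A \<in> Pi j (\<lambda>_. ?E)}"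
  have cover: "\<exists>S\<subseteq>?E. countable S \<and> UNIV = \<Union>S"
  proof (intro exI conjI)
    show "(\<lambda>n::nat. {- real n<..<real n}) ` UNIV \<subseteq> ?E" by auto
    show "UNIV = (\<Union>n::nat. {- real n<..<real n})"
    proof (intro equalityI subsetI)
      fix x :: real
      obtain n :: nat where "\<bar>x\<bar> < real n" using reals_Archimedean2 by blast
      then show "x \<in> (\<Union>n::nat. {- real n<..<real n})" by (intro UN_I[of n]) auto
    qed auto
  qed auto
  have "sets (Pi\<^sub>M {..<N} (\<lambda>_. sigma UNIV ?E)) = sets (sigma (Pi\<^sub>E {..<N} (\<lambda>_. UNIV)) ?P)"
    by (rule sets_PiM_sigma) (use cover in auto)
  moreover have "sets (LN N) = sets (Pi\<^sub>M {..<N} (\<lambda>_. sigma UNIV ?E))"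
    using borel_eq_box[where 'a=real] by (intro sets_PiM_cong) (auto simp: box_real)
  moreover have "?P = {Pi\<^sub>E {..<N} (\<lambda>i. {a i<..<b i}) | a b. True}"
  proof (intro equalityI subsetI)
    fix S assume "S \<in> ?P"
    then obtain A where A: "S = {f \<in> Pi\<^sub>E {..<N} (\<lambda>_. UNIV). \<forall>i\<in>{..<N}. f i \<in> A i}" "\<forall>i<N. A i \<in> ?E"
      by (auto simp: Pi_iff)
    have "\<exists>a b. A i = {a<..<b}" if "i \<in> {..<N}" for i
    proof -
      have "A i \<in> ?E" using A(2) that by simp
      then obtain v :: "real \<times> real" where "A i = (case v of (a, b) \<Rightarrow> {a<..<b})" by (rule rangeE)
      then show ?thesis by (cases v) auto
    qed
    then have "\<forall>i\<in>{..<N}. \<exists>a b. A i = {a<..<b}" by blast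
    then obtain a b where ab: "\<forall>i\<in>{..<N}. A i = {a i<..<b i}" by metis
    have "S = Pi\<^sub>E {..<N} (\<lambda>i. {a i<..<b i})" unfolding A(1) using ab by (auto simp: PiE_def)
    then show "S \<in> {Pi\<^sub>E {..<N} (\<lambda>i. {a i<..<b i}) | a b. True}" by blast
  next
    fix S :: "(nat \<Rightarrow> real) set" assume "S \<in> {Pi\<^sub>E {..<N} (\<lambda>i. {a i<..<b i}) | a b. True}"
    then obtain a b where ab: "S = Pi\<^sub>E {..<N} (\<lambda>i. {a i<..<b i})" by blast
    then have "S = {f \<in> Pi\<^sub>E {..<N} (\<lambda>_. UNIV). \<forall>i\<in>{..<N}. f i \<in> {a i<..<b i}}" by (auto simp: PiE_def)
    then show "S \<in> ?P" by (intro CollectI exI[of _ "\<lambda>i. {a i<..<b i}"] exI[of _ "{..<N}"]) auto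
  qed
  ultimately have "sets (LN N) = sets (sigma ({..<N} \<rightarrow>\<^sub>E UNIV) {Pi\<^sub>E {..<N} (\<lambda>i. {a i<..<b i}) | a b. True})" by simp
  also have "\<dots> = sigma_sets ({..<N} \<rightarrow>\<^sub>E UNIV) {Pi\<^sub>E {..<N} (\<lambda>i. {a i<..<b i}) | a b. True}"
    by (rule sets_measure_of) (auto simp: PiE_def)
  finally show ?thesis .
qed

definition open_box :: "nat \<Rightarrow> (nat \<Rightarrow> real) \<Rightarrow> (nat \<Rightarrow> real) \<Rightarrow> (nat \<Rightarrow> real) set" where
  "open_box N a b = Pi\<^sub>E {..<N} (\<lambda>i. {a i<..<b i})"

definition closed_box :: "nat \<Rightarrow> (nat \<Rightarrow> real) \<Rightarrow> (nat \<Rightarrow> real) \<Rightarrow> (nat \<Rightarrow> real) set" where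
  "closed_box N a b = Pi\<^sub>E {..<N} (\<lambda>i. {a i..b i})"

definition box_bump :: "nat \<Rightarrow> (nat \<Rightarrow> real) \<Rightarrow> (nat \<Rightarrow> real) \<Rightarrow> nat \<Rightarrow> (nat \<Rightarrow> real) \<Rightarrow> real" where
  "box_bump N a b n = prodfun N (\<lambda>i. bump (a i) (b i) n)"

lemma compactin_closed_box: "compactin (RN N) (closed_box N a b)"
  unfolding closed_box_def by (simp add: compactin_PiE)

lemma open_box_subset: "open_box N a b \<subseteq> closed_box N a b"
  unfolding open_box_def closed_box_def by (intro PiE_mono) auto

lemma sets_open_box [measurable]: "open_box N a b \<in> sets (LN N)"
  unfolding open_box_def by (intro sets_PiM_I_finite) auto

lemma sets_leb: "A \<in> sets (LN N) \<Longrightarrow> A \<in> sets (leb N)"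
  unfolding leb_def by (rule sets_completionI_sets)

lemma box_bump_zero:
  assumes "x \<in> space (LN N)" "x \<notin> closed_box N a b"
  shows "box_bump N a b n x = 0"
proof -
  obtain i where "i < N" "x i \<notin> {a i..b i}" 
    using assms by (auto simp: closed_box_def space_LN PiE_def Pi_iff)
  then have "i \<in> {..<N}" "bump (a i) (b i) n (x i) = 0" by (auto intro!: bump_zero)
  then show ?thesis unfolding box_bump_def prodfun_def by (intro prod_zero) blast+
qed

lemma box_bump_bounds: "0 \<le> box_bump N a b n x" "box_bump N a b n x \<le> 1"
  unfolding box_bump_def prodfun_def by (intro prod_nonneg prod_le_1 conjI ballI bump_bounds)+

lemma box_bump_limit:
  assumes "x \<in> space (LN N)"
  shows "(\<lambda>n. box_bump N a b n x) \<longlonglongrightarrow> indicator (open_box N a b) x"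
proof -
  have "(\<lambda>n. \<Prod>i<N. bump (a i) (b i) n (x i)) \<longlonglongrightarrow> (\<Prod>i<N. indicator {a i<..<b i} (x i))"
    by (intro tendsto_prod bump_limit)
  also have "(\<Prod>i<N. indicator {a i<..<b i} (x i)) = (indicator (open_box N a b) x :: real)"
  proof (cases "x \<in> open_box N a b")
    case True
    then have "x i \<in> {a i<..<b i}" if "i < N" for i
      using that unfolding open_box_def by (blast dest: PiE_mem)
    then have "(\<Prod>i<N. indicator {a i<..<b i} (x i)) = (1::real)" by (intro prod.neutral) simp
    then show ?thesis using True by simp
  next
    case False
    then obtain i where "i < N" "x i \<notin> {a i<..<b i}" 
      using assms by (auto simp: open_box_def space_LN PiE_def Pi_iff)
    then have "(\<Prod>i<N. indicator {a i<..<b i} (x i)) = (0::real)"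
      by (intro prod_zero bexI[of _ i]) auto
    then show ?thesis using False by simp
  qed
  finally show ?thesis by (simp add: box_bump_def prodfun_def)
qed

lemma smooth_box_bump: "smooth N (box_bump N a b n)"
  unfolding box_bump_def by (intro smooth_prodfun smooth_real_bump)

lemma measurable_box_bump [measurable]: "box_bump N a b n \<in> borel_measurable (LN N)"
  by (intro measurable_LN_continuous_map smooth_continuous smooth_box_bump)

lemma box_bump_test_function:
  assumes "closed_box N a b \<subseteq> \<Omega>"
  shows "box_bump N a b n \<in> test_functions N \<Omega>"
  unfolding test_functions_def
  using assms compactin_closed_box[of N a b] box_bump_zero[of _ N a b n] smooth_box_bump[of N a b n]
  by (auto simp: topspace_RN space_LN intro!: exI[of _ "closed_box N a b"])

lemma box_bump_localise:
  assumes "closed_box N a b \<subseteq> \<Omega>" "x \<in> space (leb N)"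
  shows "indicator \<Omega> x *\<^sub>R (f x * box_bump N a b n x) = box_bump N a b n x * (indicator (closed_box N a b) x *\<^sub>R f x)"
  using assms box_bump_zero[of x N a b n] by (cases "x \<in> closed_box N a b") (auto simp: indicator_def space_leb space_LN)

lemma integrable_box_bump:
  assumes f: "f \<in> L1_loc N \<Omega>" and K: "closed_box N a b \<subseteq> \<Omega>"
  shows "set_integrable (leb N) \<Omega> (\<lambda>x. f x * box_bump N a b n x)"
proof -
  have i: "integrable (leb N) (\<lambda>x. indicator (closed_box N a b) x *\<^sub>R f x)"
    using f K compactin_closed_box[of N a b] by (auto simp: L1_loc_def set_integrable_def)
  have "integrable (leb N) (\<lambda>x. box_bump N a b n x * (indicator (closed_box N a b) x *\<^sub>R f x))"
  proof (rule Bochner_Integration.integrable_bound[OF i])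
    show "(\<lambda>x. box_bump N a b n x * (indicator (closed_box N a b) x *\<^sub>R f x)) \<in> borel_measurable (leb N)"
      using borel_measurable_integrable[OF i] measurable_leb[OF measurable_box_bump] by (intro borel_measurable_times)
    show "AE x in leb N. norm (box_bump N a b n x * (indicator (closed_box N a b) x *\<^sub>R f x)) \<le> norm (indicator (closed_box N a b) x *\<^sub>R f x)"
    proof (rule AE_I2)
      fix x
      have "\<bar>box_bump N a b n x\<bar> \<le> 1" using box_bump_bounds[of N a b n x] by auto
      then show "norm (box_bump N a b n x * (indicator (closed_box N a b) x *\<^sub>R f x)) \<le> norm (indicator (closed_box N a b) x *\<^sub>R f x)"
        using mult_right_mono[of "\<bar>box_bump N a b n x\<bar>" 1 "\<bar>indicator (closed_box N a b) x *\<^sub>R f x\<bar>"] by (simp add: abs_mult)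
    qed
  qed
  then show ?thesis unfolding set_integrable_def
    by (subst Bochner_Integration.integrable_cong[OF refl box_bump_localise[OF K]])
qed

lemma integral_open_box_zero:
  assumes f: "f \<in> L1_loc N \<Omega>" and K: "closed_box N a b \<subseteq> \<Omega>" 
    and zero: "\<And>n. (LINT x:\<Omega>|leb N. f x * box_bump N a b n x) = 0"
  shows "(LINT x:open_box N a b|leb N. f x) = 0"
proof -
  define g where "g x = indicator (closed_box N a b) x *\<^sub>R f x" for x
  have i: "integrable (leb N) g"
    using f K compactin_closed_box[of N a b] unfolding g_def by (auto simp: L1_loc_def set_integrable_def)
  have gm [measurable]: "g \<in> borel_measurable (leb N)" using i by (rule borel_measurable_integrable)
  have bm [measurable]: "box_bump N a b n \<in> borel_measurable (leb N)" for n by (rule measurable_leb[OF measurable_box_bump])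
  have om [measurable]: "open_box N a b \<in> sets (leb N)" by (rule sets_leb[OF sets_open_box])
  have "(\<lambda>n. \<integral>x. box_bump N a b n x * g x \<partial>leb N) \<longlonglongrightarrow> (\<integral>x. indicator (open_box N a b) x * g x \<partial>leb N)"
  proof (rule integral_dominated_convergence[where w="\<lambda>x. \<bar>g x\<bar>"])
    show "integrable (leb N) (\<lambda>x. \<bar>g x\<bar>)" using i by (rule integrable_abs)
    show "AE x in leb N. (\<lambda>n. box_bump N a b n x * g x) \<longlonglongrightarrow> indicator (open_box N a b) x * g x"
      by (intro AE_I2 tendsto_mult_right box_bump_limit) (simp add: space_leb space_LN)
    show "AE x in leb N. norm (box_bump N a b n x * g x) \<le> \<bar>g x\<bar>" for n
    proof (rule AE_I2)
      fix x
      have "\<bar>box_bump N a b n x\<bar> \<le> 1" using box_bump_bounds[of N a b n x] by auto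
      then show "norm (box_bump N a b n x * g x) \<le> \<bar>g x\<bar>"
        using mult_right_mono[of "\<bar>box_bump N a b n x\<bar>" 1 "\<bar>g x\<bar>"] by (simp add: abs_mult)
    qed
  qed measurable
  moreover have "(\<integral>x. box_bump N a b n x * g x \<partial>leb N) = 0" for n
    using zero[of n] unfolding set_lebesgue_integral_def g_def
    by (subst (asm) Bochner_Integration.integral_cong[OF refl box_bump_localise[OF K]])
  ultimately have "(\<lambda>n. 0) \<longlonglongrightarrow> (\<integral>x. indicator (open_box N a b) x * g x \<partial>leb N)" by (simp only:)
  then have "(\<integral>x. indicator (open_box N a b) x * g x \<partial>leb N) = 0"
    by (rule LIMSEQ_unique[OF _ tendsto_const])
  moreover have "indicator (open_box N a b) x * g x = indicator (open_box N a b) x *\<^sub>R f x" for x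
    using open_box_subset[of N a b] by (auto simp: g_def indicator_def)
  ultimately show ?thesis by (simp add: set_lebesgue_integral_def)
qed

lemma open_box_Int: "open_box N a b \<inter> open_box N c d = open_box N (\<lambda>i. max (a i) (c i)) (\<lambda>i. min (b i) (d i))"
  by (auto simp: open_box_def PiE_def Pi_iff)

lemma enn2real_inject: "a \<noteq> \<infinity> \<Longrightarrow> b \<noteq> \<infinity> \<Longrightarrow> enn2real a = enn2real b \<Longrightarrow> a = b"
  by (cases a; cases b) auto

text \<open>
  The measures with the positive and the negative part of \<open>h\<close> as densities are finite and agree on
  the open boxes, which are closed under intersection and generate the measurable sets.
\<close>

lemma zero_of_zero_boxes:
  fixes h :: "(nat \<Rightarrow> real) \<Rightarrow> real"
  assumes h: "integrable (LN N) h" and zero: "\<And>a b. (\<integral>x. indicator (open_box N a b) x * h x \<partial>LN N) = 0"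
  shows "AE x in LN N. h x = 0"
proof -
  have [measurable]: "h \<in> borel_measurable (LN N)" using h by (rule borel_measurable_integrable)
  interpret sigma_finite_measure "LN N" by (rule sigma_finite_LN)
  have fin: "(\<integral>\<^sup>+x. ennreal (norm (h x)) \<partial>LN N) < \<infinity>"
    using h[unfolded integrable_iff_bounded] by blast
  have fin1: "(\<integral>\<^sup>+x. ennreal (h x) * indicator C x \<partial>LN N) \<noteq> \<infinity>" for C
  proof -
    have "(\<integral>\<^sup>+x. ennreal (h x) * indicator C x \<partial>LN N) \<le> (\<integral>\<^sup>+x. ennreal (norm (h x)) \<partial>LN N)"
      by (intro nn_integral_mono) (auto simp: indicator_def intro!: ennreal_leI)
    then show ?thesis using fin by auto
  qed
  have fin2: "(\<integral>\<^sup>+x. ennreal (- h x) * indicator C x \<partial>LN N) \<noteq> \<infinity>" for C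
  proof -
    have "(\<integral>\<^sup>+x. ennreal (- h x) * indicator C x \<partial>LN N) \<le> (\<integral>\<^sup>+x. ennreal (norm (h x)) \<partial>LN N)"
      by (intro nn_integral_mono) (auto simp: indicator_def intro!: ennreal_leI)
    then show ?thesis using fin by auto
  qed
  let ?E = "{open_box N a b | a b. True}"
  have sE: "sets (LN N) = sigma_sets ({..<N} \<rightarrow>\<^sub>E UNIV) ?E" 
    unfolding open_box_def by (rule sets_LN_boxes)
  have "density (LN N) (\<lambda>x. ennreal (h x)) = density (LN N) (\<lambda>x. ennreal (- h x))"
  proof (rule measure_eqI_generator_eq[where E="?E" and \<Omega>="{..<N} \<rightarrow>\<^sub>E UNIV" and A="\<lambda>n. open_box N (\<lambda>_. - real n) (\<lambda>_. real n)"])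
    show "Int_stable ?E" unfolding Int_stable_def using open_box_Int by blast
    show "?E \<subseteq> Pow ({..<N} \<rightarrow>\<^sub>E UNIV)" by (auto simp: open_box_def PiE_def)
    show "range (\<lambda>n. open_box N (\<lambda>_. - real n) (\<lambda>_. real n)) \<subseteq> ?E" by auto
    show "(\<Union>n. open_box N (\<lambda>_. - real n) (\<lambda>_. real n)) = {..<N} \<rightarrow>\<^sub>E UNIV"
    proof (intro equalityI subsetI)
      fix x :: "nat \<Rightarrow> real" assume x: "x \<in> {..<N} \<rightarrow>\<^sub>E UNIV"
      obtain n :: nat where n: "(\<Sum>i<N. \<bar>x i\<bar>) < real n" using reals_Archimedean2 by blast
      have "\<bar>x i\<bar> < real n" if "i < N" for i
        using member_le_sum[of i "{..<N}" "\<lambda>i. \<bar>x i\<bar>"] that n by auto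
      then have "x \<in> open_box N (\<lambda>_. - real n) (\<lambda>_. real n)"
        using x by (force simp: open_box_def PiE_def Pi_iff abs_less_iff)
      then show "x \<in> (\<Union>n. open_box N (\<lambda>_. - real n) (\<lambda>_. real n))" by blast
    qed (auto simp: open_box_def PiE_def)
    show "emeasure (density (LN N) (\<lambda>x. ennreal (h x))) (open_box N (\<lambda>_. - real n) (\<lambda>_. real n)) \<noteq> \<infinity>" for n
      using fin1 by (simp add: emeasure_density)
    fix C assume "C \<in> ?E"
    then obtain a b where C: "C = open_box N a b" by blast
    have Cm [measurable]: "C \<in> sets (LN N)" unfolding C by simp
    let ?k = "\<lambda>x. indicator C x * h x"
    have k: "integrable (LN N) ?k" using integrable_mult_indicator[OF Cm h] by simp
    have "0 = enn2real (\<integral>\<^sup>+x. ennreal (?k x) \<partial>LN N) - enn2real (\<integral>\<^sup>+x. ennreal (- ?k x) \<partial>LN N)"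
      using real_lebesgue_integral_def[OF k] zero[of a b] by (simp add: C)
    moreover have "(\<integral>\<^sup>+x. ennreal (?k x) \<partial>LN N) = (\<integral>\<^sup>+x. ennreal (h x) * indicator C x \<partial>LN N)"
      by (intro nn_integral_cong) (auto simp: indicator_def)
    moreover have "(\<integral>\<^sup>+x. ennreal (- ?k x) \<partial>LN N) = (\<integral>\<^sup>+x. ennreal (- h x) * indicator C x \<partial>LN N)"
      by (intro nn_integral_cong) (auto simp: indicator_def)
    ultimately have "enn2real (\<integral>\<^sup>+x. ennreal (h x) * indicator C x \<partial>LN N) = enn2real (\<integral>\<^sup>+x. ennreal (- h x) * indicator C x \<partial>LN N)"
      by simp
    then have "(\<integral>\<^sup>+x. ennreal (h x) * indicator C x \<partial>LN N) = (\<integral>\<^sup>+x. ennreal (- h x) * indicator C x \<partial>LN N)"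
      by (rule enn2real_inject[OF fin1 fin2])
    then show "emeasure (density (LN N) (\<lambda>x. ennreal (h x))) C = emeasure (density (LN N) (\<lambda>x. ennreal (- h x))) C"
      by (simp add: emeasure_density)
  qed (simp_all add: sE)
  then have "AE x in LN N. ennreal (h x) = ennreal (- h x)"
    by (intro density_unique) auto
  then show ?thesis
  proof eventually_elim
    case (elim x)
    then show ?case by (cases "h x \<ge> 0") (auto simp: ennreal_neg ennreal_eq_0_iff dest: sym)
  qed
qed

text \<open>
  The measurable sets of the completion are not generated by boxes. Hence \<open>f\<close> is first replaced by an
  almost everywhere equal function that is measurable with respect to the product measure.
\<close>

lemma zero_on_box:
  assumes f: "f \<in> L1_loc N \<Omega>" and K: "closed_box N a b \<subseteq> \<Omega>" 
    and zero: "\<And>a b n. closed_box N a b \<subseteq> \<Omega> \<Longrightarrow> (LINT x:\<Omega>|leb N. f x * box_bump N a b n x) = 0"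
  shows "AE x in leb N. x \<in> open_box N a b \<longrightarrow> f x = 0"
proof -
  have B [measurable]: "open_box N a b \<in> sets (leb N)" by (rule sets_leb[OF sets_open_box])
  have "integrable (leb N) (\<lambda>x. indicator (closed_box N a b) x *\<^sub>R f x)"
    using f K compactin_closed_box[of N a b] by (auto simp: L1_loc_def set_integrable_def)
  from integrable_mult_indicator[OF B this]
  have "integrable (leb N) (\<lambda>x. indicator (open_box N a b) x *\<^sub>R (indicator (closed_box N a b) x *\<^sub>R f x))" .
  moreover have "indicator (open_box N a b) x *\<^sub>R (indicator (closed_box N a b) x *\<^sub>R f x) = indicator (open_box N a b) x * f x" for x
    using open_box_subset[of N a b] by (auto simp: indicator_def)
  ultimately have g: "integrable (leb N) (\<lambda>x. indicator (open_box N a b) x * f x)" by (simp only:)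
  then obtain h where h [measurable]: "h \<in> borel_measurable (LN N)" 
    and eq: "AE x in LN N. indicator (open_box N a b) x * f x = h x"
    using completion_ex_borel_measurable_real[of "\<lambda>x. indicator (open_box N a b) x * f x" "LN N"] borel_measurable_integrable[OF g]
    unfolding leb_def by blast
  have eq': "AE x in leb N. indicator (open_box N a b) x * f x = h x"
    unfolding leb_def by (rule AE_completion[OF eq])
  have hl: "h \<in> borel_measurable (leb N)" by (rule measurable_leb[OF h])
  have "integrable (leb N) h"
    by (rule iffD1[OF integrable_cong_AE[OF borel_measurable_integrable[OF g] hl eq'] g])
  then have hi: "integrable (LN N) h" using h unfolding leb_def by (simp add: integrable_completion)
  have "AE x in LN N. h x = 0"
  proof (rule zero_of_zero_boxes[OF hi])
    fix c d
    let ?C = "open_box N c d" and ?m = "\<lambda>i. max (c i) (a i)" and ?M = "\<lambda>i. min (d i) (b i)"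
    have Cm: "?C \<in> sets (leb N)" by (rule sets_leb[OF sets_open_box])
    have "(\<integral>x. indicator ?C x * h x \<partial>LN N) = (\<integral>x. indicator ?C x * h x \<partial>leb N)"
      unfolding leb_def by (rule integral_completion[symmetric]) measurable
    also have "\<dots> = (\<integral>x. indicator ?C x * (indicator (open_box N a b) x * f x) \<partial>leb N)"
      using eq' borel_measurable_integrable[OF g] hl Cm
      by (intro integral_cong_AE) (auto elim!: eventually_mono intro!: borel_measurable_times borel_measurable_indicator)
    also have "\<dots> = (\<integral>x. indicator (?C \<inter> open_box N a b) x *\<^sub>R f x \<partial>leb N)"
      by (intro Bochner_Integration.integral_cong) (auto simp: indicator_def)
    also have "\<dots> = (LINT x:open_box N ?m ?M|leb N. f x)"
      unfolding open_box_Int by (simp add: set_lebesgue_integral_def)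
    also have "\<dots> = 0"
    proof -
      have "closed_box N ?m ?M \<subseteq> closed_box N a b" unfolding closed_box_def by (intro PiE_mono) auto
      then have "closed_box N ?m ?M \<subseteq> \<Omega>" using K by blast
      then show ?thesis using integral_open_box_zero[OF f] zero by blast
    qed
    finally show "(\<integral>x. indicator ?C x * h x \<partial>LN N) = 0" .
  qed
  then have "AE x in leb N. h x = 0" unfolding leb_def by (rule AE_completion)
  with eq' show ?thesis by eventually_elim (auto simp: indicator_def split: if_splits)
qed

context convex_domain begin

lemma rational_box:
  assumes x: "x \<in> \<Omega>"
  shows "\<exists>a\<in>{..<N} \<rightarrow>\<^sub>E \<rat>. \<exists>b\<in>{..<N} \<rightarrow>\<^sub>E \<rat>. x \<in> open_box N a b \<and> closed_box N a b \<subseteq> \<Omega>"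
proof -
  define e where "e = bdry_dist N \<Omega> x / (real N + 1)"
  have e: "0 < e" using bdry_dist_pos[OF x] by (simp add: e_def)
  have "\<exists>q\<in>\<rat>. x i - e < q \<and> q < x i" "\<exists>q\<in>\<rat>. x i < q \<and> q < x i + e" for i
    using Rats_dense_in_real[of "x i - e" "x i"] Rats_dense_in_real[of "x i" "x i + e"] e by auto
  then obtain a b where a: "\<And>i. a i \<in> \<rat> \<and> x i - e < a i \<and> a i < x i" and b: "\<And>i. b i \<in> \<rat> \<and> x i < b i \<and> b i < x i + e"
    by metis
  let ?a = "restrict a {..<N}" and ?b = "restrict b {..<N}"
  have "closed_box N ?a ?b \<subseteq> \<Omega>"
  proof
    fix q assume q: "q \<in> closed_box N ?a ?b"
    then have qs: "q \<in> space (LN N)" by (auto simp: closed_box_def space_LN PiE_def)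
    have qi: "a i \<le> q i" "q i \<le> b i" if "i < N" for i using q that by (auto simp: closed_box_def PiE_def Pi_iff)
    have "edist N x q \<le> (\<Sum>i<N. \<bar>x i - q i\<bar>)" unfolding edist_def by (rule L2_set_le_sum_abs)
    also have "\<dots> \<le> (\<Sum>i<N. e)"
    proof (rule sum_mono)
      fix i assume "i \<in> {..<N}"
      then have "a i \<le> q i" "q i \<le> b i" using qi by auto
      then show "\<bar>x i - q i\<bar> \<le> e" using a[of i] b[of i] by linarith
    qed
    also have "\<dots> = real N * e" by simp
    also have "\<dots> < (real N + 1) * e" using e by simp
    also have "\<dots> = bdry_dist N \<Omega> x" by (simp add: e_def)
    finally show "q \<in> \<Omega>" by (rule ball_subset_domain[OF x qs])
  qed
  moreover have "x \<in> open_box N ?a ?b" using a b domain_space[OF x] by (auto simp: open_box_def space_LN PiE_def)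
  moreover have "?a \<in> {..<N} \<rightarrow>\<^sub>E \<rat>" "?b \<in> {..<N} \<rightarrow>\<^sub>E \<rat>" using a b by auto
  ultimately show ?thesis by blast
qed

lemma zero_on_domain:
  assumes f: "f \<in> L1_loc N \<Omega>" 
    and zero: "\<And>a b n. closed_box N a b \<subseteq> \<Omega> \<Longrightarrow> (LINT x:\<Omega>|leb N. f x * box_bump N a b n x) = 0"
  shows "AE x in leb N. x \<in> \<Omega> \<longrightarrow> f x = 0"
proof -
  let ?Q = "({..<N} \<rightarrow>\<^sub>E \<rat>) :: (nat \<Rightarrow> real) set"
  let ?I = "{(a, b). a \<in> ?Q \<and> b \<in> ?Q \<and> closed_box N a b \<subseteq> \<Omega>}"
  have "countable ?Q" by (intro countable_PiE) (auto simp: countable_rat)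
  then have "countable (?Q \<times> ?Q)" by auto
  then have "countable ?I" by (rule countable_subset[rotated]) auto
  moreover have "AE x in leb N. x \<in> open_box N (fst w) (snd w) \<longrightarrow> f x = 0" if "w \<in> ?I" for w
    using that by (intro zero_on_box[OF f _ zero]) auto
  ultimately have "AE x in leb N. \<forall>w\<in>?I. x \<in> open_box N (fst w) (snd w) \<longrightarrow> f x = 0"
    by (intro AE_ball_countable[THEN iffD2]) auto
  then show ?thesis
  proof eventually_elim
    case (elim x)
    show ?case
    proof
      assume "x \<in> \<Omega>"
      then obtain a b where "a \<in> ?Q" "b \<in> ?Q" "x \<in> open_box N a b" "closed_box N a b \<subseteq> \<Omega>" using rational_box by blast
      then show "f x = 0" using elim[rule_format, of "(a, b)"] by auto
    qed
  qed
qed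

lemma weak_gradient_unique:
  assumes G: "weak_gradient N \<Omega> u G" and H: "weak_gradient N \<Omega> u H"
  shows "AE x in leb N. x \<in> \<Omega> \<longrightarrow> (\<forall>i<N. G i x = H i x)"
proof -
  have "AE x in leb N. x \<in> \<Omega> \<longrightarrow> G i x - H i x = 0" if i: "i < N" for i
  proof (rule zero_on_domain)
    have L: "G i \<in> L1_loc N \<Omega>" "H i \<in> L1_loc N \<Omega>" using G H i by (auto simp: weak_gradient_def)
    then show "(\<lambda>x. G i x - H i x) \<in> L1_loc N \<Omega>"
      unfolding L1_loc_def by (auto intro: set_integral_diff(1))
    fix a b n assume K: "closed_box N a b \<subseteq> \<Omega>"
    let ?b = "box_bump N a b n"
    have "(LINT x:\<Omega>|leb N. G i x * ?b x) = (LINT x:\<Omega>|leb N. H i x * ?b x)"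
      using G H i box_bump_test_function[OF K, of n] unfolding weak_gradient_def by (metis neg_equal_iff_equal)
    moreover have "(LINT x:\<Omega>|leb N. (G i x - H i x) * ?b x) = (LINT x:\<Omega>|leb N. G i x * ?b x) - (LINT x:\<Omega>|leb N. H i x * ?b x)"
      by (simp only: left_diff_distrib) (rule set_integral_diff(2)[OF integrable_box_bump[OF L(1) K] integrable_box_bump[OF L(2) K]])
    ultimately show "(LINT x:\<Omega>|leb N. (G i x - H i x) * ?b x) = 0" by simp
  qed
  then have "AE x in leb N. \<forall>i\<in>{..<N}. x \<in> \<Omega> \<longrightarrow> G i x - H i x = 0"
    by (intro AE_finite_allI) auto
  then show ?thesis by eventually_elim auto
qed

end

section \<open>Passage to the Sobolev space and the theorem\<close>

text \<open>
  Convexity at \<open>a + b = c (a / c) + (1 - c) (b / (1 - c))\<close>. The first factor tends to \<open>1\<close> as \<open>c\<close> does, while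
  the second one will multiply quantities that tend to \<open>0\<close>.
\<close>

lemma powr_add_le:
  fixes a b c p :: real
  assumes p: "1 < p" and c: "0 < c" "c < 1" and ab: "0 \<le> a" "0 \<le> b"
  shows "(a + b) powr p \<le> c powr (1 - p) * a powr p + (1 - c) powr (1 - p) * b powr p"
proof -
  have ge1: "1 \<le> c powr (1 - p)" "1 \<le> (1 - c) powr (1 - p)"
    using c p powr_mono'[of "1 - p" 0 c] powr_mono'[of "1 - p" 0 "1 - c"] by auto
  show ?thesis
  proof (cases "a = 0 \<or> b = 0")
    case True
    then show ?thesis
      using ge1 mult_right_mono[OF ge1(1), of "a powr p"] mult_right_mono[OF ge1(2), of "b powr p"] p by auto
  next
    case False
    then have ab': "0 < a" "0 < b" using ab by auto
    have "((1 - (1 - c)) *\<^sub>R (a / c) + (1 - c) *\<^sub>R (b / (1 - c))) powr p \<le> 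
      (1 - (1 - c)) * (a / c) powr p + (1 - c) * (b / (1 - c)) powr p"
      using p c ab' by (intro convex_onD[OF powr_convex]) auto
    moreover have "(1 - (1 - c)) *\<^sub>R (a / c) + (1 - c) *\<^sub>R (b / (1 - c)) = a + b" using c by simp
    moreover have "(1 - (1 - c)) * (a / c) powr p = c powr (1 - p) * a powr p"
      using c ab by (simp add: powr_divide powr_diff)
    moreover have "(1 - c) * (b / (1 - c)) powr p = (1 - c) powr (1 - p) * b powr p"
      using c ab by (simp add: powr_divide powr_diff)
    ultimately show ?thesis by simp
  qed
qed

lemma L2_set_powr_le:
  fixes w :: "nat \<Rightarrow> real"
  assumes p: "1 < p"
  shows "L2_set w {..<N} powr p \<le> real N powr p * (\<Sum>i<N. \<bar>w i\<bar> powr p)"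
proof (cases "N = 0")
  case False
  define m where "m = Max ((\<lambda>i. \<bar>w i\<bar>) ` {..<N})"
  have "m \<in> (\<lambda>i. \<bar>w i\<bar>) ` {..<N}" unfolding m_def using False by (intro Max_in) auto
  then obtain j where j: "j < N" "m = \<bar>w j\<bar>" by auto
  have "\<bar>w i\<bar> \<le> m" if "i < N" for i unfolding m_def using that by (intro Max_ge) auto
  then have "(\<Sum>i<N. \<bar>w i\<bar>) \<le> (\<Sum>i<N. m)" by (intro sum_mono) auto
  then have "L2_set w {..<N} \<le> real N * m" using L2_set_le_sum_abs[of w "{..<N}"] by simp
  then have "L2_set w {..<N} powr p \<le> (real N * m) powr p" using p by (intro powr_mono2) auto
  also have "\<dots> = real N powr p * m powr p" using j by (simp add: powr_mult)
  also have "m powr p \<le> (\<Sum>i<N. \<bar>w i\<bar> powr p)"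
    unfolding j(2) using j(1) by (intro member_le_sum[of j "{..<N}" "\<lambda>i. \<bar>w i\<bar> powr p"]) auto
  then have "real N powr p * m powr p \<le> real N powr p * (\<Sum>i<N. \<bar>w i\<bar> powr p)" by (intro mult_left_mono) auto
  finally show ?thesis .
qed simp

lemma le_of_factors_tendsto_1:
  fixes A I :: ennreal
  assumes "\<And>m. A \<le> ennreal (c m) * I" and "c \<longlonglongrightarrow> 1"
  shows "A \<le> I"
proof (cases I)
  case (real r)
  have "A \<le> ennreal (c m * r)" for m
    using assms(1)[of m] real by (simp add: ennreal_mult'')
  moreover have "(\<lambda>m. ennreal (c m * r)) \<longlonglongrightarrow> ennreal (1 * r)"
    by (intro tendsto_ennrealI tendsto_mult_right assms)
  ultimately have "A \<le> ennreal (1 * r)" by (intro LIMSEQ_le_const) auto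
  then show ?thesis using real by simp
qed simp

context convex_domain begin

text \<open>
  The test function \<open>\<phi>\<close> is close to \<open>u\<close> without any weight only, and the weight is unbounded near the
  boundary; hence the truncation at \<open>M\<close>.
\<close>

lemma truncated_hardy_W1p0:
  fixes u :: "(nat \<Rightarrow> real) \<Rightarrow> real" and M :: nat
  assumes p: "1 < p" and adm: "admissible k p (ediam N \<Omega> / (2 * D))" and D: "0 < D" and c: "0 < c" "c < 1"
    and phi: "\<phi> \<in> test_functions N \<Omega>"
    and um: "set_borel_measurable (leb N) \<Omega> u" and Gm: "\<And>i. i < N \<Longrightarrow> set_borel_measurable (leb N) \<Omega> (G i)"
  shows "(\<integral>\<^sup>+x\<in>\<Omega>. ennreal (min (total_weight k p D x) (real M) * \<bar>u x\<bar> powr p) \<partial>leb N) \<le>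
    ennreal ((c powr (1 - p))\<^sup>2) * (\<integral>\<^sup>+x\<in>\<Omega>. ennreal (L2_set (\<lambda>i. G i x) {..<N} powr p) \<partial>leb N) +
    ennreal (c powr (1 - p) * (1 - c) powr (1 - p) * real N powr p + (1 - c) powr (1 - p) * real M) *
      ((\<integral>\<^sup>+x\<in>\<Omega>. ennreal (\<bar>\<phi> x - u x\<bar> powr p) \<partial>leb N) + (\<Sum>i<N. \<integral>\<^sup>+x\<in>\<Omega>. ennreal (\<bar>pdiff i \<phi> x - G i x\<bar> powr p) \<partial>leb N))"
proof -
  define c1 c2 where "c1 = c powr (1 - p)" and "c2 = (1 - c) powr (1 - p)"
  have c12: "0 \<le> c1" "0 \<le> c2" by (auto simp: c1_def c2_def)
  let ?V = "total_weight k p D"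
  have sm: "smooth N \<phi>" using phi by (simp add: test_functions_def)
  have Vm [measurable]: "?V \<in> borel_measurable (leb N)" by (rule measurable_leb[OF measurable_total_weight])
  have Om [measurable]: "\<Omega> \<in> sets (leb N)" by (rule sets_leb[OF sets_domain])
  have pm [measurable]: "\<phi> \<in> borel_measurable (leb N)"
    by (intro measurable_leb measurable_LN_continuous_map smooth_continuous[OF sm])
  have dm [measurable]: "pdiff i \<phi> \<in> borel_measurable (leb N)" if "i \<in> {..<N}" for i
    using that by (intro measurable_leb measurable_LN_continuous_map smooth_pdiff_continuous[OF sm]) auto
  define v where "v x = indicator \<Omega> x *\<^sub>R u x" for x
  define g where "g i x = indicator \<Omega> x *\<^sub>R G i x" for i x
  have vm [measurable]: "v \<in> borel_measurable (leb N)" using um by (simp add: set_borel_measurable_def v_def[abs_def])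
  have gm [measurable]: "g i \<in> borel_measurable (leb N)" if "i \<in> {..<N}" for i 
    using Gm that by (simp add: set_borel_measurable_def g_def[abs_def])
  have vu: "v x = u x" and gG: "g i x = G i x" if "x \<in> \<Omega>" for x i using that by (auto simp: v_def g_def)
  have L2m [measurable]: "(\<lambda>x. L2_set (\<lambda>i. h i x) {..<N}) \<in> borel_measurable (leb N)" 
    if [measurable]: "\<And>i. i \<in> {..<N} \<Longrightarrow> h i \<in> borel_measurable (leb N)" for h :: "nat \<Rightarrow> (nat \<Rightarrow> real) \<Rightarrow> real"
    unfolding L2_set_def by measurable
  define Iu where "Iu = (\<integral>\<^sup>+x\<in>\<Omega>. ennreal (\<bar>\<phi> x - u x\<bar> powr p) \<partial>leb N)"
  define Id where "Id = (\<Sum>i<N. \<integral>\<^sup>+x\<in>\<Omega>. ennreal (\<bar>pdiff i \<phi> x - G i x\<bar> powr p) \<partial>leb N)"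
  define IG where "IG = (\<integral>\<^sup>+x\<in>\<Omega>. ennreal (L2_set (\<lambda>i. G i x) {..<N} powr p) \<partial>leb N)"
  have Iu: "Iu = (\<integral>\<^sup>+x\<in>\<Omega>. ennreal (\<bar>\<phi> x - v x\<bar> powr p) \<partial>leb N)"
    unfolding Iu_def by (intro nn_integral_cong) (auto simp: indicator_def vu)
  have Id: "Id = (\<Sum>i<N. \<integral>\<^sup>+x\<in>\<Omega>. ennreal (\<bar>pdiff i \<phi> x - g i x\<bar> powr p) \<partial>leb N)"
    unfolding Id_def by (intro sum.cong nn_integral_cong) (auto simp: indicator_def gG)
  have IG: "IG = (\<integral>\<^sup>+x\<in>\<Omega>. ennreal (L2_set (\<lambda>i. g i x) {..<N} powr p) \<partial>leb N)"
    unfolding IG_def by (intro nn_integral_cong) (auto simp: indicator_def gG)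
  have grad: "(\<integral>\<^sup>+x\<in>\<Omega>. ennreal (L2_set (\<lambda>i. pdiff i \<phi> x) {..<N} powr p) \<partial>leb N) \<le> ennreal c1 * IG + ennreal (c2 * real N powr p) * Id"
  proof -
    have "(\<integral>\<^sup>+x\<in>\<Omega>. ennreal (L2_set (\<lambda>i. pdiff i \<phi> x) {..<N} powr p) \<partial>leb N) \<le> 
      (\<integral>\<^sup>+x. ennreal c1 * (ennreal (L2_set (\<lambda>i. g i x) {..<N} powr p) * indicator \<Omega> x) + 
         ennreal (c2 * real N powr p) * (\<Sum>i<N. ennreal (\<bar>pdiff i \<phi> x - g i x\<bar> powr p) * indicator \<Omega> x) \<partial>leb N)"
    proof (rule nn_integral_mono)
      fix x
      let ?a = "L2_set (\<lambda>i. g i x) {..<N}" and ?b = "L2_set (\<lambda>i. pdiff i \<phi> x - g i x) {..<N}"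
      have "L2_set (\<lambda>i. pdiff i \<phi> x) {..<N} \<le> ?a + ?b"
        using L2_set_triangle_ineq[of "\<lambda>i. g i x" "\<lambda>i. pdiff i \<phi> x - g i x" "{..<N}"] by simp
      then have "L2_set (\<lambda>i. pdiff i \<phi> x) {..<N} powr p \<le> (?a + ?b) powr p" using p by (intro powr_mono2) auto
      also have "\<dots> \<le> c1 * ?a powr p + c2 * ?b powr p"
        unfolding c1_def c2_def by (intro powr_add_le p c) auto
      also have "\<dots> \<le> c1 * ?a powr p + c2 * (real N powr p * (\<Sum>i<N. \<bar>pdiff i \<phi> x - g i x\<bar> powr p))"
        using c12 by (intro add_left_mono mult_left_mono L2_set_powr_le p) auto
      finally have "ennreal (L2_set (\<lambda>i. pdiff i \<phi> x) {..<N} powr p) \<le> 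
         ennreal (c1 * ?a powr p + c2 * real N powr p * (\<Sum>i<N. \<bar>pdiff i \<phi> x - g i x\<bar> powr p))"
        by (intro ennreal_leI) (simp add: mult.assoc)
      also have "\<dots> = ennreal c1 * ennreal (?a powr p) + ennreal (c2 * real N powr p) * (\<Sum>i<N. ennreal (\<bar>pdiff i \<phi> x - g i x\<bar> powr p))"
        using c12 by (subst ennreal_plus) (auto simp: ennreal_mult sum_nonneg sum_ennreal intro!: sum_nonneg mult_nonneg_nonneg)
      finally show "ennreal (L2_set (\<lambda>i. pdiff i \<phi> x) {..<N} powr p) * indicator \<Omega> x \<le> 
         ennreal c1 * (ennreal (?a powr p) * indicator \<Omega> x) + 
         ennreal (c2 * real N powr p) * (\<Sum>i<N. ennreal (\<bar>pdiff i \<phi> x - g i x\<bar> powr p) * indicator \<Omega> x)"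
        by (cases "x \<in> \<Omega>") auto
    qed
    also have "\<dots> = ennreal c1 * IG + ennreal (c2 * real N powr p) * Id"
      unfolding IG Id by (subst nn_integral_add, measurable, subst nn_integral_cmult, measurable, subst nn_integral_cmult, measurable, subst nn_integral_sum, measurable)
    finally show ?thesis .
  qed
  have "(\<integral>\<^sup>+x\<in>\<Omega>. ennreal (min (?V x) (real M) * \<bar>u x\<bar> powr p) \<partial>leb N) \<le> 
    (\<integral>\<^sup>+x. ennreal c1 * (ennreal (\<bar>\<phi> x\<bar> powr p * ?V x) * indicator \<Omega> x) + 
       ennreal (c2 * real M) * (ennreal (\<bar>\<phi> x - v x\<bar> powr p) * indicator \<Omega> x) \<partial>leb N)"
  proof (rule nn_integral_mono)
    fix x
    show "ennreal (min (?V x) (real M) * \<bar>u x\<bar> powr p) * indicator \<Omega> x \<le> 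
       ennreal c1 * (ennreal (\<bar>\<phi> x\<bar> powr p * ?V x) * indicator \<Omega> x) + 
       ennreal (c2 * real M) * (ennreal (\<bar>\<phi> x - v x\<bar> powr p) * indicator \<Omega> x)"
    proof (cases "x \<in> \<Omega>")
      case True
      have V: "0 \<le> min (?V x) (real M)" using total_weight_nonneg[OF p] by simp
      have "\<bar>u x\<bar> powr p \<le> (\<bar>\<phi> x\<bar> + \<bar>\<phi> x - v x\<bar>) powr p"
        using p vu[OF True] by (intro powr_mono2) auto
      also have "\<dots> \<le> c1 * \<bar>\<phi> x\<bar> powr p + c2 * \<bar>\<phi> x - v x\<bar> powr p"
        unfolding c1_def c2_def by (intro powr_add_le p c) auto
      finally have "min (?V x) (real M) * \<bar>u x\<bar> powr p \<le> min (?V x) (real M) * (c1 * \<bar>\<phi> x\<bar> powr p + c2 * \<bar>\<phi> x - v x\<bar> powr p)"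
        using V by (intro mult_left_mono) auto
      also have "\<dots> = min (?V x) (real M) * (c1 * \<bar>\<phi> x\<bar> powr p) + min (?V x) (real M) * (c2 * \<bar>\<phi> x - v x\<bar> powr p)"
        by (simp add: algebra_simps)
      also have "\<dots> \<le> ?V x * (c1 * \<bar>\<phi> x\<bar> powr p) + real M * (c2 * \<bar>\<phi> x - v x\<bar> powr p)"
        using c12 by (intro add_mono mult_right_mono) auto
      also have "\<dots> = c1 * (\<bar>\<phi> x\<bar> powr p * ?V x) + c2 * real M * \<bar>\<phi> x - v x\<bar> powr p" by (simp add: algebra_simps)
      finally have "ennreal (min (?V x) (real M) * \<bar>u x\<bar> powr p) \<le> ennreal (c1 * (\<bar>\<phi> x\<bar> powr p * ?V x) + c2 * real M * \<bar>\<phi> x - v x\<bar> powr p)"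
        by (rule ennreal_leI)
      also have "\<dots> = ennreal c1 * ennreal (\<bar>\<phi> x\<bar> powr p * ?V x) + ennreal (c2 * real M) * ennreal (\<bar>\<phi> x - v x\<bar> powr p)"
        using c12 total_weight_nonneg[OF p, of k D x] by (simp add: ennreal_mult)
      finally show ?thesis using True by simp
    qed simp
  qed
  also have "\<dots> = ennreal c1 * (\<integral>\<^sup>+x\<in>\<Omega>. ennreal (\<bar>\<phi> x\<bar> powr p * ?V x) \<partial>leb N) + ennreal (c2 * real M) * Iu"
    unfolding Iu by (subst nn_integral_add, measurable, subst nn_integral_cmult, measurable, subst nn_integral_cmult, measurable)
  also have "(\<integral>\<^sup>+x\<in>\<Omega>. ennreal (\<bar>\<phi> x\<bar> powr p * ?V x) \<partial>leb N) \<le> (\<integral>\<^sup>+x\<in>\<Omega>. ennreal (L2_set (\<lambda>i. pdiff i \<phi> x) {..<N} powr p) \<partial>leb N)"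
    unfolding nn_integral_leb by (rule hardy_test_function[OF p adm D phi])
  also note grad
  finally have "(\<integral>\<^sup>+x\<in>\<Omega>. ennreal (min (?V x) (real M) * \<bar>u x\<bar> powr p) \<partial>leb N) \<le> 
     ennreal c1 * (ennreal c1 * IG + ennreal (c2 * real N powr p) * Id) + ennreal (c2 * real M) * Iu"
    by (simp add: add_mono mult_left_mono)
  also have "\<dots> = ennreal (c1\<^sup>2) * IG + (ennreal (c1 * c2 * real N powr p) * Id + ennreal (c2 * real M) * Iu)"
  proof -
    have "ennreal c1 * ennreal c1 = ennreal (c1\<^sup>2)" "ennreal c1 * ennreal (c2 * real N powr p) = ennreal (c1 * c2 * real N powr p)"
      using c12 by (auto simp: ennreal_mult[symmetric] power2_eq_square mult.assoc)
    then show ?thesis by (simp only: distrib_left mult.assoc[symmetric] add.assoc)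
  qed
  also have "\<dots> \<le> ennreal (c1\<^sup>2) * IG + (ennreal (c1 * c2 * real N powr p + c2 * real M) * Id + ennreal (c1 * c2 * real N powr p + c2 * real M) * Iu)"
    using c12 by (intro add_left_mono add_mono mult_right_mono ennreal_leI) auto
  also have "\<dots> = ennreal (c1\<^sup>2) * IG + ennreal (c1 * c2 * real N powr p + c2 * real M) * (Iu + Id)"
    by (simp add: distrib_left add.commute)
  finally show ?thesis unfolding c1_def c2_def IG_def Iu_def Id_def .
qed

text \<open>
  In \<open>truncated_hardy_W1p0\<close> first the test functions converge to \<open>u\<close>, then \<open>c\<close> tends to \<open>1\<close>, and finally
  \<open>M\<close> tends to infinity.
\<close>

lemma hardy_W1p0:
  assumes p: "1 < p" and adm: "admissible k p (ediam N \<Omega> / (2 * D))" and D: "0 < D"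
    and u: "u \<in> W1p0 N p \<Omega>" and G: "weak_gradient N \<Omega> u G"
  shows "(\<integral>\<^sup>+x\<in>\<Omega>. ennreal (\<bar>u x\<bar> powr p * total_weight k p D x) \<partial>leb N)
     \<le> (\<integral>\<^sup>+x\<in>\<Omega>. ennreal (L2_set (\<lambda>i. G i x) {..<N} powr p) \<partial>leb N)"
proof -
  let ?V = "total_weight k p D"
  obtain G0 \<phi> where G0: "weak_gradient N \<Omega> u G0" and phi: "\<And>n. \<phi> n \<in> test_functions N \<Omega>" and
     lim: "(\<lambda>n. (\<integral>\<^sup>+x\<in>\<Omega>. ennreal (\<bar>\<phi> n x - u x\<bar> powr p) \<partial>leb N) +
             (\<Sum>i<N. \<integral>\<^sup>+x\<in>\<Omega>. ennreal (\<bar>pdiff i (\<phi> n) x - G0 i x\<bar> powr p) \<partial>leb N)) \<longlonglongrightarrow> 0"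
    using u unfolding W1p0_def by blast
  obtain H where H: "weak_gradient N \<Omega> u H" "\<And>i. i < N \<Longrightarrow> H i \<in> Lp N p \<Omega>" and uL: "u \<in> Lp N p \<Omega>"
    using u unfolding W1p0_def W1p_def by blast
  have um: "set_borel_measurable (leb N) \<Omega> u" and Hm: "\<And>i. i < N \<Longrightarrow> set_borel_measurable (leb N) \<Omega> (H i)"
    using H(2) uL by (auto simp: Lp_def)
  define I where "I = (\<integral>\<^sup>+x\<in>\<Omega>. ennreal (L2_set (\<lambda>i. H i x) {..<N} powr p) \<partial>leb N)"
  have IG: "I = (\<integral>\<^sup>+x\<in>\<Omega>. ennreal (L2_set (\<lambda>i. G i x) {..<N} powr p) \<partial>leb N)"
    unfolding I_def
  proof (rule nn_integral_cong_AE)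
    show "AE x in leb N. ennreal (L2_set (\<lambda>i. H i x) {..<N} powr p) * indicator \<Omega> x = ennreal (L2_set (\<lambda>i. G i x) {..<N} powr p) * indicator \<Omega> x"
      using weak_gradient_unique[OF H(1) G]
    proof eventually_elim
      case (elim x)
      then have "L2_set (\<lambda>i. H i x) {..<N} = L2_set (\<lambda>i. G i x) {..<N}" if "x \<in> \<Omega>" using that by (intro L2_set_cong) auto
      then show ?case by (cases "x \<in> \<Omega>") auto
    qed
  qed
  define E where "E n = (\<integral>\<^sup>+x\<in>\<Omega>. ennreal (\<bar>\<phi> n x - u x\<bar> powr p) \<partial>leb N) +
             (\<Sum>i<N. \<integral>\<^sup>+x\<in>\<Omega>. ennreal (\<bar>pdiff i (\<phi> n) x - H i x\<bar> powr p) \<partial>leb N)" for n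
  have "(\<integral>\<^sup>+x\<in>\<Omega>. ennreal (\<bar>pdiff i (\<phi> n) x - G0 i x\<bar> powr p) \<partial>leb N) = (\<integral>\<^sup>+x\<in>\<Omega>. ennreal (\<bar>pdiff i (\<phi> n) x - H i x\<bar> powr p) \<partial>leb N)"
    if "i \<in> {..<N}" for i n
  proof (rule nn_integral_cong_AE)
    show "AE x in leb N. ennreal (\<bar>pdiff i (\<phi> n) x - G0 i x\<bar> powr p) * indicator \<Omega> x = ennreal (\<bar>pdiff i (\<phi> n) x - H i x\<bar> powr p) * indicator \<Omega> x"
      using weak_gradient_unique[OF G0 H(1)] by eventually_elim (use that in \<open>auto simp: indicator_def\<close>)
  qed
  then have E0: "E \<longlonglongrightarrow> 0" using lim by (simp add: E_def[abs_def])
  have trunc: "(\<integral>\<^sup>+x\<in>\<Omega>. ennreal (min (?V x) (real M) * \<bar>u x\<bar> powr p) \<partial>leb N) \<le> I" (is "?A M \<le> I") for M :: nat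
  proof -
    have step: "?A M \<le> ennreal ((c powr (1 - p))\<^sup>2) * I" if c: "0 < c" "c < 1" for c
    proof -
      let ?C = "c powr (1 - p) * (1 - c) powr (1 - p) * real N powr p + (1 - c) powr (1 - p) * real M"
      have "?A M \<le> ennreal ((c powr (1 - p))\<^sup>2) * I + ennreal ?C * E n" for n
        unfolding I_def E_def by (rule truncated_hardy_W1p0[OF p adm D c phi um Hm])
      moreover have "(\<lambda>n. ennreal ((c powr (1 - p))\<^sup>2) * I + ennreal ?C * E n) \<longlonglongrightarrow> ennreal ((c powr (1 - p))\<^sup>2) * I + ennreal ?C * 0"
        by (intro tendsto_add tendsto_const ennreal_tendsto_cmult E0) auto
      ultimately show ?thesis by (intro LIMSEQ_le_const[where X="\<lambda>n. ennreal ((c powr (1 - p))\<^sup>2) * I + ennreal ?C * E n"]) auto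
    qed
    define d where "d m = 1 - 1 / real (Suc (Suc m))" for m
    have d: "0 < d m" "d m < 1" for m by (auto simp: d_def field_simps)
    have "(\<lambda>m. 1 / real (Suc m)) \<longlonglongrightarrow> 0" using LIMSEQ_inverse_real_of_nat by (simp add: inverse_eq_divide)
    then have "(\<lambda>m. 1 / real (Suc (Suc m))) \<longlonglongrightarrow> 0" by (rule LIMSEQ_Suc)
    then have "d \<longlonglongrightarrow> 1 - 0" unfolding d_def by (intro tendsto_diff tendsto_const)
    then have "(\<lambda>m. (d m powr (1 - p))\<^sup>2) \<longlonglongrightarrow> (1 powr (1 - p))\<^sup>2"
      by (intro tendsto_power tendsto_powr tendsto_const) auto
    then have "(\<lambda>m. (d m powr (1 - p))\<^sup>2) \<longlonglongrightarrow> 1" by simp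
    from le_of_factors_tendsto_1[OF step[OF d] this] show ?thesis .
  qed
  define v where "v x = indicator \<Omega> x *\<^sub>R u x" for x
  have [measurable]: "v \<in> borel_measurable (leb N)" using um by (simp add: set_borel_measurable_def v_def[abs_def])
  have [measurable]: "?V \<in> borel_measurable (leb N)" by (rule measurable_leb[OF measurable_total_weight])
  have [measurable]: "\<Omega> \<in> sets (leb N)" by (rule sets_leb[OF sets_domain])
  let ?f = "\<lambda>M x. ennreal (min (?V x) (real M) * \<bar>v x\<bar> powr p) * indicator \<Omega> x"
  have fv: "?A M = (\<integral>\<^sup>+x. ?f M x \<partial>leb N)" for M
    by (intro nn_integral_cong) (auto simp: v_def indicator_def)
  have "ennreal (\<bar>u x\<bar> powr p * ?V x) * indicator \<Omega> x \<le> (SUP M. ?f M x)" for x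
  proof (cases "x \<in> \<Omega>")
    case True
    obtain M :: nat where "?V x \<le> real M" using real_arch_simple by blast
    then have "ennreal (\<bar>u x\<bar> powr p * ?V x) * indicator \<Omega> x = ?f M x" using True by (simp add: v_def mult.commute)
    also have "?f M x \<le> (SUP M. ?f M x)" by (rule SUP_upper) simp
    finally show ?thesis .
  qed simp
  then have "(\<integral>\<^sup>+x\<in>\<Omega>. ennreal (\<bar>u x\<bar> powr p * ?V x) \<partial>leb N) \<le> (\<integral>\<^sup>+x. (SUP M. ?f M x) \<partial>leb N)"
    by (intro nn_integral_mono)
  also have "\<dots> = (SUP M. \<integral>\<^sup>+x. ?f M x \<partial>leb N)"
  proof (rule nn_integral_monotone_convergence_SUP)
    show "incseq ?f"
      by (intro incseq_SucI le_funI mult_right_mono ennreal_leI) auto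
  qed measurable
  also have "\<dots> \<le> I" unfolding fv[symmetric] by (intro SUP_least trunc)
  finally show ?thesis unfolding IG .
qed

lemma hardy_inequality_W1p0:
  assumes p: "1 < p" and adm: "admissible k p (ediam N \<Omega> / (2 * D))" and D: "0 < D"
    and u: "u \<in> W1p0 N p \<Omega>" and G: "weak_gradient N \<Omega> u G"
  shows "hardy_inequality k p N \<Omega> D u G"
proof -
  let ?d = "bdry_dist N \<Omega>"
  define A where "A = ((p - 1) / p) powr p"
  define B where "B = 1 / 2 * ((p - 1) / p) powr (p - 1)"
  define K where "K = k_const N p * defect k p (eta k (ediam N \<Omega> / (2 * D))) powr (p / (p - 1)) *
       (volume N (unit_ball N) / volume N \<Omega>) powr (p / real N)"
  have nn: "0 \<le> A" "0 \<le> B" "0 \<le> K" using k_const_nonneg[OF p] by (auto simp: A_def B_def K_def)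
  define Y where "Y i x = (\<Prod>j=1..i. (X_iter j (?d x / D))\<^sup>2)" for i x
  have Y: "0 \<le> Y i x" for i x by (auto simp: Y_def intro!: prod_nonneg)
  have um: "set_borel_measurable (leb N) \<Omega> u" using u by (auto simp: W1p0_def W1p_def Lp_def)
  define v where "v x = indicator \<Omega> x *\<^sub>R u x" for x
  have [measurable]: "v \<in> borel_measurable (leb N)" using um by (simp add: set_borel_measurable_def v_def[abs_def])
  have [measurable]: "?d \<in> borel_measurable (leb N)" by (rule measurable_leb[OF measurable_bdry_dist])
  have [measurable]: "\<Omega> \<in> sets (leb N)" by (rule sets_leb[OF sets_domain])
  have [measurable]: "Y i \<in> borel_measurable (leb N)" for i unfolding Y_def[abs_def] by measurable
  let ?f1 = "\<lambda>x. ennreal (\<bar>v x\<bar> powr p / ?d x powr p) * indicator \<Omega> x"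
  let ?f2 = "\<lambda>i x. ennreal (\<bar>v x\<bar> powr p / ?d x powr p * Y i x) * indicator \<Omega> x"
  let ?f3 = "\<lambda>x. ennreal (\<bar>v x\<bar> powr p) * indicator \<Omega> x"
  have "ennreal A * (\<integral>\<^sup>+x. ?f1 x \<partial>leb N) + ennreal B * (\<Sum>i=1..k. \<integral>\<^sup>+x. ?f2 i x \<partial>leb N) + ennreal K * (\<integral>\<^sup>+x. ?f3 x \<partial>leb N)
    = (\<integral>\<^sup>+x. ennreal A * ?f1 x + ennreal B * (\<Sum>i=1..k. ?f2 i x) + ennreal K * ?f3 x \<partial>leb N)"
    by (subst nn_integral_add, measurable, subst nn_integral_add, measurable, subst nn_integral_cmult, measurable, subst nn_integral_cmult, measurable,
        subst nn_integral_cmult, measurable, subst nn_integral_sum, measurable)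
  also have "\<dots> = (\<integral>\<^sup>+x\<in>\<Omega>. ennreal (\<bar>u x\<bar> powr p * total_weight k p D x) \<partial>leb N)"
  proof (rule nn_integral_cong)
    fix x
    show "ennreal A * ?f1 x + ennreal B * (\<Sum>i=1..k. ?f2 i x) + ennreal K * ?f3 x = ennreal (\<bar>u x\<bar> powr p * total_weight k p D x) * indicator \<Omega> x"
    proof (cases "x \<in> \<Omega>")
      case True
      then have v: "v x = u x" by (simp add: v_def)
      let ?m = "\<bar>u x\<bar> powr p"
      have "total_weight k p D x = ?d x powr (- p) * (A + B * (\<Sum>i=1..k. Y i x)) + K"
        by (simp add: total_weight_def hardy_weight_def A_def B_def K_def Xsquares_def Y_def)
      moreover have "(\<Sum>i=1..k. ?m / ?d x powr p * Y i x) = ?m / ?d x powr p * (\<Sum>i=1..k. Y i x)"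
        by (rule sum_distrib_left[symmetric])
      ultimately have "?m * total_weight k p D x = A * (?m / ?d x powr p) + B * (\<Sum>i=1..k. ?m / ?d x powr p * Y i x) + K * ?m"
        by (simp only:) (simp add: powr_minus_divide algebra_simps)
      then have "ennreal (?m * total_weight k p D x) = ennreal (A * (?m / ?d x powr p)) + ennreal (B * (\<Sum>i=1..k. ?m / ?d x powr p * Y i x)) + ennreal (K * ?m)"
        using nn Y by (simp add: sum_nonneg)
      also have "\<dots> = ennreal A * ennreal (?m / ?d x powr p) + ennreal B * (\<Sum>i=1..k. ennreal (?m / ?d x powr p * Y i x)) + ennreal K * ennreal ?m"
      proof -
        have S: "(\<Sum>i=1..k. ennreal (?m / ?d x powr p * Y i x)) = ennreal (\<Sum>i=1..k. ?m / ?d x powr p * Y i x)"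
          using Y by (intro sum_ennreal) auto
        show ?thesis unfolding S ennreal_mult'[OF nn(1)] ennreal_mult'[OF nn(2)] ennreal_mult'[OF nn(3)] ..
      qed
      finally show ?thesis using True v by simp
    qed simp
  qed
  also have "\<dots> \<le> (\<integral>\<^sup>+x\<in>\<Omega>. ennreal (L2_set (\<lambda>i. G i x) {..<N} powr p) \<partial>leb N)"
    by (rule hardy_W1p0[OF p adm D u G])
  finally have main: "ennreal A * (\<integral>\<^sup>+x. ?f1 x \<partial>leb N) + ennreal B * (\<Sum>i=1..k. \<integral>\<^sup>+x. ?f2 i x \<partial>leb N) + ennreal K * (\<integral>\<^sup>+x. ?f3 x \<partial>leb N)
     \<le> (\<integral>\<^sup>+x\<in>\<Omega>. ennreal (L2_set (\<lambda>i. G i x) {..<N} powr p) \<partial>leb N)" .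
  have e1: "(\<integral>\<^sup>+x\<in>\<Omega>. ennreal (\<bar>u x\<bar> powr p / ?d x powr p) \<partial>leb N) = (\<integral>\<^sup>+x. ?f1 x \<partial>leb N)"
    by (intro nn_integral_cong) (auto simp: v_def indicator_def)
  have e2: "(\<integral>\<^sup>+x\<in>\<Omega>. ennreal (\<bar>u x\<bar> powr p / ?d x powr p * (\<Prod>j=1..i. (X_iter j (?d x / D))\<^sup>2)) \<partial>leb N) = (\<integral>\<^sup>+x. ?f2 i x \<partial>leb N)" for i
    by (intro nn_integral_cong) (auto simp: v_def indicator_def Y_def)
  have e3: "(\<integral>\<^sup>+x\<in>\<Omega>. ennreal (\<bar>u x\<bar> powr p) \<partial>leb N) = (\<integral>\<^sup>+x. ?f3 x \<partial>leb N)"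
    by (intro nn_integral_cong) (auto simp: v_def indicator_def)
  show ?thesis
    unfolding hardy_inequality_def e1 e2 e3 using main unfolding A_def B_def K_def .
qed

end

text \<open>
  With \<open>D\<^sub>0 = \<delta> / (2 s)\<close> for this \<open>s\<close>, the condition \<open>D \<ge> D\<^sub>0\<close> means that \<open>\<delta> / (2 D)\<close> is in the admissible range
  \<open>(0, s]\<close>.
\<close>

definition threshold :: "nat \<Rightarrow> real \<Rightarrow> real" where
  "threshold k p = (SOME s. admissible k p s \<and> (p = 2 \<and> k \<ge> 1 \<longrightarrow> eta k s = 1))"

lemma threshold:
  assumes "1 < p"
  shows "admissible k p (threshold k p)" "p = 2 \<Longrightarrow> k \<ge> 1 \<Longrightarrow> eta k (threshold k p) = 1"
    "0 < threshold k p" "threshold k p \<le> 1"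
  using someI_ex[OF ex_admissible[OF assms, of k]] unfolding threshold_def[symmetric]
  by (auto simp: admissible_def)

lemma eta_inject:
  assumes "k \<ge> 1" "0 < s" "s \<le> 1" "0 < t" "t \<le> 1" "eta k s = eta k t"
  shows "s = t"
  using eta_strict_mono[of s t k] eta_strict_mono[of t s k] assms by (cases s t rule: linorder_cases) auto

theorem theoremA:
  "\<exists>D0 :: nat \<Rightarrow> real \<Rightarrow> real \<Rightarrow> real.
     (\<forall>p>1. \<forall>k. \<forall>N\<ge>1. \<forall>\<Omega>. bounded_convex_domain N \<Omega> \<longrightarrow>
        D0 k p (ediam N \<Omega>) \<ge> ediam N \<Omega> / 2 \<and>
        (\<forall>D \<ge> D0 k p (ediam N \<Omega>).
           defect k p (eta k (ediam N \<Omega> / (2 * D))) \<ge> 0 \<and>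
           (\<forall>u \<in> W1p0 N p \<Omega>. \<forall>G. weak_gradient N \<Omega> u G \<longrightarrow>
              hardy_inequality k p N \<Omega> D u G))) \<and>
     (\<forall>k\<ge>1. \<forall>\<delta>>0.
        D0 k 2 \<delta> \<ge> \<delta> / 2 \<and> eta k (\<delta> / (2 * D0 k 2 \<delta>)) = 1 \<and>
        (\<forall>E \<ge> \<delta> / 2. eta k (\<delta> / (2 * E)) = 1 \<longrightarrow> E = D0 k 2 \<delta>))"
proof (rule exI[of _ "\<lambda>k p \<delta>. \<delta> / (2 * threshold k p)"], intro conjI allI impI ballI)
  fix p :: real and k N :: nat and \<Omega> :: "(nat \<Rightarrow> real) set"
  assume p: "1 < p" and N: "N \<ge> 1" and dom: "bounded_convex_domain N \<Omega>"
  interpret convex_domain N \<Omega> using N dom by unfold_locales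
  note th = threshold[OF p, of k]
  have diam: "0 < ediam N \<Omega>" by (rule ediam_pos)
  show "ediam N \<Omega> / 2 \<le> ediam N \<Omega> / (2 * threshold k p)"
    using th diam by (intro divide_left_mono) auto
  fix D assume D: "ediam N \<Omega> / (2 * threshold k p) \<le> D"
  moreover have "0 < ediam N \<Omega> / (2 * threshold k p)" using diam th by simp
  ultimately have D0: "0 < D" by linarith
  have le: "0 < ediam N \<Omega> / (2 * D)" "ediam N \<Omega> / (2 * D) \<le> threshold k p"
    using D D0 diam th(3) by (auto simp: field_simps)
  note adm = admissible_mono[OF th(1) le]
  show "0 \<le> defect k p (eta k (ediam N \<Omega> / (2 * D)))"
    by (rule admissible_defect[OF th(1) le])
  fix u G assume "u \<in> W1p0 N p \<Omega>" "weak_gradient N \<Omega> u G"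
  then show "hardy_inequality k p N \<Omega> D u G"
    by (rule hardy_inequality_W1p0[OF p adm D0])
next
  fix k :: nat and \<delta> :: real
  assume k: "1 \<le> k" and d: "0 < \<delta>"
  note th = threshold[of 2 k, simplified]
  have s: "\<delta> / (2 * (\<delta> / (2 * threshold k 2))) = threshold k 2" using d th by simp
  show "\<delta> / 2 \<le> \<delta> / (2 * threshold k 2)" using th d by (intro divide_left_mono) auto
  show eq: "eta k (\<delta> / (2 * (\<delta> / (2 * threshold k 2)))) = 1" unfolding s using th(2) k by simp
  fix E assume E: "\<delta> / 2 \<le> E" "eta k (\<delta> / (2 * E)) = 1"
  then have E0: "0 < E" using d by linarith
  have "\<delta> / (2 * E) = threshold k 2"
    by (rule eta_inject[OF k]) (use E E0 d th eq s in \<open>auto simp: field_simps\<close>)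
  then show "E = \<delta> / (2 * threshold k 2)" using E0 d th(3) by (auto simp: field_simps)
qed

end
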